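(* Let $M$ be a compact Hermitian manifold and $T>0$. Let $u\in C^{3,2}_{x,t}(M\times[0,T))$ be a positive solution on $M\times[0,T)$ of $$\frac{\partial u}{\partial t}=G^{i\bar j}\partial_i\partial_{\bar j}u+\chi_ku_k+\chi_{\bar k}u_{\bar k}+\chi_0u,$$ where $G^{i\bar j},\chi_k,\chi_{\bar k},\chi_0$ are time-dependent, $G^{i\bar j}$ is of class $C^{3,1}_{x,t}$, $\chi_k,\chi_{\bar k},\chi_0$ are of class $C^{1,1}_{x,t}$, and $G^{i\bar j}$ is uniformly elliptic: $0<\lambda|\xi|^2\le G^{i\bar j}\xi_i\xi_{\bar j}\le\Lambda_0|\xi|^2$ on $M$ for every (nonzero) vector $\xi$, with constants $\lambda,\Lambda_0>0$. Then for $0<t_1<t_2$ (with $t_2<T$), $$\sup_{x\in M}u(x,t_1)\le C(t_1,t_2)\inf_{x\in M}u(x,t_2)$$ for $$C(t_1,t_2)=\left(\frac{t_2}{t_1}\right)^{C_2}\exp\left(\frac{C_3}{t_2-t_1}+C_1(t_2-t_1)\right),$$ where $C_1,C_2,C_3$ are constants depending only on the $C^{3,1}_{x,t}(M\times[0,T))$ norm of $G^{i\bar j}$ and the $C^{1,1}_{x,t}(M\times[0,T))$ norms of $\chi_0,\chi_k,\chi_{\bar k}$.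
   Context: $C^{k,p}_{x,t}(M\times I)$ is the set of functions on $M\times I$ whose derivatives of orders up to $(k,p)$ in $(x,t)$ exist and are continuous. Subscripts $u_k$, $u_{\bar k}$ denote derivatives $\partial_ku$, $\partial_{\bar k}u$ in local holomorphic coordinates; repeated indices are summed. The manifold $(M,\omega)$ and the ellipticity constants $\lambda,\Lambda_0$ of $G^{i\bar j}$ are fixed background data.
   Formalization: The manifold M is assumed connected (and of positive dimension): on a disconnected M the claim fails, since with all χ zero a solution equal to 1 on one component and a large constant K on another violates the inequality. *)

theory Defs
  imports "HOL-Analysis.Analysis"
begin

section \<open>Derivatives and parabolic regularity classes in Euclidean coordinates\<close>

definition dir_deriv :: "'e::real_normed_vector \<Rightarrow> ('e \<Rightarrow> 'b::real_normed_vector) \<Rightarrow> 'e \<Rightarrow> 'b" where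
  "dir_deriv v h z = vector_derivative (\<lambda>s. h (z + s *\<^sub>R v)) (at 0)"

definition d_space :: "'e::real_normed_vector \<Rightarrow> ('e \<Rightarrow> real \<Rightarrow> 'b::real_normed_vector) \<Rightarrow> 'e \<Rightarrow> real \<Rightarrow> 'b" where
  "d_space v f = (\<lambda>z t. dir_deriv v (\<lambda>y. f y t) z)"

text \<open>Taken within \<open>I\<close>, hence one-sided at an end point of \<open>I\<close> that belongs to \<open>I\<close>.\<close>

definition d_time :: "real set \<Rightarrow> ('e \<Rightarrow> real \<Rightarrow> 'b::real_normed_vector) \<Rightarrow> 'e \<Rightarrow> real \<Rightarrow> 'b" where
  "d_time I f = (\<lambda>z t. vector_derivative (f z) (at t within I))"

text \<open>The class \<open>C\<^sup>k\<^sup>,\<^sup>p\<close> in \<open>(x,t)\<close>: all mixed partial derivatives with at most \<open>k\<close> space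
  derivatives and at most \<open>p\<close> time derivatives, taken in any order, exist and are continuous
  on \<open>D \<times> I\<close>. Only meant for open \<open>D\<close>.\<close>

fun C_class :: "nat \<Rightarrow> nat \<Rightarrow> 'e::euclidean_space set \<Rightarrow> real set \<Rightarrow>
    ('e \<Rightarrow> real \<Rightarrow> 'b::real_normed_vector) \<Rightarrow> bool" where
  "C_class k p D I f \<longleftrightarrow>
     continuous_on (D \<times> I) (\<lambda>(z, t). f z t) \<and>
     (case k of 0 \<Rightarrow> True | Suc k' \<Rightarrow>
        \<forall>b\<in>Basis. (\<forall>z\<in>D. \<forall>t\<in>I. (\<lambda>s. f (z + s *\<^sub>R b) t) differentiable (at 0)) \<and>
          C_class k' p D I (d_space b f)) \<and>
     (case p of 0 \<Rightarrow> True | Suc p' \<Rightarrow>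
        (\<forall>z\<in>D. \<forall>t\<in>I. f z differentiable (at t within I)) \<and>
          C_class k p' D I (d_time I f))"

declare C_class.simps [simp del]

definition C_norm :: "nat \<Rightarrow> nat \<Rightarrow> 'e::euclidean_space set \<Rightarrow> real set \<Rightarrow>
    ('e \<Rightarrow> real \<Rightarrow> 'b::real_normed_vector) \<Rightarrow> ennreal" where
  "C_norm k p P I f =
     (SUP bs \<in> {bs \<in> lists Basis. length bs \<le> k}. SUP q \<in> {..p}. SUP z \<in> P. SUP t \<in> I.
        ennreal (norm ((d_time I ^^ q) (foldr d_space bs f) z t)))"

text \<open>Wirtinger derivatives \<open>\<partial>\<^sub>k\<close> and \<open>\<partial>\<close>-bar\<open>\<^sub>k\<close> on \<open>\<complex>\<^sup>n\<close>.\<close>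

definition dz :: "'n::finite \<Rightarrow> (complex ^ 'n \<Rightarrow> complex) \<Rightarrow> complex ^ 'n \<Rightarrow> complex" where
  "dz k h z = (dir_deriv (axis k 1) h z - \<i> * dir_deriv (axis k \<i>) h z) / 2"

definition dzbar :: "'n::finite \<Rightarrow> (complex ^ 'n \<Rightarrow> complex) \<Rightarrow> complex ^ 'n \<Rightarrow> complex" where
  "dzbar k h z = (dir_deriv (axis k 1) h z + \<i> * dir_deriv (axis k \<i>) h z) / 2"

section \<open>Complex manifolds\<close>

text \<open>A chart is a pair of a domain and a coordinate map; only the values of the coordinate
  map on the domain matter. The manifold is the whole type \<open>'a\<close>.\<close>

type_synonym ('a, 'n) chart = "'a set \<times> ('a \<Rightarrow> complex ^ 'n)"

definition chart_inv :: "('a, 'n) chart \<Rightarrow> complex ^ 'n \<Rightarrow> 'a" where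
  "chart_inv c = inv_into (fst c) (snd c)"

definition chart_image :: "('a, 'n) chart \<Rightarrow> (complex ^ 'n) set" where
  "chart_image c = snd c ` fst c"

definition is_chart :: "('a::topological_space, 'n::finite) chart \<Rightarrow> bool" where
  "is_chart c \<longleftrightarrow> open (fst c) \<and> open (chart_image c) \<and>
     homeomorphism (fst c) (chart_image c) (snd c) (chart_inv c)"

definition holomorphic_map_on :: "(complex ^ 'n::finite \<Rightarrow> complex ^ 'm::finite) \<Rightarrow> (complex ^ 'n) set \<Rightarrow> bool" where
  "holomorphic_map_on F D \<longleftrightarrow>
     (\<forall>z\<in>D. \<exists>F'. (F has_derivative F') (at z) \<and> (\<forall>a v. F' (a *s v) = a *s F' v))"

definition holomorphic_atlas :: "('a::topological_space, 'n::finite) chart set \<Rightarrow> bool" where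
  "holomorphic_atlas A \<longleftrightarrow>
     (\<forall>c\<in>A. is_chart c) \<and> (\<Union>c\<in>A. fst c) = UNIV \<and>
     (\<forall>c\<in>A. \<forall>d\<in>A. holomorphic_map_on (snd d \<circ> chart_inv c) (snd c ` (fst c \<inter> fst d)))"

section \<open>Tensor fields in local coordinates\<close>

text \<open>A (time-dependent) tensor field is given by its components \<open>F c x t\<close> in each chart \<open>c\<close>
  at each point \<open>x\<close> of the domain of \<open>c\<close>, subject to the transformation law of its type.
  If \<open>z\<close> and \<open>w\<close> are the coordinates of \<open>c\<close> and \<open>d\<close>, then \<open>jacobian c d x $ k $ i\<close> is
  \<open>\<partial>w\<^sup>k / \<partial>z\<^sup>i\<close> at \<open>x\<close>.\<close>

definition jacobian :: "('a, 'n::finite) chart \<Rightarrow> ('a, 'n) chart \<Rightarrow> 'a \<Rightarrow> complex ^ 'n ^ 'n" where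
  "jacobian c d x = (\<chi> k i. dz i (\<lambda>z. snd d (chart_inv c z) $ k) (snd c x))"

text \<open>Fields \<open>X\<^sup>k \<partial>\<^sub>k\<close> of type \<open>(1,0)\<close>.\<close>

definition vector_field_10 ::
    "('a, 'n::finite) chart set \<Rightarrow> real set \<Rightarrow> (('a, 'n) chart \<Rightarrow> 'a \<Rightarrow> real \<Rightarrow> complex ^ 'n) \<Rightarrow> bool" where
  "vector_field_10 A I X \<longleftrightarrow>
     (\<forall>c\<in>A. \<forall>d\<in>A. \<forall>x\<in>fst c \<inter> fst d. \<forall>t\<in>I. \<forall>k.
        X d x t $ k = (\<Sum>i\<in>UNIV. jacobian c d x $ k $ i * X c x t $ i))"

text \<open>Fields of type \<open>(0,1)\<close>.\<close>

definition vector_field_01 ::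
    "('a, 'n::finite) chart set \<Rightarrow> real set \<Rightarrow> (('a, 'n) chart \<Rightarrow> 'a \<Rightarrow> real \<Rightarrow> complex ^ 'n) \<Rightarrow> bool" where
  "vector_field_01 A I X \<longleftrightarrow>
     (\<forall>c\<in>A. \<forall>d\<in>A. \<forall>x\<in>fst c \<inter> fst d. \<forall>t\<in>I. \<forall>k.
        X d x t $ k = (\<Sum>i\<in>UNIV. cnj (jacobian c d x $ k $ i) * X c x t $ i))"

text \<open>Contravariant tensors \<open>G\<close> with one unbarred (first) and one barred (second) index.\<close>

definition contravariant_11 ::
    "('a, 'n::finite) chart set \<Rightarrow> real set \<Rightarrow> (('a, 'n) chart \<Rightarrow> 'a \<Rightarrow> real \<Rightarrow> complex ^ 'n ^ 'n) \<Rightarrow> bool" where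
  "contravariant_11 A I G \<longleftrightarrow>
     (\<forall>c\<in>A. \<forall>d\<in>A. \<forall>x\<in>fst c \<inter> fst d. \<forall>t\<in>I. \<forall>k l.
        G d x t $ k $ l = (\<Sum>i\<in>UNIV. \<Sum>j\<in>UNIV.
          jacobian c d x $ k $ i * G c x t $ i $ j * cnj (jacobian c d x $ l $ j)))"

definition local_rep :: "('a, 'n) chart \<Rightarrow> ('a \<Rightarrow> real \<Rightarrow> 'b) \<Rightarrow> complex ^ 'n \<Rightarrow> real \<Rightarrow> 'b" where
  "local_rep c F = (\<lambda>z t. F (chart_inv c z) t)"

definition field_C :: "('a, 'n::finite) chart set \<Rightarrow> nat \<Rightarrow> nat \<Rightarrow> real set \<Rightarrow>
    (('a, 'n) chart \<Rightarrow> 'a \<Rightarrow> real \<Rightarrow> 'b::real_normed_vector) \<Rightarrow> bool" where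
  "field_C A k p I F \<longleftrightarrow> (\<forall>c\<in>A. C_class k p (chart_image c) I (local_rep c (F c)))"

text \<open>A Hermitian metric \<open>g\<close> has components \<open>g c x $ i $ j\<close> with unbarred index \<open>i\<close> and
  barred index \<open>j\<close>.\<close>

definition hermitian_metric ::
    "('a, 'n::finite) chart set \<Rightarrow> (('a, 'n) chart \<Rightarrow> 'a \<Rightarrow> complex ^ 'n ^ 'n) \<Rightarrow> bool" where
  "hermitian_metric A g \<longleftrightarrow>
     (\<forall>c\<in>A. \<forall>d\<in>A. \<forall>x\<in>fst c \<inter> fst d. \<forall>i j.
        g c x $ i $ j = (\<Sum>k\<in>UNIV. \<Sum>l\<in>UNIV.
          jacobian c d x $ k $ i * g d x $ k $ l * cnj (jacobian c d x $ l $ j))) \<and>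
     (\<forall>c\<in>A. \<forall>x\<in>fst c. \<forall>i j. g c x $ j $ i = cnj (g c x $ i $ j)) \<and>
     (\<forall>c\<in>A. \<forall>x\<in>fst c. \<forall>v. v \<noteq> 0 \<longrightarrow>
        0 < Re (\<Sum>i\<in>UNIV. \<Sum>j\<in>UNIV. g c x $ i $ j * v $ i * cnj (v $ j))) \<and>
     (\<forall>m. field_C A m 0 UNIV (\<lambda>c x t. g c x))"

text \<open>Manifolds are connected; Hausdorffness is part of the type class.\<close>

definition compact_hermitian_manifold ::
    "('a::t2_space, 'n::finite) chart set \<Rightarrow> (('a, 'n) chart \<Rightarrow> 'a \<Rightarrow> complex ^ 'n ^ 'n) \<Rightarrow> bool" where
  "compact_hermitian_manifold A g \<longleftrightarrow>
     compact (UNIV :: 'a set) \<and> connected (UNIV :: 'a set) \<and>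
     holomorphic_atlas A \<and> hermitian_metric A g"

text \<open>The sesquilinear form \<open>H\<^sup>i\<^sup>j \<xi>\<^sub>i cnj \<xi>\<^sub>j\<close> on covectors, and the norm of covectors
  for the dual metric. The transpose comes from the index convention for the inverse metric:
  the sum over \<open>j\<close> of \<open>g\<^sup>i\<^sup>j g\<^sub>k\<^sub>j\<close> is the Kronecker delta of \<open>i\<close> and \<open>k\<close>, where \<open>j\<close> is the
  barred index.\<close>

definition covector_form :: "complex ^ 'n ^ 'n \<Rightarrow> complex ^ 'n::finite \<Rightarrow> complex" where
  "covector_form H \<xi> = (\<Sum>i\<in>UNIV. \<Sum>j\<in>UNIV. H $ i $ j * \<xi> $ i * cnj (\<xi> $ j))"

definition covector_norm2 :: "complex ^ 'n ^ 'n \<Rightarrow> complex ^ 'n::finite \<Rightarrow> real" where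
  "covector_norm2 h \<xi> = Re (covector_form (matrix_inv (transpose h)) \<xi>)"

definition uniformly_elliptic :: "('a, 'n::finite) chart set \<Rightarrow> (('a, 'n) chart \<Rightarrow> 'a \<Rightarrow> complex ^ 'n ^ 'n) \<Rightarrow>
    real set \<Rightarrow> real \<Rightarrow> real \<Rightarrow> (('a, 'n) chart \<Rightarrow> 'a \<Rightarrow> real \<Rightarrow> complex ^ 'n ^ 'n) \<Rightarrow> bool" where
  "uniformly_elliptic A g I lam Lam G \<longleftrightarrow>
     (\<forall>c\<in>A. \<forall>x\<in>fst c. \<forall>t\<in>I. \<forall>\<xi>. \<xi> \<noteq> 0 \<longrightarrow>
        covector_form (G c x t) \<xi> \<in> \<real> \<and>
        0 < lam * covector_norm2 (g c x) \<xi> \<and>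
        lam * covector_norm2 (g c x) \<xi> \<le> Re (covector_form (G c x t) \<xi>) \<and>
        Re (covector_form (G c x t) \<xi>) \<le> Lam * covector_norm2 (g c x) \<xi>)"

section \<open>Norms of fields on a compact manifold\<close>

text \<open>Global norms are taken with respect to a fixed finite family of compact sets, each inside
  the domain of a chart, that together cover the manifold. Different families give equivalent
  norms.\<close>

definition norm_cover :: "('a::topological_space, 'n::finite) chart set \<Rightarrow> (('a, 'n) chart \<times> 'a set) set \<Rightarrow> bool" where
  "norm_cover A S \<longleftrightarrow> finite S \<and> (\<forall>(c, K)\<in>S. c \<in> A \<and> compact K \<and> K \<subseteq> fst c) \<and>
     (\<Union>(c, K)\<in>S. K) = UNIV"

definition field_norm :: "(('a, 'n::finite) chart \<times> 'a set) set \<Rightarrow> nat \<Rightarrow> nat \<Rightarrow> real set \<Rightarrow>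
    (('a, 'n) chart \<Rightarrow> 'a \<Rightarrow> real \<Rightarrow> 'b::real_normed_vector) \<Rightarrow> ennreal" where
  "field_norm S k p I F = (SUP (c, K) \<in> S. C_norm k p (snd c ` K) I (local_rep c (F c)))"

lemma norm_cover_exists:
  fixes A :: "('a::t2_space, 'n::finite) chart set"
  assumes cpt: "compact (UNIV :: 'a set)" and A: "holomorphic_atlas A"
  shows "\<exists>S. norm_cover A S"
proof -
  have "\<exists>c K O'. c \<in> A \<and> compact K \<and> K \<subseteq> fst c \<and> open O' \<and> x \<in> O' \<and> O' \<subseteq> K" for x
  proof -
    obtain c where c: "c \<in> A" "x \<in> fst c"
      using A unfolding holomorphic_atlas_def by blast
    have ch: "open (fst c)" "open (chart_image c)"
      and hom: "homeomorphism (fst c) (chart_image c) (snd c) (chart_inv c)"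
      using A c unfolding holomorphic_atlas_def is_chart_def by blast+
    have "snd c x \<in> chart_image c"
      using c by (auto simp: chart_image_def)
    then obtain e where e: "e > 0" "cball (snd c x) e \<subseteq> chart_image c"
      using ch(2) open_contains_cball by blast
    let ?K = "chart_inv c ` cball (snd c x) e"
    let ?O = "snd c -` ball (snd c x) e \<inter> fst c"
    have "compact ?K"
      using hom e(2) by (intro compact_continuous_image)
        (auto simp: homeomorphism_def intro: continuous_on_subset)
    moreover have "?K \<subseteq> fst c"
      using hom e(2) unfolding homeomorphism_def by blast
    moreover have "open ?O"
      using hom ch(1) continuous_on_open_vimage[of "fst c" "snd c"]
      unfolding homeomorphism_def by blast
    moreover have "x \<in> ?O"
      using c e by auto
    moreover have "?O \<subseteq> ?K"
    proof
      fix y assume y: "y \<in> ?O"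
      then have "chart_inv c (snd c y) = y"
        using hom unfolding homeomorphism_def by blast
      moreover have "snd c y \<in> cball (snd c x) e"
        using y ball_subset_cball by blast
      ultimately show "y \<in> ?K"
        by (metis imageI)
    qed
    ultimately show ?thesis
      using c(1) by blast
  qed
  then obtain cc KK VV where *: "\<And>x. cc x \<in> A \<and> compact (KK x) \<and> KK x \<subseteq> fst (cc x) \<and>
      open (VV x) \<and> x \<in> VV x \<and> VV x \<subseteq> KK x"
    by metis
  have cover: "UNIV \<subseteq> (\<Union>x\<in>UNIV. VV x)"
    using * by blast
  obtain X where X: "finite X" "UNIV \<subseteq> (\<Union>x\<in>X. VV x)"
    by (rule compactE_image[OF cpt _ cover]) (simp_all add: *)
  have "(\<Union>x\<in>X. KK x) = UNIV"
    using X(2) * by blast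
  then have "norm_cover A ((\<lambda>x. (cc x, KK x)) ` X)"
    unfolding norm_cover_def using X(1) * by (simp add: image_image)
  then show ?thesis ..
qed

end

theory Submission
  imports Defs
begin

text \<open>Li and Yau's method. Put \<open>f = ln u\<close>, \<open>Q = G\<^sup>i\<^sup>j \<partial>\<^sub>i f \<partial>\<close>-bar\<open>\<^sub>j f\<close> and \<open>P = Q - 2 \<partial>\<^sub>t f\<close>, which does not
  depend on the chart. At a point where \<open>t P\<close> is maximal, \<open>0 \<ge> G\<^sup>i\<^sup>j \<partial>\<^sub>i \<partial>\<close>-bar\<open>\<^sub>j P - \<partial>\<^sub>t P - P / t\<close>. Differentiating
  the equation for \<open>f\<close> eliminates the third derivatives of \<open>f\<close> and the derivatives of \<open>\<partial>\<^sub>t f\<close>, and what is left is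
  \<open>\<lambda>\<^sup>2 \<bar>\<nabla>\<^sup>2f\<bar>\<^sup>2 \<le> P / t + C (\<bar>\<nabla>f\<bar>\<^sup>2 + \<bar>\<nabla>f\<bar> \<bar>\<nabla>\<^sup>2f\<bar> + \<bar>\<nabla>\<^sup>2f\<bar> + 1)\<close>. The equation for \<open>f\<close> also bounds \<open>P + Q\<close> linearly
  in \<open>\<bar>\<nabla>f\<bar>\<close> and \<open>\<bar>\<nabla>\<^sup>2f\<bar>\<close>, so \<open>P \<le> B (1 / t + 1)\<close> at that point and hence everywhere, with \<open>B\<close> depending on
  pointwise bounds of the coefficients only.

  Along a straight segment in a coordinate ball, traversed at constant speed, this bound on \<open>P\<close> absorbs the
  gradient term of \<open>df/dt\<close> and yields the Harnack inequality for points of the same ball. By compactness and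
  connectedness any two points are joined by a chain of balls of fixed length, and the time interval is divided
  equally along the chain.\<close>

section \<open>Calculus in the parabolic classes\<close>

text \<open>Bounds on the coefficients are available only in the charts of \<open>S\<close>, on its
  compact pieces, while the derivatives that occur are plain coordinate derivatives. Since
  \<open>P\<close> is a scalar on the manifold, its maximum may be read off in a chart of
  \<open>S\<close>, and the whole computation takes place in that chart with real partial
  derivatives: no connection, no curvature and, \<open>M\<close> being compact, no cutoff function.
  The factor 2 in \<open>P\<close> matters. With \<open>Q - \<partial>_t f\<close> the equation
  would express \<open>P\<close> by the Hessian and lower order terms and leave the gradient
  uncontrolled; with 2 an extra \<open>Q\<close> appears next to \<open>P\<close>, so the Hessian
  controls \<open>P\<close> and the gradient at once. The weight \<open>t\<close> makes
  \<open>t P\<close> vanish at time 0, so nothing about the initial values of \<open>u\<close>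
  enters, and maximising over [0, t] with t < T keeps the constants free of \<open>T\<close>. The
  ellipticity constants of the metric, the coordinate balls and the chain length are fixed before
  any solution is given. Hence \<open>C3\<close> depends on the background only, while
  \<open>C1\<close> and \<open>C2\<close> come from the two summands of
  \<open>B (1 / t + 1)\<close>, with \<open>B\<close> a function of the sum of the four
  norms.\<close>

lemma C_classI:
  assumes "continuous_on (D \<times> I) (\<lambda>(z, t). f z t)"
    and "\<And>k' b z t. k = Suc k' \<Longrightarrow> b \<in> Basis \<Longrightarrow> z \<in> D \<Longrightarrow> t \<in> I \<Longrightarrow>
          (\<lambda>s. f (z + s *\<^sub>R b) t) differentiable (at 0)"
    and "\<And>k' b. k = Suc k' \<Longrightarrow> b \<in> Basis \<Longrightarrow> C_class k' p D I (d_space b f)"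
    and "\<And>p' z t. p = Suc p' \<Longrightarrow> z \<in> D \<Longrightarrow> t \<in> I \<Longrightarrow> f z differentiable (at t within I)"
    and "\<And>p'. p = Suc p' \<Longrightarrow> C_class k p' D I (d_time I f)"
  shows "C_class k p D I f"
  using assms by (subst C_class.simps) (auto split: nat.split)

lemma C_class_continuous: "C_class k p D I f \<Longrightarrow> continuous_on (D \<times> I) (\<lambda>(z, t). f z t)"
  by (subst (asm) C_class.simps) simp

lemma C_class_space:
  assumes "C_class (Suc k) p D I f" "b \<in> Basis"
  shows "C_class k p D I (d_space b f)"
  using assms by (subst (asm) C_class.simps) simp

lemma C_class_time:
  assumes "C_class k (Suc p) D I f"
  shows "C_class k p D I (d_time I f)"
  using assms by (subst (asm) C_class.simps) simp

lemma C_class_has_deriv_space: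
  assumes "C_class (Suc k) p D I f" "b \<in> Basis" "z \<in> D" "t \<in> I"
  shows "((\<lambda>s. f (z + s *\<^sub>R b) t) has_vector_derivative d_space b f z t) (at 0)"
  using assms unfolding d_space_def dir_deriv_def
  by (subst (asm) C_class.simps) (simp add: vector_derivative_works[symmetric])

lemma C_class_has_deriv_time:
  assumes "C_class k (Suc p) D I f" "z \<in> D" "t \<in> I"
  shows "(f z has_vector_derivative d_time I f z t) (at t within I)"
  using assms unfolding d_time_def
  by (subst (asm) C_class.simps) (simp add: vector_derivative_works[symmetric])

text \<open>Each clause of the class gives up one space or one time derivative, so
  \<open>k + p\<close> is the measure of this induction and of those below.\<close>

lemma C_class_mono:
  fixes D :: "'e::euclidean_space set"
  assumes "C_class k p D I f" "k' \<le> k" "p' \<le> p"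
  shows "C_class k' p' D I f"
  using assms
proof (induction "k + p" arbitrary: k p k' p' f rule: less_induct)
  case less
  show ?case
  proof (rule C_classI)
    show "continuous_on (D \<times> I) (\<lambda>(z, t). f z t)"
      using less.prems(1) by (rule C_class_continuous)
  next
    fix j z t and b :: 'e assume "k' = Suc j" "b \<in> Basis" "z \<in> D" "t \<in> I"
    moreover then obtain i where "k = Suc i" using less.prems by (cases k) auto
    ultimately show "(\<lambda>s. f (z + s *\<^sub>R b) t) differentiable at 0"
      using C_class_has_deriv_space less.prems(1) differentiableI_vector by metis
  next
    fix j and b :: 'e assume *: "k' = Suc j" "b \<in> Basis"
    then obtain i where i: "k = Suc i" using less.prems by (cases k) auto
    show "C_class j p' D I (d_space b f)"
      by (rule less.hyps[of i p]) (use i * less.prems C_class_space in auto)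
  next
    fix j z t assume "p' = Suc j" "z \<in> D" "t \<in> I"
    moreover then obtain i where "p = Suc i" using less.prems by (cases p) auto
    ultimately show "f z differentiable at t within I"
      using C_class_has_deriv_time less.prems(1) differentiableI_vector by metis
  next
    fix j assume *: "p' = Suc j"
    then obtain i where i: "p = Suc i" using less.prems by (cases p) auto
    show "C_class k' j D I (d_time I f)"
      by (rule less.hyps[of k i]) (use i * less.prems C_class_time in auto)
  qed
qed

text \<open>Openness keeps short segments inside \<open>D\<close>. The second assumption makes
  derivatives within \<open>I\<close> unique, so that \<open>d_time\<close> is determined also at an
  end point such as 0 in \<open>{0..<T}\<close>.\<close>

locale space_time =
  fixes D :: "'e::euclidean_space set" and I :: "real set"
  assumes open_D: "open D"
    and nontrivial_I: "t \<in> I \<Longrightarrow> at t within I \<noteq> bot"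
begin

abbreviation C :: "nat \<Rightarrow> nat \<Rightarrow> ('e \<Rightarrow> real \<Rightarrow> 'b::real_normed_vector) \<Rightarrow> bool" where
  "C k p \<equiv> C_class k p D I"

lemma eventually_line_in:
  assumes "z \<in> D"
  shows "eventually (\<lambda>s. z + s *\<^sub>R b \<in> D) (nhds 0)"
proof -
  have "open ((\<lambda>s. z + s *\<^sub>R b) -` D)"
    by (intro open_vimage open_D continuous_intros)
  then show ?thesis
    using assms by (intro eventually_nhds[THEN iffD2]) auto
qed

lemma has_deriv_line_cong:
  assumes "\<And>y. y \<in> D \<Longrightarrow> h y = k y" "z \<in> D"
  shows "((\<lambda>s. h (z + s *\<^sub>R b)) has_vector_derivative d) (at 0) \<longleftrightarrow>
    ((\<lambda>s. k (z + s *\<^sub>R b)) has_vector_derivative d) (at 0)"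
proof (rule has_vector_derivative_cong_ev)
  show "\<forall>\<^sub>F s in nhds 0. s \<in> UNIV \<longrightarrow> h (z + s *\<^sub>R b) = k (z + s *\<^sub>R b)"
    using eventually_line_in[OF assms(2), of b] by eventually_elim (use assms in auto)
qed (use assms in auto)

lemma d_space_eqI:
  assumes "((\<lambda>s. f (z + s *\<^sub>R b) t) has_vector_derivative d) (at 0)"
  shows "d_space b f z t = d"
  using assms unfolding d_space_def dir_deriv_def by (rule vector_derivative_at)

lemma d_time_eqI:
  assumes "(f z has_vector_derivative d) (at t within I)" "t \<in> I"
  shows "d_time I f z t = d"
  using assms nontrivial_I unfolding d_time_def by (intro vector_derivative_within) auto

text \<open>Both sides choose from the same set of candidate derivatives, so they agree whether or
  not one exists.\<close>

lemma d_space_cong: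
  assumes "\<And>y. y \<in> D \<Longrightarrow> f y t = g y t" "z \<in> D"
  shows "d_space b f z t = d_space b g z t"
  unfolding d_space_def dir_deriv_def vector_derivative_def
  using has_deriv_line_cong[of "\<lambda>y. f y t" "\<lambda>y. g y t", OF assms] by simp

lemma d_time_cong:
  assumes "\<And>s. s \<in> I \<Longrightarrow> f z s = g z s" "t \<in> I"
  shows "d_time I f z t = d_time I g z t"
  unfolding d_time_def vector_derivative_def
  by (intro arg_cong[where f = Eps] ext has_vector_derivative_cong_ev) (use assms in auto)

text \<open>Local representatives have arbitrary values outside the chart image, and formulas for
  derivatives hold only on \<open>D\<close> and \<open>I\<close>; this lets a function be replaced
  by one that agrees with it there.\<close>

lemma C_cong:
  assumes "C k p f" "\<And>z t. z \<in> D \<Longrightarrow> t \<in> I \<Longrightarrow> f z t = g z t"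
  shows "C k p g"
  using assms
proof (induction "k + p" arbitrary: k p f g rule: less_induct)
  case less
  show ?case
  proof (rule C_classI)
    show "continuous_on (D \<times> I) (\<lambda>(z, t). g z t)"
      using C_class_continuous[OF less.prems(1)]
      by (rule continuous_on_eq) (use less.prems in auto)
  next
    fix j z t and b :: 'e assume *: "k = Suc j" "b \<in> Basis" "z \<in> D" "t \<in> I"
    have "((\<lambda>s. f (z + s *\<^sub>R b) t) has_vector_derivative d_space b f z t) (at 0)"
      using C_class_has_deriv_space less.prems * by blast
    then have "((\<lambda>s. g (z + s *\<^sub>R b) t) has_vector_derivative d_space b f z t) (at 0)"
      using has_deriv_line_cong[of "\<lambda>y. f y t" "\<lambda>y. g y t" z b] less.prems * by simp
    then show "(\<lambda>s. g (z + s *\<^sub>R b) t) differentiable at 0"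
      by (rule differentiableI_vector)
  next
    fix j and b :: 'e assume *: "k = Suc j" "b \<in> Basis"
    show "C j p (d_space b g)"
      by (rule less.hyps[of j p "d_space b f"])
        (use * less.prems in \<open>auto intro: C_class_space intro!: d_space_cong\<close>)
  next
    fix j z t assume *: "p = Suc j" "z \<in> D" "t \<in> I"
    have "(f z has_vector_derivative d_time I f z t) (at t within I)"
      using C_class_has_deriv_time less.prems * by blast
    then have "(g z has_vector_derivative d_time I f z t) (at t within I)"
      by (rule has_vector_derivative_transform[rotated -1]) (use less.prems * in auto)
    then show "g z differentiable at t within I"
      by (rule differentiableI_vector)
  next
    fix j assume *: "p = Suc j"
    show "C k j (d_time I g)"
      by (rule less.hyps[of k j "d_time I f"])
        (use * less.prems in \<open>auto intro: C_class_time intro!: d_time_cong\<close>)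
  qed
qed

text \<open>Closure of the classes under an operation follows by induction once the operation
  preserves continuity and its derivatives are known.\<close>

lemma C_step:
  assumes "continuous_on (D \<times> I) (\<lambda>(z, t). f z t)"
    and "\<And>j b z t. k = Suc j \<Longrightarrow> b \<in> Basis \<Longrightarrow> z \<in> D \<Longrightarrow> t \<in> I \<Longrightarrow>
          ((\<lambda>s. f (z + s *\<^sub>R b) t) has_vector_derivative S b z t) (at 0)"
    and "\<And>j b. k = Suc j \<Longrightarrow> b \<in> Basis \<Longrightarrow> C j p (S b)"
    and "\<And>j z t. p = Suc j \<Longrightarrow> z \<in> D \<Longrightarrow> t \<in> I \<Longrightarrow>
          (f z has_vector_derivative R z t) (at t within I)"
    and "\<And>j. p = Suc j \<Longrightarrow> C k j R"
  shows "C k p f"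
proof (rule C_classI)
  fix j and b :: 'e assume *: "k = Suc j" "b \<in> Basis"
  show "C j p (d_space b f)"
    by (rule C_cong[OF assms(3)[OF *]]) (use * assms(2) d_space_eqI in metis)
next
  fix j assume *: "p = Suc j"
  show "C k j (d_time I f)"
    by (rule C_cong[OF assms(5)[OF *]]) (use * assms(4) d_time_eqI in metis)
qed (use assms differentiableI_vector in blast)+

lemma C_const: "C k p (\<lambda>z t. c)"
proof (induction "k + p" arbitrary: k p c rule: less_induct)
  case less
  show ?case
    by (rule C_step[where S = "\<lambda>b z t. 0" and R = "\<lambda>z t. 0"]) (use less in \<open>auto intro!: continuous_intros\<close>)
qed

lemma C_linear:
  assumes L: "bounded_linear L" and "C k p f"
  shows "C k p (\<lambda>z t. L (f z t))"
  using assms(2)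
proof (induction "k + p" arbitrary: k p f rule: less_induct)
  case less
  show ?case
  proof (rule C_step[where S = "\<lambda>b z t. L (d_space b f z t)" and R = "\<lambda>z t. L (d_time I f z t)"])
    show "continuous_on (D \<times> I) (\<lambda>(z, t). L (f z t))"
      using bounded_linear.continuous_on[OF L C_class_continuous[OF less.prems]]
      by (simp add: case_prod_unfold)
  qed (use less in \<open>auto intro!: bounded_linear.has_vector_derivative[OF L] less.hyps
      intro: C_class_has_deriv_space C_class_has_deriv_time C_class_space C_class_time\<close>)
qed

lemmas C_minus = C_linear[OF bounded_linear_minus[OF bounded_linear_ident]]

lemma C_add:
  assumes "C k p f" "C k p g"
  shows "C k p (\<lambda>z t. f z t + g z t)"
  using assms
proof (induction "k + p" arbitrary: k p f g rule: less_induct)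
  case less
  show ?case
  proof (rule C_step[where S = "\<lambda>b z t. d_space b f z t + d_space b g z t"
        and R = "\<lambda>z t. d_time I f z t + d_time I g z t"])
    show "continuous_on (D \<times> I) (\<lambda>(z, t). f z t + g z t)"
      using continuous_on_add[OF C_class_continuous[OF less.prems(1)] C_class_continuous[OF less.prems(2)]]
      by (simp add: case_prod_unfold)
  qed (use less in \<open>auto intro!: has_vector_derivative_add less.hyps
      intro: C_class_has_deriv_space C_class_has_deriv_time C_class_space C_class_time\<close>)
qed

lemma C_sum:
  assumes "\<And>i. i \<in> B \<Longrightarrow> C k p (f i)"
  shows "C k p (\<lambda>z t. \<Sum>i\<in>B. f i z t)"
  using assms
  by (induction B rule: infinite_finite_induct) (auto intro: C_const C_add)

lemma C_mult:
  fixes f g :: "'e \<Rightarrow> real \<Rightarrow> real"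
  assumes "C k p f" "C k p g"
  shows "C k p (\<lambda>z t. f z t * g z t)"
  using assms
proof (induction "k + p" arbitrary: k p f g rule: less_induct)
  case less
  have 1: "C j p f \<and> C j p g" if "k = Suc j" for j
    using less.prems that C_class_mono by (metis le_SucI le_refl)
  have 2: "C k j f \<and> C k j g" if "p = Suc j" for j
    using less.prems that C_class_mono by (metis le_SucI le_refl)
  show ?case
  proof (rule C_step[where S = "\<lambda>b z t. f z t * d_space b g z t + d_space b f z t * g z t"
        and R = "\<lambda>z t. f z t * d_time I g z t + d_time I f z t * g z t"])
    show "continuous_on (D \<times> I) (\<lambda>(z, t). f z t * g z t)"
      using continuous_on_mult[OF C_class_continuous[OF less.prems(1)] C_class_continuous[OF less.prems(2)]]
      by (simp add: case_prod_unfold)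
  next
    fix j z t and b :: 'e assume *: "k = Suc j" "b \<in> Basis" "z \<in> D" "t \<in> I"
    then show "((\<lambda>s. f (z + s *\<^sub>R b) t * g (z + s *\<^sub>R b) t) has_vector_derivative
        f z t * d_space b g z t + d_space b f z t * g z t) (at 0)"
      using has_vector_derivative_mult[OF C_class_has_deriv_space C_class_has_deriv_space] less.prems
      by fastforce
  next
    fix j z t assume *: "p = Suc j" "z \<in> D" "t \<in> I"
    then show "((\<lambda>t. f z t * g z t) has_vector_derivative
        f z t * d_time I g z t + d_time I f z t * g z t) (at t within I)"
      using has_vector_derivative_mult[OF C_class_has_deriv_time C_class_has_deriv_time] less.prems
      by fastforce
  qed (use less 1 2 in \<open>auto intro!: C_add less.hyps intro: C_class_space C_class_time\<close>)
qed

text \<open>The derivative of a reciprocal contains the same reciprocal, now needed to one order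
  less. So \<open>f\<close> stays fixed and only the orders vary in the induction.\<close>

lemma C_inverse:
  fixes f :: "'e \<Rightarrow> real \<Rightarrow> real"
  assumes "C k p f" "\<And>z t. z \<in> D \<Longrightarrow> t \<in> I \<Longrightarrow> f z t \<noteq> 0"
  shows "C k p (\<lambda>z t. inverse (f z t))"
  using assms(1)
proof (induction "k + p" arbitrary: k p rule: less_induct)
  case less
  have 1: "C j p f" if "k = Suc j" for j
    using less.prems that C_class_mono by (metis le_SucI le_refl)
  have 2: "C k j f" if "p = Suc j" for j
    using less.prems that C_class_mono by (metis le_SucI le_refl)
  show ?case
  proof (rule C_step[where S = "\<lambda>b z t. - (inverse (f z t) * d_space b f z t * inverse (f z t))"
        and R = "\<lambda>z t. - (inverse (f z t) * d_time I f z t * inverse (f z t))"])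
    show "continuous_on (D \<times> I) (\<lambda>(z, t). inverse (f z t))"
      using continuous_on_inverse[OF C_class_continuous[OF less.prems(1)]] assms(2)
      by (force simp: case_prod_unfold)
  next
    fix j z t and b :: 'e assume *: "k = Suc j" "b \<in> Basis" "z \<in> D" "t \<in> I"
    have "((\<lambda>s. f (z + s *\<^sub>R b) t) has_real_derivative d_space b f z t) (at 0)"
      using C_class_has_deriv_space less.prems * by (metis has_real_derivative_iff_has_vector_derivative)
    from DERIV_inverse'[OF this]
    show "((\<lambda>s. inverse (f (z + s *\<^sub>R b) t)) has_vector_derivative
        - (inverse (f z t) * d_space b f z t * inverse (f z t))) (at 0)"
      using assms(2) * by (simp add: has_real_derivative_iff_has_vector_derivative)
  next
    fix j z t assume *: "p = Suc j" "z \<in> D" "t \<in> I"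
    have "(f z has_real_derivative d_time I f z t) (at t within I)"
      using C_class_has_deriv_time less.prems * by (metis has_real_derivative_iff_has_vector_derivative)
    from DERIV_inverse'[OF this]
    show "((\<lambda>s. inverse (f z s)) has_vector_derivative
        - (inverse (f z t) * d_time I f z t * inverse (f z t))) (at t within I)"
      using assms(2) * by (simp add: has_real_derivative_iff_has_vector_derivative)
  qed (use less 1 2 in \<open>auto intro!: C_minus C_mult less.hyps intro: C_class_space C_class_time\<close>)
qed

lemma C_ln:
  fixes f :: "'e \<Rightarrow> real \<Rightarrow> real"
  assumes "C k p f" "\<And>z t. z \<in> D \<Longrightarrow> t \<in> I \<Longrightarrow> f z t > 0"
  shows "C k p (\<lambda>z t. ln (f z t))"
proof -
  \<comment> \<open>Stated for all smaller orders so that it survives the induction, where it is a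
    factor of the derivative of the logarithm.\<close>
  have 0: "C k' p' (\<lambda>z t. inverse (f z t))" if "k' \<le> k" "p' \<le> p" for k' p'
    using C_inverse[OF C_class_mono[OF assms(1) that]] assms(2) by (metis less_irrefl)
  show ?thesis
    using assms(1) 0
  proof (induction "k + p" arbitrary: k p rule: less_induct)
    case less
    show ?case
    proof (rule C_step[where S = "\<lambda>b z t. inverse (f z t) * d_space b f z t"
          and R = "\<lambda>z t. inverse (f z t) * d_time I f z t"])
      show "continuous_on (D \<times> I) (\<lambda>(z, t). ln (f z t))"
        using continuous_on_ln[OF C_class_continuous[OF less.prems(1)]] assms(2)
        by (force simp: case_prod_unfold)
    next
      fix j z t and b :: 'e assume *: "k = Suc j" "b \<in> Basis" "z \<in> D" "t \<in> I"
      have "((\<lambda>s. f (z + s *\<^sub>R b) t) has_real_derivative d_space b f z t) (at 0)"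
        using C_class_has_deriv_space less.prems * by (metis has_real_derivative_iff_has_vector_derivative)
      from DERIV_chain2[OF DERIV_ln this]
      show "((\<lambda>s. ln (f (z + s *\<^sub>R b) t)) has_vector_derivative
          inverse (f z t) * d_space b f z t) (at 0)"
        using assms(2) * by (simp add: has_real_derivative_iff_has_vector_derivative)
    next
      fix j z t assume *: "p = Suc j" "z \<in> D" "t \<in> I"
      have "(f z has_real_derivative d_time I f z t) (at t within I)"
        using C_class_has_deriv_time less.prems * by (metis has_real_derivative_iff_has_vector_derivative)
      from DERIV_chain2[OF DERIV_ln this]
      show "((\<lambda>s. ln (f z s)) has_vector_derivative
          inverse (f z t) * d_time I f z t) (at t within I)"
        using assms(2) * by (simp add: has_real_derivative_iff_has_vector_derivative)
    qed (use less in \<open>auto intro!: C_mult intro: C_class_space C_class_time\<close>)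
  qed
qed

lemma d_space_linear:
  assumes "bounded_linear L" "C 1 0 f" "b \<in> Basis" "z \<in> D" "t \<in> I"
  shows "d_space b (\<lambda>z t. L (f z t)) z t = L (d_space b f z t)"
  by (rule d_space_eqI) (use assms in \<open>auto intro!: bounded_linear.has_vector_derivative[OF assms(1)] C_class_has_deriv_space\<close>)

lemma d_time_linear:
  assumes "bounded_linear L" "C 0 1 f" "z \<in> D" "t \<in> I"
  shows "d_time I (\<lambda>z t. L (f z t)) z t = L (d_time I f z t)"
  by (rule d_time_eqI) (use assms in \<open>auto intro!: bounded_linear.has_vector_derivative[OF assms(1)] C_class_has_deriv_time\<close>)

lemma d_space_add:
  assumes "C 1 0 f" "C 1 0 g" "b \<in> Basis" "z \<in> D" "t \<in> I"
  shows "d_space b (\<lambda>z t. f z t + g z t) z t = d_space b f z t + d_space b g z t"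
  by (rule d_space_eqI) (use assms in \<open>auto intro!: has_vector_derivative_add C_class_has_deriv_space\<close>)

lemma d_time_add:
  assumes "C 0 1 f" "C 0 1 g" "z \<in> D" "t \<in> I"
  shows "d_time I (\<lambda>z t. f z t + g z t) z t = d_time I f z t + d_time I g z t"
  by (rule d_time_eqI) (use assms in \<open>auto intro!: has_vector_derivative_add C_class_has_deriv_time\<close>)

lemma d_space_sum:
  assumes "\<And>i. i \<in> B \<Longrightarrow> C 1 0 (f i)" "b \<in> Basis" "z \<in> D" "t \<in> I"
  shows "d_space b (\<lambda>z t. \<Sum>i\<in>B. f i z t) z t = (\<Sum>i\<in>B. d_space b (f i) z t)"
  by (rule d_space_eqI) (use assms in \<open>auto intro!: has_vector_derivative_sum C_class_has_deriv_space\<close>)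

lemma d_time_sum:
  assumes "\<And>i. i \<in> B \<Longrightarrow> C 0 1 (f i)" "z \<in> D" "t \<in> I"
  shows "d_time I (\<lambda>z t. \<Sum>i\<in>B. f i z t) z t = (\<Sum>i\<in>B. d_time I (f i) z t)"
  by (rule d_time_eqI) (use assms in \<open>auto intro!: has_vector_derivative_sum C_class_has_deriv_time\<close>)

lemma d_space_mult:
  fixes f g :: "'e \<Rightarrow> real \<Rightarrow> real"
  assumes "C 1 0 f" "C 1 0 g" "b \<in> Basis" "z \<in> D" "t \<in> I"
  shows "d_space b (\<lambda>z t. f z t * g z t) z t = d_space b f z t * g z t + f z t * d_space b g z t"
proof -
  have f: "((\<lambda>s. f (z + s *\<^sub>R b) t) has_vector_derivative d_space b f z t) (at 0)"
    using C_class_has_deriv_space[of 0 0 D I f] assms by simp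
  have g: "((\<lambda>s. g (z + s *\<^sub>R b) t) has_vector_derivative d_space b g z t) (at 0)"
    using C_class_has_deriv_space[of 0 0 D I g] assms by simp
  show ?thesis
    using d_space_eqI[of "\<lambda>z t. f z t * g z t" z b t, OF has_vector_derivative_mult[OF f g]]
    by simp
qed

lemma d_time_mult:
  fixes f g :: "'e \<Rightarrow> real \<Rightarrow> real"
  assumes "C 0 1 f" "C 0 1 g" "z \<in> D" "t \<in> I"
  shows "d_time I (\<lambda>z t. f z t * g z t) z t = d_time I f z t * g z t + f z t * d_time I g z t"
proof -
  have f: "(f z has_vector_derivative d_time I f z t) (at t within I)"
    using C_class_has_deriv_time[of 0 0 D I f] assms by simp
  have g: "(g z has_vector_derivative d_time I g z t) (at t within I)"
    using C_class_has_deriv_time[of 0 0 D I g] assms by simp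
  show ?thesis
    using d_time_eqI[of "\<lambda>z t. f z t * g z t" z, OF has_vector_derivative_mult[OF f g]] assms
    by simp
qed

end

section \<open>Total derivatives from partial derivatives, and Schwarz's theorem\<close>

lemma mvt_line:
  fixes h :: "real \<Rightarrow> real"
  assumes "\<And>s. \<bar>s\<bar> \<le> \<bar>r\<bar> \<Longrightarrow> (h has_real_derivative h' s) (at s)"
  obtains \<xi> where "\<bar>\<xi>\<bar> \<le> \<bar>r\<bar>" "h r - h 0 = r * h' \<xi>"
proof (cases "r = 0")
  case True
  then show ?thesis using that[of 0] by simp
next
  case False
  consider "0 < r" | "r < 0" using False by linarith
  then show ?thesis
  proof cases
    case 1
    obtain \<xi> where "\<xi> > 0" "\<xi> < r" "h r - h 0 = (r - 0) * h' \<xi>"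
      using MVT2[of 0 r h h'] assms 1 by auto
    then show ?thesis using that[of \<xi>] by auto
  next
    case 2
    obtain \<xi> where "\<xi> > r" "\<xi> < 0" "h 0 - h r = (0 - r) * h' \<xi>"
      using MVT2[of r 0 h h'] assms 2 by auto
    then show ?thesis using that[of \<xi>] by auto
  qed
qed

text \<open>The coordinates are changed one at a time and the mean value theorem is applied to each
  change. The classes provide partial derivatives only; the total derivative is needed for oblique
  directions, for changes of charts and for points moving in space and time.\<close>

lemma has_derivative_from_partials:
  fixes f :: "'e::euclidean_space \<Rightarrow> real"
  assumes "open D" "z \<in> D"
    and der: "\<And>y b. y \<in> D \<Longrightarrow> b \<in> Basis \<Longrightarrow> ((\<lambda>s. f (y + s *\<^sub>R b)) has_real_derivative g b y) (at 0)"
    and cont: "\<And>b. b \<in> Basis \<Longrightarrow> continuous_on D (g b)"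
  shows "(f has_derivative (\<lambda>v. \<Sum>b\<in>Basis. (v \<bullet> b) * g b z)) (at z)"
proof -
  define m where "m = real (card (Basis :: 'e set))"
  have m: "m \<ge> 1"
    unfolding m_def by (simp add: DIM_positive Suc_leI)
  have der': "((\<lambda>s. f (y + s *\<^sub>R b)) has_real_derivative g b (y + s *\<^sub>R b)) (at s)"
    if "y + s *\<^sub>R b \<in> D" "b \<in> Basis" for y b s
  proof -
    have "((\<lambda>r. f ((y + s *\<^sub>R b) + r *\<^sub>R b)) has_real_derivative g b (y + s *\<^sub>R b)) (at (s + - s))"
      using der[OF that] by simp
    then have "((\<lambda>r. f ((y + s *\<^sub>R b) + (r + - s) *\<^sub>R b)) has_real_derivative g b (y + s *\<^sub>R b)) (at s)"
      by (rule DERIV_shift[THEN iffD1])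
    then show ?thesis by (simp add: algebra_simps)
  qed
  have "bounded_linear (\<lambda>v. \<Sum>b\<in>Basis. (v \<bullet> b) * g b z)"
    by (intro bounded_linear_sum bounded_linear_mult_const bounded_linear_inner_left)
  moreover have "\<exists>d>0. \<forall>y. norm (y - z) < d \<longrightarrow>
      norm (f y - f z - (\<Sum>b\<in>Basis. ((y - z) \<bullet> b) * g b z)) \<le> e * norm (y - z)" if "e > 0" for e
  proof -
    have "\<forall>b\<in>Basis. \<exists>d>0. \<forall>y. dist y z < d \<longrightarrow> y \<in> D \<and> \<bar>g b y - g b z\<bar> < e / m"
    proof
      fix b :: 'e assume b: "b \<in> Basis"
      obtain d1 where d1: "d1 > 0" "\<And>y. dist y z < d1 \<Longrightarrow> y \<in> D"
        using assms(1,2) open_dist by blast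
      have "isCont (g b) z"
        using cont[OF b] assms(1,2) continuous_on_eq_continuous_at by blast
      moreover have "e / m > 0" using that m by simp
      ultimately obtain d2 where d2: "d2 > 0" "\<And>y. dist y z < d2 \<Longrightarrow> dist (g b y) (g b z) < e / m"
        unfolding continuous_at_eps_delta by meson
      show "\<exists>d>0. \<forall>y. dist y z < d \<longrightarrow> y \<in> D \<and> \<bar>g b y - g b z\<bar> < e / m"
        using d1 d2 by (intro exI[of _ "min d1 d2"]) (auto simp: dist_real_def)
    qed
    then obtain dd where dd: "\<And>b. b \<in> Basis \<Longrightarrow> dd b > 0"
      "\<And>b y. b \<in> Basis \<Longrightarrow> dist y z < dd b \<Longrightarrow> y \<in> D \<and> \<bar>g b y - g b z\<bar> < e / m"
      by metis
    define d where "d = Min (dd ` Basis)"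
    have d: "d > 0" "\<And>b. b \<in> Basis \<Longrightarrow> d \<le> dd b"
      using dd(1) by (auto simp: d_def)
    show ?thesis
    \<comment> \<open>The radius is divided by \<open>m\<close> because a point with only some
      coordinates moved is still within \<open>m * norm v\<close> of \<open>z\<close>.\<close>
    proof (intro exI[of _ "d / m"] conjI allI impI)
      show "d / m > 0" using d m by simp
    next
      fix y assume y: "norm (y - z) < d / m"
      define v where "v = y - z"
      \<comment> \<open>The intermediate point at which the coordinates in \<open>B\<close> have
        already been moved from \<open>z\<close> to \<open>y\<close>.\<close>
      define w where "w B = z + (\<Sum>b\<in>B. (v \<bullet> b) *\<^sub>R b)" for B
      have vb: "\<bar>v \<bullet> b\<bar> \<le> norm v" if "b \<in> Basis" for b
        using Basis_le_norm[OF that] by blast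
      have near: "dist (w B + s *\<^sub>R b) z < d"
        if "finite B" "b \<notin> B" "insert b B \<subseteq> Basis" "\<bar>s\<bar> \<le> \<bar>v \<bullet> b\<bar>" for B b s
      proof -
        have "dist (w B + s *\<^sub>R b) z = norm ((\<Sum>b\<in>B. (v \<bullet> b) *\<^sub>R b) + s *\<^sub>R b)"
          by (simp add: dist_norm w_def)
        also have "\<dots> \<le> (\<Sum>b\<in>B. norm ((v \<bullet> b) *\<^sub>R b)) + norm (s *\<^sub>R b)"
          by (intro order_trans[OF norm_triangle_ineq] add_mono norm_sum) simp
        also have "\<dots> \<le> (\<Sum>b\<in>B. norm v) + norm v"
          using that vb by (intro add_mono sum_mono) (auto intro: order_trans)
        also have "\<dots> = real (card (insert b B)) * norm v"
          using that by (simp add: algebra_simps)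
        also have "\<dots> \<le> m * norm v"
          using card_mono[of Basis "insert b B"] that unfolding m_def
          by (intro mult_right_mono) auto
        also have "\<dots> < d"
          using y m by (simp add: v_def field_simps)
        finally show ?thesis .
      qed
      have "\<bar>f (w B) - f z - (\<Sum>b\<in>B. (v \<bullet> b) * g b z)\<bar> \<le> (\<Sum>b\<in>B. \<bar>v \<bullet> b\<bar> * (e / m))"
        if "finite B" "B \<subseteq> Basis" for B
        using that
      proof (induction B rule: finite_induct)
        case empty
        then show ?case by (simp add: w_def)
      next
        case (insert b B)
        have b: "b \<in> Basis" using insert by simp
        have w: "w (insert b B) = w B + (v \<bullet> b) *\<^sub>R b"
          using insert by (simp add: w_def algebra_simps)
        have inD: "w B + s *\<^sub>R b \<in> D" "\<bar>g b (w B + s *\<^sub>R b) - g b z\<bar> < e / m"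
          if "\<bar>s\<bar> \<le> \<bar>v \<bullet> b\<bar>" for s
          using dd(2)[OF b, of "w B + s *\<^sub>R b"] near[of B b s] d(2)[OF b] insert that by auto
        obtain \<xi> where \<xi>: "\<bar>\<xi>\<bar> \<le> \<bar>v \<bullet> b\<bar>"
          "f (w B + (v \<bullet> b) *\<^sub>R b) - f (w B + 0 *\<^sub>R b) = (v \<bullet> b) * g b (w B + \<xi> *\<^sub>R b)"
          by (rule mvt_line[of "v \<bullet> b" "\<lambda>s. f (w B + s *\<^sub>R b)" "\<lambda>s. g b (w B + s *\<^sub>R b)"])
            (use der' inD b in auto)
        have "f (w (insert b B)) - f z - (\<Sum>b\<in>insert b B. (v \<bullet> b) * g b z)
            = (f (w B) - f z - (\<Sum>b\<in>B. (v \<bullet> b) * g b z)) + (v \<bullet> b) * (g b (w B + \<xi> *\<^sub>R b) - g b z)"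
          using \<xi>(2) insert by (simp add: w algebra_simps)
        also have "\<bar>\<dots>\<bar> \<le> (\<Sum>b\<in>B. \<bar>v \<bullet> b\<bar> * (e / m)) + \<bar>v \<bullet> b\<bar> * (e / m)"
        proof (intro order_trans[OF abs_triangle_ineq] add_mono)
          show "\<bar>(v \<bullet> b) * (g b (w B + \<xi> *\<^sub>R b) - g b z)\<bar> \<le> \<bar>v \<bullet> b\<bar> * (e / m)"
            using inD(2)[OF \<xi>(1)] unfolding abs_mult by (intro mult_left_mono) auto
        qed (use insert in auto)
        finally show ?case using insert by (simp add: add.commute)
      qed
      from this[of Basis] have "\<bar>f (w Basis) - f z - (\<Sum>b\<in>Basis. (v \<bullet> b) * g b z)\<bar>
          \<le> (\<Sum>b\<in>Basis. \<bar>v \<bullet> b\<bar> * (e / m))" by simp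
      also have "\<dots> \<le> (\<Sum>b\<in>(Basis::'e set). norm v * (e / m))"
        using vb that m by (intro sum_mono mult_right_mono) auto
      also have "\<dots> = e * norm v"
        using m by (simp add: m_def)
      finally show "norm (f y - f z - (\<Sum>b\<in>Basis. ((y - z) \<bullet> b) * g b z)) \<le> e * norm (y - z)"
        by (simp add: w_def v_def euclidean_representation)
    qed
  qed
  ultimately show ?thesis
    unfolding has_derivative_at_alt by blast
qed

text \<open>Schwarz's theorem. The second difference over a small square is evaluated by two mean
  value theorems in either order, so \<open>hst\<close> and \<open>hts\<close> take a common value
  at two points of the square; continuity at the corner \<open>(a, b)\<close> excludes a gap between
  them.\<close>

lemma mixed_derivatives_commute:
  fixes h :: "real \<Rightarrow> real \<Rightarrow> real"
  assumes "e > 0"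
    and hs: "\<And>s t. \<bar>s - a\<bar> < e \<Longrightarrow> \<bar>t - b\<bar> < e \<Longrightarrow> ((\<lambda>s. h s t) has_real_derivative hs s t) (at s)"
    and ht: "\<And>s t. \<bar>s - a\<bar> < e \<Longrightarrow> \<bar>t - b\<bar> < e \<Longrightarrow> ((\<lambda>t. h s t) has_real_derivative ht s t) (at t)"
    and hst: "\<And>s t. \<bar>s - a\<bar> < e \<Longrightarrow> \<bar>t - b\<bar> < e \<Longrightarrow> ((\<lambda>t. hs s t) has_real_derivative hst s t) (at t)"
    and hts: "\<And>s t. \<bar>s - a\<bar> < e \<Longrightarrow> \<bar>t - b\<bar> < e \<Longrightarrow> ((\<lambda>s. ht s t) has_real_derivative hts s t) (at s)"
    and cst: "isCont (\<lambda>(s, t). hst s t) (a, b)" and cts: "isCont (\<lambda>(s, t). hts s t) (a, b)"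
  shows "hst a b = hts a b"
proof (rule ccontr)
  assume ne: "hst a b \<noteq> hts a b"
  define k where "k = \<bar>hst a b - hts a b\<bar> / 2"
  have k: "k > 0" using ne by (simp add: k_def)
  obtain d1 where d1: "d1 > 0" "\<And>p. dist p (a, b) < d1 \<Longrightarrow> dist ((\<lambda>(s, t). hst s t) p) (hst a b) < k"
    using cst k unfolding continuous_at_eps_delta by (metis case_prod_conv)
  obtain d2 where d2: "d2 > 0" "\<And>p. dist p (a, b) < d2 \<Longrightarrow> dist ((\<lambda>(s, t). hts s t) p) (hts a b) < k"
    using cts k unfolding continuous_at_eps_delta by (metis case_prod_conv)
  \<comment> \<open>A point of the square has distance at most \<open>2 * r\<close> from the corner,
    which is less than \<open>d1\<close> and \<open>d2\<close>.\<close>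
  define r where "r = min (e / 2) (min (d1 / 3) (d2 / 3))"
  have r: "r > 0" "r < e" using d1 d2 \<open>e > 0\<close> by (auto simp: r_def)
  have near: "dist (s, t) (a, b) < d1 \<and> dist (s, t) (a, b) < d2" if "\<bar>s - a\<bar> \<le> r" "\<bar>t - b\<bar> \<le> r" for s t
  proof -
    have "dist (s, t) (a, b) \<le> \<bar>s - a\<bar> + \<bar>t - b\<bar>"
      using sqrt_sum_squares_le_sum_abs[of "s - a" "t - b"] by (simp add: dist_Pair_Pair dist_real_def)
    also have "\<dots> \<le> 2 * r" using that by simp
    finally show ?thesis using d1(1) d2(1) by (auto simp: r_def)
  qed
  have "\<exists>z>a. z < a + r \<and> (h (a + r) (b + r) - h (a + r) b) - (h a (b + r) - h a b)
      = (a + r - a) * (hs z (b + r) - hs z b)"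
    by (rule MVT2[of a "a + r" "\<lambda>s. h s (b + r) - h s b"]) (use r in \<open>auto intro!: DERIV_diff hs\<close>)
  then obtain s1 where s1: "s1 > a" "s1 < a + r"
    "(h (a + r) (b + r) - h (a + r) b) - (h a (b + r) - h a b) = r * (hs s1 (b + r) - hs s1 b)"
    by auto
  have "\<exists>z>b. z < b + r \<and> hs s1 (b + r) - hs s1 b = (b + r - b) * hst s1 z"
    by (rule MVT2[of b "b + r" "hs s1"]) (use r s1 in \<open>auto intro!: hst\<close>)
  then obtain t1 where t1: "t1 > b" "t1 < b + r" "hs s1 (b + r) - hs s1 b = r * hst s1 t1"
    by auto
  have "\<exists>z>b. z < b + r \<and> (h (a + r) (b + r) - h a (b + r)) - (h (a + r) b - h a b)
      = (b + r - b) * (ht (a + r) z - ht a z)"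
    by (rule MVT2[of b "b + r" "\<lambda>t. h (a + r) t - h a t"]) (use r in \<open>auto intro!: DERIV_diff ht\<close>)
  then obtain t2 where t2: "t2 > b" "t2 < b + r"
    "(h (a + r) (b + r) - h a (b + r)) - (h (a + r) b - h a b) = r * (ht (a + r) t2 - ht a t2)"
    by auto
  have "\<exists>z>a. z < a + r \<and> ht (a + r) t2 - ht a t2 = (a + r - a) * hts z t2"
    by (rule MVT2[of a "a + r" "\<lambda>s. ht s t2"]) (use r t2 in \<open>auto intro!: hts\<close>)
  then obtain s2 where s2: "s2 > a" "s2 < a + r" "ht (a + r) t2 - ht a t2 = r * hts s2 t2"
    by auto
  have "r * (r * hst s1 t1) = r * (r * hts s2 t2)"
    using s1(3) t2(3) unfolding t1(3) s2(3) by linarith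
  then have "hst s1 t1 = hts s2 t2" using r by simp
  moreover have "\<bar>hst a b - hts a b\<bar> \<le> \<bar>x - hst a b\<bar> + \<bar>x - hts a b\<bar>" for x
    by arith
  moreover have "\<bar>hst s1 t1 - hst a b\<bar> < k"
    using d1(2)[of "(s1, t1)"] near[of s1 t1] s1 t1 by (auto simp: dist_real_def)
  moreover have "\<bar>hts s2 t2 - hts a b\<bar> < k"
    using d2(2)[of "(s2, t2)"] near[of s2 t2] s2 t2 by (auto simp: dist_real_def)
  ultimately show False unfolding k_def by (smt (verit) field_sum_of_halves)
qed

context space_time
begin

lemma C_slice_continuous:
  assumes "C k p f" "t \<in> I"
  shows "continuous_on D (\<lambda>z. f z t)"
proof -
  have "continuous_on D (\<lambda>z. (\<lambda>(z, t). f z t) (z, t))"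
    by (rule continuous_on_compose2[OF C_class_continuous[OF assms(1)]])
      (use assms(2) in \<open>auto intro: continuous_on_Pair continuous_on_id continuous_on_const\<close>)
  then show ?thesis by simp
qed

lemma C_deriv_line:
  fixes f :: "'e \<Rightarrow> real \<Rightarrow> real"
  assumes "C 1 0 f" "b \<in> Basis" "z + s *\<^sub>R b \<in> D" "t \<in> I"
  shows "((\<lambda>s. f (z + s *\<^sub>R b) t) has_real_derivative d_space b f (z + s *\<^sub>R b) t) (at s)"
proof -
  have "((\<lambda>r. f ((z + s *\<^sub>R b) + r *\<^sub>R b) t) has_real_derivative d_space b f (z + s *\<^sub>R b) t) (at (s + - s))"
    using C_class_has_deriv_space[of 0 0 D I f b] assms
    by (simp add: has_real_derivative_iff_has_vector_derivative)
  then have "((\<lambda>r. f ((z + s *\<^sub>R b) + (r + - s) *\<^sub>R b) t) has_real_derivative d_space b f (z + s *\<^sub>R b) t) (at s)"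
    by (rule DERIV_shift[THEN iffD1])
  then show ?thesis by (simp add: algebra_simps)
qed

lemma C_deriv_time:
  fixes f :: "'e \<Rightarrow> real \<Rightarrow> real"
  assumes "C 0 1 f" "z \<in> D" "t \<in> interior I"
  shows "(f z has_real_derivative d_time I f z t) (at t)"
proof -
  have "t \<in> I" using assms(3) interior_subset by blast
  then have "(f z has_vector_derivative d_time I f z t) (at t within I)"
    using C_class_has_deriv_time[of 0 0 D I f] assms by simp
  then show ?thesis
    using at_within_interior[OF assms(3)] by (simp add: has_real_derivative_iff_has_vector_derivative)
qed

lemma C_frechet:
  fixes f :: "'e \<Rightarrow> real \<Rightarrow> real"
  assumes "C 1 0 f" "z \<in> D" "t \<in> I"
  shows "((\<lambda>y. f y t) has_derivative (\<lambda>v. \<Sum>b\<in>Basis. (v \<bullet> b) * d_space b f z t)) (at z)"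
proof (rule has_derivative_from_partials[OF open_D assms(2)])
  fix y b :: 'e assume "y \<in> D" "b \<in> Basis"
  then show "((\<lambda>s. f (y + s *\<^sub>R b) t) has_real_derivative d_space b f y t) (at 0)"
    using C_deriv_line[OF assms(1), of b y 0 t] assms by simp
next
  fix b :: 'e assume "b \<in> Basis"
  then have "C 0 0 (d_space b f)" using C_class_space[of 0] assms(1) by simp
  then show "continuous_on D (\<lambda>y. d_space b f y t)"
    using C_slice_continuous assms(3) by blast
qed

lemma d_space_commute:
  fixes f :: "'e \<Rightarrow> real \<Rightarrow> real"
  assumes f: "C 2 0 f" and b: "b \<in> Basis" "b' \<in> Basis" and zt: "z \<in> D" "t \<in> I"
  shows "d_space b (d_space b' f) z t = d_space b' (d_space b f) z t"
proof -
  obtain d where d: "d > 0" "\<And>y. dist y z < d \<Longrightarrow> y \<in> D"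
    using open_D zt open_dist by blast
  have inD: "z + s *\<^sub>R b + r *\<^sub>R b' \<in> D" if "\<bar>s - 0\<bar> < d / 2" "\<bar>r - 0\<bar> < d / 2" for s r
  proof (rule d(2))
    have "dist (z + s *\<^sub>R b + r *\<^sub>R b') z \<le> norm (s *\<^sub>R b) + norm (r *\<^sub>R b')"
      using norm_triangle_ineq[of "s *\<^sub>R b" "r *\<^sub>R b'"] by (simp add: dist_norm)
    also have "\<dots> < d" using b that by simp
    finally show "dist (z + s *\<^sub>R b + r *\<^sub>R b') z < d" .
  qed
  have f1: "C 1 0 f" using C_class_mono[OF f, of 1 0] by simp
  have f2: "C 1 0 (d_space c f)" if "c \<in> Basis" for c
    using C_class_space[of 1] f that by (simp add: numeral_2_eq_2)
  have f3: "C 0 0 (d_space c (d_space c' f))" if "c \<in> Basis" "c' \<in> Basis" for c c'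
    using C_class_space[of 0 0 D I "d_space c' f" c] f2[of c'] that by simp
  have cont: "isCont (\<lambda>(s, r). d_space c (d_space c' f) (z + s *\<^sub>R b + r *\<^sub>R b') t) (0, 0)"
    if "c \<in> Basis" "c' \<in> Basis" for c c'
  proof -
    have "continuous_on ({- d/2<..<d/2} \<times> {- d/2<..<d/2})
        (\<lambda>p. d_space c (d_space c' f) (z + fst p *\<^sub>R b + snd p *\<^sub>R b') t)"
      using inD by (intro continuous_on_compose2[OF C_slice_continuous[OF f3[OF that] zt(2)]])
        (auto intro!: continuous_intros simp: abs_less_iff)
    then show ?thesis
      using d(1) by (subst (asm) continuous_on_eq_continuous_at)
        (auto intro: open_Times simp: case_prod_unfold)
  qed
  have "d_space b' (d_space b f) (z + 0 *\<^sub>R b + 0 *\<^sub>R b') t = d_space b (d_space b' f) (z + 0 *\<^sub>R b + 0 *\<^sub>R b') t"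
  proof (rule mixed_derivatives_commute[of "d / 2" 0 0 "\<lambda>s r. f (z + s *\<^sub>R b + r *\<^sub>R b') t"
        "\<lambda>s r. d_space b f (z + s *\<^sub>R b + r *\<^sub>R b') t" "\<lambda>s r. d_space b' f (z + s *\<^sub>R b + r *\<^sub>R b') t"
        "\<lambda>s r. d_space b' (d_space b f) (z + s *\<^sub>R b + r *\<^sub>R b') t"
        "\<lambda>s r. d_space b (d_space b' f) (z + s *\<^sub>R b + r *\<^sub>R b') t"])
    fix s r :: real assume sr: "\<bar>s - 0\<bar> < d / 2" "\<bar>r - 0\<bar> < d / 2"
    note D = inD[OF sr]
    have comm: "z + s *\<^sub>R b + r *\<^sub>R b' = z + r *\<^sub>R b' + s *\<^sub>R b" for s r by simp
    show "((\<lambda>s. f (z + s *\<^sub>R b + r *\<^sub>R b') t) has_real_derivative d_space b f (z + s *\<^sub>R b + r *\<^sub>R b') t) (at s)"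
      using C_deriv_line[OF f1 b(1), of "z + r *\<^sub>R b'" s t] D zt unfolding comm by simp
    show "((\<lambda>r. f (z + s *\<^sub>R b + r *\<^sub>R b') t) has_real_derivative d_space b' f (z + s *\<^sub>R b + r *\<^sub>R b') t) (at r)"
      using C_deriv_line[OF f1 b(2), of "z + s *\<^sub>R b" r t] D zt by simp
    show "((\<lambda>r. d_space b f (z + s *\<^sub>R b + r *\<^sub>R b') t) has_real_derivative
        d_space b' (d_space b f) (z + s *\<^sub>R b + r *\<^sub>R b') t) (at r)"
      using C_deriv_line[OF f2[OF b(1)] b(2), of "z + s *\<^sub>R b" r t] D zt by simp
    show "((\<lambda>s. d_space b' f (z + s *\<^sub>R b + r *\<^sub>R b') t) has_real_derivative
        d_space b (d_space b' f) (z + s *\<^sub>R b + r *\<^sub>R b') t) (at s)"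
      using C_deriv_line[OF f2[OF b(2)] b(1), of "z + r *\<^sub>R b'" s t] D zt unfolding comm by simp
  qed (use d(1) cont b in auto)
  then show ?thesis by simp
qed

text \<open>Time lies in the interior of \<open>I\<close>, where the derivative within
  \<open>I\<close> is the two-sided one that Schwarz's theorem speaks about.\<close>

lemma d_time_space_commute:
  fixes f :: "'e \<Rightarrow> real \<Rightarrow> real"
  assumes f: "C 1 1 f" and b: "b \<in> Basis" and zt: "z \<in> D" "t \<in> interior I"
  shows "d_time I (d_space b f) z t = d_space b (d_time I f) z t"
proof -
  obtain d1 where d1: "d1 > 0" "\<And>y. dist y z < d1 \<Longrightarrow> y \<in> D"
    using open_D zt open_dist by blast
  obtain d2 where d2: "d2 > 0" "\<And>r. dist r t < d2 \<Longrightarrow> r \<in> interior I"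
    using open_interior zt open_dist by blast
  define d where "d = min d1 d2"
  have d: "d > 0" using d1 d2 by (simp add: d_def)
  have inD: "z + s *\<^sub>R b \<in> D" if "\<bar>s - 0\<bar> < d" for s
    using that b by (intro d1(2)) (simp add: dist_norm d_def)
  have inI: "r \<in> interior I" "r \<in> I" if "\<bar>r - t\<bar> < d" for r
    using that d2(2)[of r] interior_subset[of I] by (auto simp: dist_real_def d_def)
  have f1: "C 1 0 f" "C 0 1 f" using C_class_mono[OF f, of 1 0] C_class_mono[OF f, of 0 1] by simp_all
  have f2: "C 0 1 (d_space b f)" "C 1 0 (d_time I f)"
    using C_class_space[of 0 1] C_class_time[of 1 0] f b by simp_all
  have f3: "C 0 0 (d_time I (d_space b f))" "C 0 0 (d_space b (d_time I f))"
    using C_class_time[of 0 0] C_class_space[of 0] f2 b by simp_all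
  have cont: "isCont (\<lambda>(s, r). h (z + s *\<^sub>R b) r) (0, t)" if "C 0 0 h" for h :: "'e \<Rightarrow> real \<Rightarrow> real"
  proof -
    have "continuous_on ({- d<..<d} \<times> {t - d<..<t + d}) (\<lambda>p. (\<lambda>(z, t). h z t) (z + fst p *\<^sub>R b, snd p))"
      using inD inI by (intro continuous_on_compose2[OF C_class_continuous[OF that]])
        (auto intro!: continuous_intros simp: abs_less_iff)
    then show ?thesis
      using d by (subst (asm) continuous_on_eq_continuous_at)
        (auto intro: open_Times simp: case_prod_unfold)
  qed
  have "d_time I (d_space b f) (z + 0 *\<^sub>R b) t = d_space b (d_time I f) (z + 0 *\<^sub>R b) t"
  proof (rule mixed_derivatives_commute[of d 0 t "\<lambda>s r. f (z + s *\<^sub>R b) r"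
        "\<lambda>s r. d_space b f (z + s *\<^sub>R b) r" "\<lambda>s r. d_time I f (z + s *\<^sub>R b) r"
        "\<lambda>s r. d_time I (d_space b f) (z + s *\<^sub>R b) r" "\<lambda>s r. d_space b (d_time I f) (z + s *\<^sub>R b) r"])
    fix s r :: real assume s: "\<bar>s - 0\<bar> < d" and r: "\<bar>r - t\<bar> < d"
    note D = inD[OF s] and I = inI[OF r]
    show "((\<lambda>s. f (z + s *\<^sub>R b) r) has_real_derivative d_space b f (z + s *\<^sub>R b) r) (at s)"
      by (rule C_deriv_line[OF f1(1) b D I(2)])
    show "(f (z + s *\<^sub>R b) has_real_derivative d_time I f (z + s *\<^sub>R b) r) (at r)"
      by (rule C_deriv_time[OF f1(2) D I(1)])
    show "(d_space b f (z + s *\<^sub>R b) has_real_derivative d_time I (d_space b f) (z + s *\<^sub>R b) r) (at r)"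
      by (rule C_deriv_time[OF f2(1) D I(1)])
    show "((\<lambda>s. d_time I f (z + s *\<^sub>R b) r) has_real_derivative d_space b (d_time I f) (z + s *\<^sub>R b) r) (at s)"
      by (rule C_deriv_line[OF f2(2) b D I(2)])
  qed (rule d cont[OF f3(1)] cont[OF f3(2)])+
  then show ?thesis by simp
qed

end

section \<open>The Li-Yau inequality at a maximum\<close>

definition quad :: "'i set \<Rightarrow> ('i \<Rightarrow> 'i \<Rightarrow> real) \<Rightarrow> ('i \<Rightarrow> real) \<Rightarrow> real" where
  "quad B a x = (\<Sum>i\<in>B. \<Sum>j\<in>B. a i j * x i * x j)"

lemma sum_sum_insert:
  fixes F :: "'i \<Rightarrow> 'i \<Rightarrow> real"
  assumes "finite B" "b \<notin> B"
  shows "(\<Sum>i\<in>insert b B. \<Sum>j\<in>insert b B. F i j)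
    = F b b + (\<Sum>j\<in>B. F b j) + (\<Sum>i\<in>B. F i b) + (\<Sum>i\<in>B. \<Sum>j\<in>B. F i j)"
  using assms by (simp add: sum.distrib)

text \<open>Splitting off one rank-one term \<open>a\<^sub>b a\<^sub>b\<^sup>T / a\<^sub>b\<^sub>b\<close> of the Cholesky decomposition of \<open>a\<close>
  at a time.\<close>

lemma trace_product_nonneg:
  assumes "finite B"
    and "\<And>i j. i \<in> B \<Longrightarrow> j \<in> B \<Longrightarrow> a i j = a j i"
    and "\<And>x. (\<exists>i\<in>B. x i \<noteq> 0) \<Longrightarrow> 0 < quad B a x"
    and "\<And>x. 0 \<le> quad B M x"
  shows "0 \<le> (\<Sum>i\<in>B. \<Sum>j\<in>B. a i j * M i j)"
  using assms
proof (induction B arbitrary: a rule: finite_induct)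
  case empty
  then show ?case by simp
next
  case (insert b B)
  note ins = sum_sum_insert[OF insert.hyps]
  \<comment> \<open>Testing the form on the unit vector of \<open>b\<close> shows that the pivot is
    positive.\<close>
  have "0 < quad (insert b B) a (\<lambda>i. if i = b then 1 else 0)"
    by (rule insert.prems(2)) auto
  also have "\<dots> = a b b"
  proof -
    have "(if i = b then 1 else 0) = (0 :: real)" if "i \<in> B" for i
      using that insert.hyps by auto
    then show ?thesis unfolding quad_def ins by simp
  qed
  finally have bb: "a b b > 0" .
  \<comment> \<open>The Schur complement of the pivot.\<close>
  define a' where "a' i j = a i j - a b i * a b j / a b b" for i j
  have "0 \<le> (\<Sum>i\<in>B. \<Sum>j\<in>B. a' i j * M i j)"
  proof (rule insert.IH)
    fix i j assume "i \<in> B" "j \<in> B"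
    then show "a' i j = a' j i" using insert.prems(1) by (simp add: a'_def)
  next
    fix x :: "'a \<Rightarrow> real" assume x: "\<exists>i\<in>B. x i \<noteq> 0"
    define s where "s = (\<Sum>j\<in>B. a b j * x j)"
    \<comment> \<open>This value at \<open>b\<close> minimises the form for given \<open>x\<close>
      on \<open>B\<close>. The minimum is the form of the Schur complement, which is therefore
      positive definite again.\<close>
    define y where "y i = (if i = b then - s / a b b else x i)" for i
    have yB: "y i = x i" if "i \<in> B" for i using that insert.hyps by (auto simp: y_def)
    have "0 < quad (insert b B) a y"
      by (rule insert.prems(2)) (use x yB in auto)
    also have "\<dots> = a b b * y b * y b + (\<Sum>j\<in>B. a b j * y b * x j) + (\<Sum>i\<in>B. a b i * x i * y b) + quad B a x"
    proof -
      have "(\<Sum>i\<in>B. a i b * y i * y b) = (\<Sum>i\<in>B. a b i * x i * y b)"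
        using insert.prems(1) yB by (intro sum.cong) auto
      then show ?thesis unfolding quad_def ins using yB by simp
    qed
    also have "(\<Sum>j\<in>B. a b j * y b * x j) = y b * s"
      by (simp add: s_def sum_distrib_left mult_ac)
    also have "(\<Sum>i\<in>B. a b i * x i * y b) = y b * s"
      by (simp add: s_def sum_distrib_left mult_ac)
    also have "a b b * y b * y b + y b * s + y b * s = - (s * s / a b b)"
      using bb by (simp add: y_def field_simps)
    also have "s * s / a b b = (\<Sum>i\<in>B. \<Sum>j\<in>B. a b i * a b j / a b b * x i * x j)"
      unfolding s_def sum_product sum_divide_distrib by (intro sum.cong refl) (simp add: mult_ac)
    also have "- \<dots> + quad B a x = quad B a' x"
      unfolding quad_def a'_def by (simp add: left_diff_distrib sum_subtractf)
    finally show "0 < quad B a' x" .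
  next
    fix x :: "'a \<Rightarrow> real"
    define y where "y i = (if i = b then 0 else x i)" for i
    have yB: "y i = x i" if "i \<in> B" for i using that insert.hyps by (auto simp: y_def)
    have "quad (insert b B) M y = quad B M x"
      unfolding quad_def ins using yB by (simp add: y_def[of b])
    then show "0 \<le> quad B M x" using insert.prems(3)[of y] by simp
  qed
  moreover have "0 \<le> quad (insert b B) M (a b) / a b b"
    using insert.prems(3) bb by simp
  moreover have "(\<Sum>i\<in>insert b B. \<Sum>j\<in>insert b B. a i j * M i j)
      = quad (insert b B) M (a b) / a b b + (\<Sum>i\<in>insert b B. \<Sum>j\<in>insert b B. a' i j * M i j)"
    unfolding quad_def sum_divide_distrib sum.distrib[symmetric] a'_def
    by (intro sum.cong refl) (simp add: algebra_simps)
  \<comment> \<open>Row and column \<open>b\<close> of the Schur complement vanish, so the induction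
    hypothesis covers the whole sum.\<close>
  moreover have "(\<Sum>i\<in>insert b B. \<Sum>j\<in>insert b B. a' i j * M i j) = (\<Sum>i\<in>B. \<Sum>j\<in>B. a' i j * M i j)"
  proof -
    have "a' b j = 0" "a' j b = 0" if "j \<in> insert b B" for j
      using bb insert.prems(1)[OF that, of b] by (auto simp: a'_def)
    then show ?thesis unfolding ins by simp
  qed
  ultimately show ?case by simp
qed

lemma quad_lower_pos:
  assumes "finite B" "\<And>x. l * (\<Sum>i\<in>B. (x i)\<^sup>2) \<le> quad B a x" "l > 0" "\<exists>i\<in>B. x i \<noteq> 0"
  shows "0 < quad B a x"
proof -
  have "0 < (\<Sum>i\<in>B. (x i)\<^sup>2)"
    using assms(1,4) by (metis sum_pos2 zero_le_power2 zero_less_power2)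
  then show ?thesis using assms(2)[of x] assms(3) by (smt (verit) mult_pos_pos)
qed

text \<open>The right-hand side is the trace of \<open>a M\<close> for the positive semidefinite
  matrix \<open>M = h a h^T\<close>. Since \<open>a\<close> minus \<open>l / 2\<close> times the
  identity is still positive definite, this trace is at least \<open>l / 2\<close> times the trace
  of \<open>M\<close>, which in turn is at least \<open>l\<close> times the sum of squares. Half of
  \<open>l\<close> is given away because \<open>trace_product_nonneg\<close> wants strict
  positivity.\<close>

lemma quad_hessian_lower:
  assumes B: "finite B" and l: "l > 0"
    and sym: "\<And>i j. i \<in> B \<Longrightarrow> j \<in> B \<Longrightarrow> a i j = a j i"
    and ell: "\<And>x. l * (\<Sum>i\<in>B. (x i)\<^sup>2) \<le> quad B a x"
  shows "l\<^sup>2 / 2 * (\<Sum>k\<in>B. \<Sum>i\<in>B. (h k i)\<^sup>2)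
    \<le> (\<Sum>k\<in>B. \<Sum>l\<in>B. a k l * (\<Sum>i\<in>B. \<Sum>j\<in>B. a i j * h k i * h l j))"
proof -
  define M where "M k l = (\<Sum>i\<in>B. \<Sum>j\<in>B. a i j * h k i * h l j)" for k l
  define d where "d i j = (if i = j then l / 2 else 0)" for i j :: 'a
  have dsum: "(\<Sum>i\<in>B. \<Sum>j\<in>B. d i j * F i j) = l / 2 * (\<Sum>i\<in>B. F i i)" for F
    using B by (simp add: d_def sum_distrib_left if_distrib[of "\<lambda>x. x * _"] cong: if_cong)
  have "0 \<le> (\<Sum>i\<in>B. \<Sum>j\<in>B. (a i j - d i j) * M i j)"
  proof (rule trace_product_nonneg[OF B])
    show "a i j - d i j = a j i - d j i" if "i \<in> B" "j \<in> B" for i j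
      using sym[OF that] by (simp add: d_def)
    show "0 < quad B (\<lambda>i j. a i j - d i j) x" if x: "\<exists>i\<in>B. x i \<noteq> 0" for x
    proof (rule quad_lower_pos[OF B _ _ x, of "l / 2"])
      fix x
      have "quad B (\<lambda>i j. a i j - d i j) x = quad B a x - (\<Sum>i\<in>B. \<Sum>j\<in>B. d i j * (x i * x j))"
        unfolding quad_def by (simp add: left_diff_distrib sum_subtractf mult.assoc)
      also have "\<dots> = quad B a x - l / 2 * (\<Sum>i\<in>B. (x i)\<^sup>2)"
        unfolding dsum by (simp add: power2_eq_square)
      finally show "l / 2 * (\<Sum>i\<in>B. (x i)\<^sup>2) \<le> quad B (\<lambda>i j. a i j - d i j) x"
        using ell[of x] by simp
    qed (use l in simp)
    show "0 \<le> quad B M x" for x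
    proof -
      have "quad B M x = (\<Sum>k\<in>B. \<Sum>l\<in>B. \<Sum>i\<in>B. \<Sum>j\<in>B. a i j * (x k * h k i) * (x l * h l j))"
        unfolding quad_def M_def sum_distrib_right by (intro sum.cong refl) (simp add: mult_ac)
      also have "\<dots> = (\<Sum>k\<in>B. \<Sum>i\<in>B. \<Sum>l\<in>B. \<Sum>j\<in>B. a i j * (x k * h k i) * (x l * h l j))"
        by (intro sum.cong refl sum.swap)
      also have "\<dots> = (\<Sum>i\<in>B. \<Sum>k\<in>B. \<Sum>l\<in>B. \<Sum>j\<in>B. a i j * (x k * h k i) * (x l * h l j))"
        by (rule sum.swap)
      also have "\<dots> = (\<Sum>i\<in>B. \<Sum>k\<in>B. \<Sum>j\<in>B. \<Sum>l\<in>B. a i j * (x k * h k i) * (x l * h l j))"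
        by (intro sum.cong refl sum.swap)
      also have "\<dots> = (\<Sum>i\<in>B. \<Sum>j\<in>B. \<Sum>k\<in>B. \<Sum>l\<in>B. a i j * (x k * h k i) * (x l * h l j))"
        by (intro sum.cong refl sum.swap)
      also have "\<dots> = quad B a (\<lambda>i. \<Sum>k\<in>B. x k * h k i)"
        unfolding quad_def by (intro sum.cong refl) (simp add: sum_distrib_left sum_distrib_right mult_ac)
      also have "\<dots> \<ge> 0"
        using ell[of "\<lambda>i. \<Sum>k\<in>B. x k * h k i"] l by (smt (verit) mult_nonneg_nonneg sum_nonneg zero_le_power2)
      finally show ?thesis .
    qed
  qed
  then have "l / 2 * (\<Sum>k\<in>B. M k k) \<le> (\<Sum>i\<in>B. \<Sum>j\<in>B. a i j * M i j)"
    by (simp add: left_diff_distrib sum_subtractf dsum)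
  moreover have "l * (\<Sum>k\<in>B. \<Sum>i\<in>B. (h k i)\<^sup>2) \<le> (\<Sum>k\<in>B. M k k)"
    unfolding sum_distrib_left[of l] using ell by (intro sum_mono) (simp add: M_def quad_def sum_distrib_left)
  then have "l / 2 * (l * (\<Sum>k\<in>B. \<Sum>i\<in>B. (h k i)\<^sup>2)) \<le> l / 2 * (\<Sum>k\<in>B. M k k)"
    using l by (intro mult_left_mono) auto
  ultimately show ?thesis
    unfolding M_def by (simp add: power2_eq_square)
qed

lemma abs_sum_le:
  fixes g :: "'i \<Rightarrow> real"
  assumes "\<And>i. i \<in> B \<Longrightarrow> \<bar>g i\<bar> \<le> M"
  shows "\<bar>\<Sum>i\<in>B. g i\<bar> \<le> real (card B) * M"
  using order_trans[OF sum_abs sum_bounded_above[of B "\<lambda>i. \<bar>g i\<bar>"]] assms by simp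

text \<open>\<open>X\<close>, \<open>Y\<close> and \<open>\<tau>\<close> stand for \<open>\<bar>\<nabla>f\<bar>\<close>, \<open>\<bar>\<nabla>\<^sup>2f\<bar>\<close> and \<open>1 / t\<close>, and \<open>P\<close> for the Li-Yau quantity at its maximum.\<close>

definition growth_const :: "real \<Rightarrow> real \<Rightarrow> real \<Rightarrow> bool" where
  "growth_const l c B \<longleftrightarrow> 0 \<le> B \<and> (\<forall>X Y P \<tau>. 0 \<le> X \<longrightarrow> 0 \<le> Y \<longrightarrow> 0 < P \<longrightarrow> 0 < \<tau> \<longrightarrow>
     l * X\<^sup>2 + P \<le> c * (X + Y + 1) \<longrightarrow>
     l\<^sup>2 * Y\<^sup>2 \<le> P * \<tau> + c * (X\<^sup>2 + X * Y + X + Y + 1) \<longrightarrow> P \<le> B * (\<tau> + 1))"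

text \<open>By Young's inequality the first hypothesis bounds \<open>X^2\<close> by
  \<open>c1 * (Y + 1)\<close>. In the second, half and then a quarter of \<open>l^2 Y^2\<close> is
  absorbed on the left, so that \<open>Y^2\<close> is bounded by a multiple of
  \<open>P * \<tau> + c3\<close>. As \<open>P\<close> is at most linear in \<open>Y\<close>, this
  yields \<open>P^2 <= c5 * (P * \<tau> + 1)\<close>, which forces \<open>P\<close> to be at most
  linear in \<open>\<tau>\<close>.\<close>

lemma growth_const_exists:
  fixes l c :: real
  assumes "l > 0" "c > 0"
  shows "\<exists>B. growth_const l c B"
proof -
  define c1 where "c1 = 2 / l * (c + c\<^sup>2 / (2 * l))"
  \<comment> \<open>The weight in Young's inequality for \<open>X * Y\<close>, chosen so that
    \<open>c * e / 2\<close> is exactly half of \<open>l^2\<close>.\<close>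
  define e where "e = l\<^sup>2 / c"
  define c2 where "c2 = c1 * (1 + 1 / (2 * e)) + (c1 + 1) + 1"
  define c3 where "c3 = c * c2 + (c * c2)\<^sup>2 / l\<^sup>2"
  define c4 where "c4 = c * (c1 + 2)"
  define c5 where "c5 = 2 * c4\<^sup>2 * (4 / l\<^sup>2 + 4 * c3 / l\<^sup>2 + 1)"
  have pos1: "c1 > 0" "e > 0"
    using assms by (auto simp: c1_def e_def intro!: add_pos_pos mult_pos_pos divide_pos_pos)
  then have pos2: "c2 > 0"
    unfolding c2_def by (intro add_pos_pos mult_pos_pos divide_pos_pos) auto
  then have pos: "c1 > 0" "e > 0" "c2 > 0" "c3 > 0" "c4 > 0"
    using assms pos1 unfolding c3_def c4_def
    by (auto intro!: add_pos_nonneg mult_pos_pos)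
  have pos5: "c5 > 0"
    using assms pos unfolding c5_def by (intro add_pos_pos mult_pos_pos divide_pos_pos) auto
  show ?thesis
    unfolding growth_const_def
  proof (intro exI[of _ "c5 + 1"] conjI allI impI)
    fix X Y P \<tau> :: real
    assume X: "X \<ge> 0" and Y: "Y \<ge> 0" and P: "P > 0" and t: "\<tau> > 0"
      and 1: "l * X\<^sup>2 + P \<le> c * (X + Y + 1)"
      and 2: "l\<^sup>2 * Y\<^sup>2 \<le> P * \<tau> + c * (X\<^sup>2 + X * Y + X + Y + 1)"
    have "c * X \<le> l * X\<^sup>2 / 2 + c\<^sup>2 / (2 * l)"
    proof -
      have "0 \<le> (l * X - c)\<^sup>2 / (2 * l)" using assms by simp
      also have "\<dots> = l * X\<^sup>2 / 2 + c\<^sup>2 / (2 * l) - c * X"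
        using assms by (simp add: field_simps power2_eq_square)
      finally show ?thesis by simp
    qed
    then have "l / 2 * X\<^sup>2 \<le> c * (Y + 1) + c\<^sup>2 / (2 * l)"
      using 1 P by (simp add: algebra_simps)
    also have "\<dots> \<le> (c + c\<^sup>2 / (2 * l)) * (Y + 1)"
    proof -
      have "0 \<le> c\<^sup>2 / (2 * l) * Y" using assms Y by simp
      then show ?thesis by (simp add: algebra_simps add_divide_distrib)
    qed
    also have "\<dots> = l / 2 * (c1 * (Y + 1))"
      using assms by (simp add: c1_def)
    finally have XX: "X\<^sup>2 \<le> c1 * (Y + 1)"
      using assms by (simp add: mult_le_cancel_left_pos)
    have "0 \<le> (X - 1)\<^sup>2 + X" using X by simp
    then have X1: "X \<le> X\<^sup>2 + 1" by (simp add: power2_eq_square algebra_simps)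
    have XY: "X * Y \<le> X\<^sup>2 / (2 * e) + e * Y\<^sup>2 / 2"
    proof -
      have "0 \<le> (X - e * Y)\<^sup>2 / (2 * e)" using pos by simp
      also have "\<dots> = X\<^sup>2 / (2 * e) + e * Y\<^sup>2 / 2 - X * Y"
        using pos by (simp add: field_simps power2_eq_square)
      finally show ?thesis by simp
    qed
    have "X\<^sup>2 * (1 + 1 / (2 * e)) \<le> c1 * (Y + 1) * (1 + 1 / (2 * e))"
      using XX pos by (intro mult_right_mono) auto
    moreover have "X\<^sup>2 * (1 + 1 / (2 * e)) = X\<^sup>2 + X\<^sup>2 / (2 * e)" by (simp add: algebra_simps)
    moreover have "X \<le> (c1 + 1) * (Y + 1)" using X1 XX Y by (simp add: algebra_simps)
    ultimately have "X\<^sup>2 + X * Y + X + Y + 1 \<le> c1 * (Y + 1) * (1 + 1 / (2 * e)) + (c1 + 1) * (Y + 1) + (Y + 1) + e * Y\<^sup>2 / 2"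
      using XY by linarith
    also have "\<dots> = c2 * (Y + 1) + e * Y\<^sup>2 / 2"
      by (simp add: c2_def algebra_simps)
    finally have "c * (X\<^sup>2 + X * Y + X + Y + 1) \<le> c * (c2 * (Y + 1) + e * Y\<^sup>2 / 2)"
      using assms by (intro mult_left_mono) auto
    also have "\<dots> = c * c2 * (Y + 1) + l\<^sup>2 * Y\<^sup>2 / 2"
      using assms by (simp add: e_def field_simps)
    finally have "l\<^sup>2 * Y\<^sup>2 / 2 \<le> P * \<tau> + c * c2 * (Y + 1)" using 2 by linarith
    moreover have "c * c2 * Y \<le> l\<^sup>2 * Y\<^sup>2 / 4 + (c * c2)\<^sup>2 / l\<^sup>2"
    proof -
      have "0 \<le> (l\<^sup>2 * Y / 2 - c * c2)\<^sup>2 / l\<^sup>2" by simp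
      also have "\<dots> = l\<^sup>2 * Y\<^sup>2 / 4 + (c * c2)\<^sup>2 / l\<^sup>2 - c * c2 * Y"
        using assms by (simp add: field_simps power2_eq_square)
      finally show ?thesis by simp
    qed
    ultimately have "l\<^sup>2 * Y\<^sup>2 / 4 \<le> P * \<tau> + c3"
      by (simp add: c3_def algebra_simps)
    then have YY: "Y\<^sup>2 \<le> 4 / l\<^sup>2 * (P * \<tau> + c3)"
      using assms by (simp add: field_simps)
    have "P \<le> c * (X + Y + 1)" using 1 assms(1) by (smt (verit) mult_nonneg_nonneg zero_le_power2)
    also have "\<dots> \<le> c * ((c1 + 1) * (Y + 1) + Y + 1)"
      using \<open>X \<le> (c1 + 1) * (Y + 1)\<close> assms by (intro mult_left_mono) auto
    also have "\<dots> = c4 * (Y + 1)" by (simp add: c4_def algebra_simps)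
    finally have "P\<^sup>2 \<le> (c4 * (Y + 1))\<^sup>2" using P by (intro power_mono) auto
    also have "\<dots> \<le> 2 * c4\<^sup>2 * (Y\<^sup>2 + 1)"
    proof -
      have "(Y + 1)\<^sup>2 \<le> 2 * (Y\<^sup>2 + 1)"
        using zero_le_power2[of "Y - 1"] by (simp add: power2_eq_square algebra_simps)
      then have "c4\<^sup>2 * (Y + 1)\<^sup>2 \<le> c4\<^sup>2 * (2 * (Y\<^sup>2 + 1))" by (rule mult_left_mono) simp
      then show ?thesis unfolding power_mult_distrib by linarith
    qed
    also have "\<dots> \<le> 2 * c4\<^sup>2 * (4 / l\<^sup>2 * (P * \<tau> + c3) + 1)"
      using YY by (intro mult_left_mono) auto
    also have "\<dots> \<le> 2 * c4\<^sup>2 * ((4 / l\<^sup>2 + 4 * c3 / l\<^sup>2 + 1) * (P * \<tau> + 1))"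
    proof (intro mult_left_mono)
      have "0 \<le> P * \<tau> * (4 * c3 / l\<^sup>2 + 1) + 4 / l\<^sup>2" using P t pos assms by simp
      then show "4 / l\<^sup>2 * (P * \<tau> + c3) + 1 \<le> (4 / l\<^sup>2 + 4 * c3 / l\<^sup>2 + 1) * (P * \<tau> + 1)"
        by (simp add: algebra_simps add_divide_distrib)
    qed simp
    also have "\<dots> = c5 * (P * \<tau> + 1)" by (simp add: c5_def mult_ac)
    finally have main: "P * P \<le> c5 * (P * \<tau> + 1)" by (simp add: power2_eq_square)
    show "P \<le> (c5 + 1) * (\<tau> + 1)"
    proof (rule ccontr)
      assume "\<not> ?thesis"
      then have gt: "P > (c5 + 1) * (\<tau> + 1)" by simp
      \<comment> \<open>From the negation follow \<open>P > 1\<close> and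
        \<open>P > c5 * \<tau> + c5\<close>; multiplied by \<open>P\<close>, the latter exceeds
        \<open>c5 * (P * \<tau> + 1)\<close>.\<close>
      have "(c5 + 1) * (\<tau> + 1) = 1 + c5 + \<tau> + c5 * \<tau>" by (simp add: algebra_simps)
      moreover have "c5 * \<tau> > 0" using pos5 t by simp
      ultimately have "P > 1" "P > c5 * \<tau> + c5" using gt pos5 t by linarith+
      then have "P * P > P * (c5 * \<tau> + c5)" using P by simp
      moreover have "P * (c5 * \<tau> + c5) = c5 * (P * \<tau>) + c5 * P" by (simp add: algebra_simps)
      moreover have "c5 * P \<ge> c5 * 1" using \<open>P > 1\<close> pos5 by (intro mult_left_mono) auto
      ultimately show False using main by (simp add: algebra_simps)
    qed
  qed (use pos5 in simp)
qed

lemma sum_swap4: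
  "(\<Sum>k\<in>B. \<Sum>l\<in>B. \<Sum>i\<in>B. \<Sum>j\<in>B. F k l i j) = (\<Sum>i\<in>B. \<Sum>j\<in>B. \<Sum>k\<in>B. \<Sum>l\<in>B. F k l i j)"
proof -
  have "(\<Sum>k\<in>B. \<Sum>l\<in>B. \<Sum>i\<in>B. \<Sum>j\<in>B. F k l i j) = (\<Sum>k\<in>B. \<Sum>i\<in>B. \<Sum>j\<in>B. \<Sum>l\<in>B. F k l i j)"
    by (subst sum.swap) (intro sum.cong refl sum.swap)
  also have "\<dots> = (\<Sum>i\<in>B. \<Sum>j\<in>B. \<Sum>k\<in>B. \<Sum>l\<in>B. F k l i j)"
    by (subst sum.swap) (intro sum.cong refl sum.swap)
  finally show ?thesis .
qed

text \<open>One constant for both hypotheses of \<open>growth_const\<close>, for \<open>m\<close>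
  coordinates and coefficients bounded by \<open>K\<close>: the first summand serves the remainder
  \<open>R\<close>, the other three the linear terms in \<open>P + Q\<close>.\<close>

definition li_yau_error :: "real \<Rightarrow> real \<Rightarrow> real" where
  "li_yau_error m K = 23 * (m ^ 4 * K\<^sup>2) + 2 * (m * (m * K)) + 2 * (m * K) + 2 * K"

text \<open>The data are the values at one point of \<open>f = ln u\<close> and of the coefficients:
  \<open>p\<close>, \<open>h\<close>, \<open>h3\<close> are the first, second and third space derivatives of \<open>f\<close>; \<open>ft\<close>, \<open>ft1\<close>, \<open>ft2\<close>
  are \<open>\<partial>\<^sub>t f\<close> and its space derivatives; \<open>Q1\<close> and \<open>Qt\<close> belong to \<open>Q = a\<^sub>i\<^sub>j f\<^sub>i f\<^sub>j\<close>, and \<open>P2\<close>, \<open>Pt\<close> to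
  \<open>P = Q - 2 \<partial>\<^sub>t f\<close>. The point is a spatial maximum of \<open>P\<close> and a temporal maximum of \<open>t P\<close>.\<close>

locale li_yau_data =
  fixes l K :: real and B :: "'i set" and a :: "'i \<Rightarrow> 'i \<Rightarrow> real" and a1 a2 ad b b1 bt c c1 ct Q1 p
    and h :: "'i \<Rightarrow> 'i \<Rightarrow> real" and h3 ft1 Qt ftt ft2 P2 Pt ft P t
  assumes B: "finite B" "B \<noteq> {}" and l: "l > 0" and K: "K \<ge> 1"
    and sym: "\<And>i j. i \<in> B \<Longrightarrow> j \<in> B \<Longrightarrow> a i j = a j i"
    and ell: "\<And>x. l * (\<Sum>i\<in>B. (x i)\<^sup>2) \<le> quad B a x"
    and bnd: "\<And>i j. i \<in> B \<Longrightarrow> j \<in> B \<Longrightarrow> \<bar>a i j\<bar> \<le> K"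
      "\<And>k i j. k \<in> B \<Longrightarrow> i \<in> B \<Longrightarrow> j \<in> B \<Longrightarrow> \<bar>a1 k i j\<bar> \<le> K"
      "\<And>k l i j. k \<in> B \<Longrightarrow> l \<in> B \<Longrightarrow> i \<in> B \<Longrightarrow> j \<in> B \<Longrightarrow> \<bar>a2 k l i j\<bar> \<le> K"
      "\<And>i j. i \<in> B \<Longrightarrow> j \<in> B \<Longrightarrow> \<bar>ad i j\<bar> \<le> K"
      "\<And>i. i \<in> B \<Longrightarrow> \<bar>b i\<bar> \<le> K"
      "\<And>k i. k \<in> B \<Longrightarrow> i \<in> B \<Longrightarrow> \<bar>b1 k i\<bar> \<le> K"
      "\<And>i. i \<in> B \<Longrightarrow> \<bar>bt i\<bar> \<le> K"
    and c: "\<bar>c\<bar> \<le> K"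
    and bnd2: "\<And>i. i \<in> B \<Longrightarrow> \<bar>c1 i\<bar> \<le> K" "\<bar>ct\<bar> \<le> K"
    and Q1: "\<And>k. k \<in> B \<Longrightarrow> Q1 k = (\<Sum>i\<in>B. \<Sum>j\<in>B. a1 k i j * p i * p j + 2 * a i j * h k i * p j)"
    and third: "\<And>i. i \<in> B \<Longrightarrow> (\<Sum>k\<in>B. \<Sum>l\<in>B. a k l * h3 l k i)
      = ft1 i - Q1 i - (\<Sum>k\<in>B. b1 i k * p k + b k * h i k) - c1 i - (\<Sum>k\<in>B. \<Sum>l\<in>B. a1 i k l * h k l)"
    and crit: "\<And>i. i \<in> B \<Longrightarrow> Q1 i = 2 * ft1 i"
    and Qt: "Qt = (\<Sum>i\<in>B. \<Sum>j\<in>B. ad i j * p i * p j + 2 * a i j * ft1 i * p j)"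
    and ftt: "ftt = (\<Sum>k\<in>B. \<Sum>l\<in>B. a k l * ft2 k l) + (\<Sum>k\<in>B. \<Sum>l\<in>B. ad k l * h k l) + Qt
      + (\<Sum>k\<in>B. bt k * p k + b k * ft1 k) + ct"
    and P2: "\<And>k l. k \<in> B \<Longrightarrow> l \<in> B \<Longrightarrow> P2 k l = (\<Sum>i\<in>B. \<Sum>j\<in>B. a2 k l i j * p i * p j
      + a1 k i j * (h l i * p j + p i * h l j)
      + 2 * (a1 l i j * h k i * p j + a i j * h3 l k i * p j + a i j * h k i * h l j)) - 2 * ft2 k l"
    and Pt: "Pt = Qt - 2 * ftt"
    and ft: "ft = (\<Sum>k\<in>B. \<Sum>l\<in>B. a k l * h k l) + quad B a p + (\<Sum>k\<in>B. b k * p k) + c"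
    and P: "P = quad B a p - 2 * ft" and P0: "P > 0" and t: "t > 0"
    and max: "(\<Sum>k\<in>B. \<Sum>l\<in>B. a k l * P2 k l) \<le> 0" "0 \<le> P / t + Pt"
begin

text \<open>The lower order part of the evolution of \<open>P\<close>. Every summand is at most
  linear in \<open>h\<close> and of degree at most two in \<open>p\<close> and \<open>h\<close>
  together, where \<open>Q1\<close> counts as degree two; so the squared Hessian dominates it once
  the gradient is controlled.\<close>

definition "R = (\<Sum>k\<in>B. \<Sum>l\<in>B. a k l * (\<Sum>i\<in>B. \<Sum>j\<in>B. a2 k l i j * p i * p j
          + a1 k i j * (h l i * p j + p i * h l j) + 2 * a1 l i j * h k i * p j))
      + 2 * (\<Sum>i\<in>B. \<Sum>j\<in>B. a i j * p j * (- (\<Sum>k\<in>B. b1 i k * p k + b k * h i k) - c1 i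
          - (\<Sum>k\<in>B. \<Sum>l\<in>B. a1 i k l * h k l)))
      + (\<Sum>i\<in>B. \<Sum>j\<in>B. ad i j * p i * p j) + 2 * (\<Sum>k\<in>B. \<Sum>l\<in>B. ad k l * h k l)
      + 2 * (\<Sum>k\<in>B. bt k * p k) + (\<Sum>k\<in>B. b k * Q1 k) + 2 * ct"

text \<open>All third derivatives of \<open>f\<close> and all derivatives of \<open>\<partial>\<^sub>t f\<close> cancel because \<open>P\<close> is critical in space.\<close>

lemma identity: "(\<Sum>k\<in>B. \<Sum>l\<in>B. a k l * P2 k l) - Pt =
  2 * (\<Sum>k\<in>B. \<Sum>l\<in>B. a k l * (\<Sum>i\<in>B. \<Sum>j\<in>B. a i j * h k i * h l j)) + R"
proof -
  define U where "U k l = (\<Sum>i\<in>B. \<Sum>j\<in>B. a2 k l i j * p i * p j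
          + a1 k i j * (h l i * p j + p i * h l j) + 2 * a1 l i j * h k i * p j)" for k l
  define V where "V k l = (\<Sum>i\<in>B. \<Sum>j\<in>B. a i j * h3 l k i * p j)" for k l
  define W where "W k l = (\<Sum>i\<in>B. \<Sum>j\<in>B. a i j * h k i * h l j)" for k l
  define S where "S i = - (\<Sum>k\<in>B. b1 i k * p k + b k * h i k) - c1 i - (\<Sum>k\<in>B. \<Sum>l\<in>B. a1 i k l * h k l)" for i
  have P2': "P2 k l = U k l + 2 * V k l + 2 * W k l - 2 * ft2 k l" if "k \<in> B" "l \<in> B" for k l
    unfolding P2[OF that] U_def V_def W_def sum_distrib_left sum.distrib[symmetric]
    by (simp add: algebra_simps)
  have "(\<Sum>k\<in>B. \<Sum>l\<in>B. a k l * P2 k l)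
      = (\<Sum>k\<in>B. \<Sum>l\<in>B. a k l * U k l + 2 * (a k l * V k l) + 2 * (a k l * W k l) - 2 * (a k l * ft2 k l))"
    by (intro sum.cong refl) (simp add: P2' algebra_simps)
  also have "\<dots> = (\<Sum>k\<in>B. \<Sum>l\<in>B. a k l * U k l) + 2 * (\<Sum>k\<in>B. \<Sum>l\<in>B. a k l * V k l)
      + 2 * (\<Sum>k\<in>B. \<Sum>l\<in>B. a k l * W k l) - 2 * (\<Sum>k\<in>B. \<Sum>l\<in>B. a k l * ft2 k l)"
    by (simp only: sum.distrib sum_subtractf sum_distrib_left)
  finally have E1: "(\<Sum>k\<in>B. \<Sum>l\<in>B. a k l * P2 k l)
      = (\<Sum>k\<in>B. \<Sum>l\<in>B. a k l * U k l) + 2 * (\<Sum>k\<in>B. \<Sum>l\<in>B. a k l * V k l)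
      + 2 * (\<Sum>k\<in>B. \<Sum>l\<in>B. a k l * W k l) - 2 * (\<Sum>k\<in>B. \<Sum>l\<in>B. a k l * ft2 k l)" .
  \<comment> \<open>The third derivatives occur only contracted with \<open>a\<close>, as in the
    differentiated equation \<open>third\<close>. By \<open>crit\<close>, the difference
    \<open>ft1 - Q1\<close> in it is \<open>- ft1\<close>.\<close>
  have "(\<Sum>k\<in>B. \<Sum>l\<in>B. a k l * V k l) = (\<Sum>k\<in>B. \<Sum>l\<in>B. \<Sum>i\<in>B. \<Sum>j\<in>B. a i j * p j * (a k l * h3 l k i))"
    unfolding V_def sum_distrib_left by (intro sum.cong refl) (simp add: mult_ac)
  also have "\<dots> = (\<Sum>i\<in>B. \<Sum>j\<in>B. a i j * p j * (\<Sum>k\<in>B. \<Sum>l\<in>B. a k l * h3 l k i))"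
    unfolding sum_distrib_left by (rule sum_swap4)
  also have "\<dots> = (\<Sum>i\<in>B. \<Sum>j\<in>B. a i j * p j * S i - a i j * ft1 i * p j)"
    by (intro sum.cong refl) (simp add: third S_def crit algebra_simps)
  also have "\<dots> = (\<Sum>i\<in>B. \<Sum>j\<in>B. a i j * p j * S i) - (\<Sum>i\<in>B. \<Sum>j\<in>B. a i j * ft1 i * p j)"
    by (simp only: sum_subtractf)
  finally have E2: "(\<Sum>k\<in>B. \<Sum>l\<in>B. a k l * V k l)
      = (\<Sum>i\<in>B. \<Sum>j\<in>B. a i j * p j * S i) - (\<Sum>i\<in>B. \<Sum>j\<in>B. a i j * ft1 i * p j)" .
  have E3: "Qt = (\<Sum>i\<in>B. \<Sum>j\<in>B. ad i j * p i * p j) + 2 * (\<Sum>i\<in>B. \<Sum>j\<in>B. a i j * ft1 i * p j)"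
    unfolding Qt by (simp add: sum.distrib sum_distrib_left mult.assoc)
  have "(\<Sum>k\<in>B. b k * Q1 k) = (\<Sum>k\<in>B. 2 * (b k * ft1 k))"
    by (intro sum.cong refl) (simp add: crit)
  then have E4: "(\<Sum>k\<in>B. b k * Q1 k) = 2 * (\<Sum>k\<in>B. b k * ft1 k)"
    by (simp only: sum_distrib_left)
  \<comment> \<open>Since \<open>ftt\<close> contains \<open>Qt\<close>, the term
    \<open>- Pt = 2 * ftt - Qt\<close> leaves one \<open>Qt\<close>, whose \<open>ft1\<close> part
    cancels that of twice \<open>E2\<close>. The \<open>ft2\<close> terms cancel likewise, and
    \<open>E4\<close> rewrites the drift terms in \<open>ft1\<close> by \<open>Q1\<close>.\<close>
  show ?thesis
    unfolding R_def U_def[symmetric] W_def[symmetric] S_def[symmetric] E1 E2 E4 Pt ftt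
    using E3 by (simp add: sum.distrib)
qed

text \<open>The bound is built by rules that mirror the structure of \<open>R\<close>: each sum
  costs a factor \<open>m\<close>, each coefficient a factor \<open>K\<close>. As \<open>m\<close>
  and \<open>K\<close> are at least 1, every monomial is then raised to
  \<open>m^4 K^2\<close>.\<close>

lemma remainder_bound:
  assumes m: "m = real (card B)" "m \<ge> 1"
    and X: "\<And>i. i \<in> B \<Longrightarrow> \<bar>p i\<bar> \<le> X" "X \<ge> 0"
    and Y: "\<And>i j. i \<in> B \<Longrightarrow> j \<in> B \<Longrightarrow> \<bar>h i j\<bar> \<le> Y" "Y \<ge> 0"
  shows "\<bar>R\<bar> \<le> 23 * (m ^ 4 * K\<^sup>2) * (X\<^sup>2 + X * Y + X + Y + 1)"
proof -
  have K0: "K \<ge> 0" using K by simp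
  have S1: "\<bar>\<Sum>i\<in>B. g i\<bar> \<le> m * M" if "\<And>i. i \<in> B \<Longrightarrow> \<bar>g i\<bar> \<le> M" for g :: "'i \<Rightarrow> real" and M
    unfolding m(1) by (rule abs_sum_le[OF that])
  have S2: "\<bar>\<Sum>i\<in>B. \<Sum>j\<in>B. g i j\<bar> \<le> m * (m * M)"
    if "\<And>i j. i \<in> B \<Longrightarrow> j \<in> B \<Longrightarrow> \<bar>g i j\<bar> \<le> M" for g :: "'i \<Rightarrow> 'i \<Rightarrow> real" and M
    by (intro S1 that)
  have M: "\<bar>x * y\<bar> \<le> c * d" if "\<bar>x\<bar> \<le> c" "\<bar>y\<bar> \<le> d" for x y c d :: real
    unfolding abs_mult using that by (intro mult_mono) auto
  have A: "\<bar>x + y\<bar> \<le> c + d" if "\<bar>x\<bar> \<le> c" "\<bar>y\<bar> \<le> d" for x y c d :: real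
    using that by linarith
  have N: "\<bar>- x\<bar> \<le> c" if "\<bar>x\<bar> \<le> c" for x c :: real
    using that by simp
  have D: "\<bar>x - y\<bar> \<le> c + d" if "\<bar>x\<bar> \<le> c" "\<bar>y\<bar> \<le> d" for x y c d :: real
    using that by linarith
  have two: "\<bar>2\<bar> \<le> (2::real)" by simp
  have R6: "\<bar>Q1 k\<bar> \<le> m * (m * (K * X * X + 2 * K * Y * X))" if "k \<in> B" for k
    unfolding Q1[OF that] by (intro S2 A M two X Y bnd that)
  have "\<bar>R\<bar>
    \<le> m * (m * (K * (m * (m * (K * X * X + K * (Y * X + X * Y) + 2 * K * Y * X)))))
      + 2 * (m * (m * (K * X * (m * (K * X + K * Y) + K + m * (m * (K * Y))))))
      + m * (m * (K * X * X)) + 2 * (m * (m * (K * Y))) + 2 * (m * (K * X))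
      + m * (K * (m * (m * (K * X * X + 2 * K * Y * X)))) + 2 * K"
    unfolding R_def by (intro A M N D S1 S2 two X Y bnd bnd2 R6)
  also have "\<dots> = (m ^ 4 * K\<^sup>2) * (X\<^sup>2 + 4 * (X * Y))
      + (m ^ 3 * K\<^sup>2) * (2 * X\<^sup>2 + 2 * (X * Y)) + 2 * (m\<^sup>2 * K\<^sup>2) * X + 2 * (m ^ 4 * K\<^sup>2) * (X * Y)
      + (m\<^sup>2 * K) * X\<^sup>2 + 2 * (m\<^sup>2 * K) * Y + 2 * (m * K) * X
      + (m ^ 3 * K\<^sup>2) * (X\<^sup>2 + 2 * (X * Y)) + 2 * K"
    by (simp add: power2_eq_square power3_eq_cube power4_eq_xxxx algebra_simps)
  also have "\<dots> \<le> (m ^ 4 * K\<^sup>2) * (X\<^sup>2 + 4 * (X * Y))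
      + (m ^ 4 * K\<^sup>2) * (2 * X\<^sup>2 + 2 * (X * Y)) + 2 * (m ^ 4 * K\<^sup>2) * X + 2 * (m ^ 4 * K\<^sup>2) * (X * Y)
      + (m ^ 4 * K\<^sup>2) * X\<^sup>2 + 2 * (m ^ 4 * K\<^sup>2) * Y + 2 * (m ^ 4 * K\<^sup>2) * X
      + (m ^ 4 * K\<^sup>2) * (X\<^sup>2 + 2 * (X * Y)) + 2 * (m ^ 4 * K\<^sup>2)"
  proof -
    have KK: "K \<le> K\<^sup>2" "0 \<le> K\<^sup>2" using K by (auto simp: power2_eq_square)
    have mm: "m ^ 3 \<le> m ^ 4" "m\<^sup>2 \<le> m ^ 4" "m \<le> m ^ 4" "1 \<le> m ^ 4"
      using m(2) power_increasing[of 3 4 m] power_increasing[of 2 4 m] power_increasing[of 1 4 m]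
        one_le_power[of m 4] by auto
    have i: "m ^ 3 * K\<^sup>2 \<le> m ^ 4 * K\<^sup>2" "m\<^sup>2 * K\<^sup>2 \<le> m ^ 4 * K\<^sup>2" "m\<^sup>2 * K \<le> m ^ 4 * K\<^sup>2"
      "m * K \<le> m ^ 4 * K\<^sup>2" "K \<le> m ^ 4 * K\<^sup>2"
      using mm KK K0 m(2) mult_mono[of 1 "m ^ 4" K "K\<^sup>2"] by (auto intro!: mult_mono)
    show ?thesis
      using X(2) Y(2) by (intro add_mono mult_right_mono mult_left_mono i order_refl) auto
  qed
  \<comment> \<open>23 is the sum 5 + 10 + 4 + 2 + 2 of the coefficients of \<open>X^2\<close>,
    \<open>X * Y\<close>, \<open>X\<close>, \<open>Y\<close> and 1 in the previous bound.\<close>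
  also have "\<dots> \<le> 23 * (m ^ 4 * K\<^sup>2) * (X\<^sup>2 + X * Y + X + Y + 1)"
  proof -
    have "0 \<le> (m ^ 4 * K\<^sup>2) * (18 * X\<^sup>2 + 13 * (X * Y) + 19 * X + 21 * Y + 21)"
      using X(2) Y(2) m(2) K0 by (intro mult_nonneg_nonneg add_nonneg_nonneg) auto
    then show ?thesis by (simp add: algebra_simps)
  qed
  finally show ?thesis .
qed

text \<open>The formula for \<open>ft\<close> makes \<open>P + Q\<close> linear in \<open>p\<close>
  and \<open>h\<close>, and ellipticity bounds \<open>Q\<close> below by \<open>l * X^2\<close>: the
  first hypothesis of \<open>growth_const\<close>. The second is \<open>identity\<close> at the
  maximum, where the factor 2 cancels the 1/2 of \<open>quad_hessian_lower\<close>.\<close>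

lemma estimate:
  assumes A: "growth_const l (li_yau_error (real (card B)) K) A"
  shows "P \<le> A * (1 / t + 1)"
proof -
  define m where "m = real (card B)"
  have m: "m \<ge> 1" using B by (simp add: m_def Suc_leI card_gt_0_iff)
  define cc where "cc = li_yau_error m K"
  have mK: "m ^ 4 * K\<^sup>2 > 0" "m * (m * K) > 0" "m * K > 0" "K > 0" using m K by auto
  define X where "X = sqrt (\<Sum>i\<in>B. (p i)\<^sup>2)"
  define Y where "Y = sqrt (\<Sum>k\<in>B. \<Sum>i\<in>B. (h k i)\<^sup>2)"
  have X2: "X\<^sup>2 = (\<Sum>i\<in>B. (p i)\<^sup>2)" by (simp add: X_def sum_nonneg)
  have Y2: "Y\<^sup>2 = (\<Sum>k\<in>B. \<Sum>i\<in>B. (h k i)\<^sup>2)" by (simp add: Y_def sum_nonneg)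
  have X0: "X \<ge> 0" and Y0: "Y \<ge> 0" by (auto simp: X_def Y_def intro!: sum_nonneg)
  have pX: "\<bar>p i\<bar> \<le> X" if "i \<in> B" for i
    using member_le_sum[OF that, of "\<lambda>i. (p i)\<^sup>2"] B(1)
    by (auto simp: X_def intro!: real_le_rsqrt)
  have hY: "\<bar>h i j\<bar> \<le> Y" if "i \<in> B" "j \<in> B" for i j
  proof -
    have "(h i j)\<^sup>2 \<le> (\<Sum>j\<in>B. (h i j)\<^sup>2)"
      using member_le_sum[OF that(2), of "\<lambda>j. (h i j)\<^sup>2"] B(1) by auto
    also have "\<dots> \<le> (\<Sum>k\<in>B. \<Sum>j\<in>B. (h k j)\<^sup>2)"
      by (rule member_le_sum[OF that(1), of "\<lambda>i. \<Sum>j\<in>B. (h i j)\<^sup>2"]) (auto intro: sum_nonneg B(1))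
    finally show ?thesis by (auto simp: Y_def intro!: real_le_rsqrt)
  qed
  have "P + quad B a p = - 2 * ((\<Sum>k\<in>B. \<Sum>l\<in>B. a k l * h k l) + (\<Sum>k\<in>B. b k * p k) + c)"
    using P ft by simp
  moreover have "\<bar>\<Sum>k\<in>B. \<Sum>l\<in>B. a k l * h k l\<bar> \<le> m * (m * (K * Y))"
    unfolding m_def using bnd(1) hY K
    by (intro abs_sum_le) (auto simp: abs_mult intro!: mult_mono)
  moreover have "\<bar>\<Sum>k\<in>B. b k * p k\<bar> \<le> m * (K * X)"
    unfolding m_def using bnd(5) pX K
    by (intro abs_sum_le) (auto simp: abs_mult intro!: mult_mono)
  moreover have "s \<le> 2 * (u1 + u2 + K)"
    if "s = - 2 * (s1 + s2 + c)" "\<bar>s1\<bar> \<le> u1" "\<bar>s2\<bar> \<le> u2" for s s1 s2 u1 u2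
    using that c by (simp add: abs_le_iff)
  ultimately have "P + quad B a p \<le> 2 * (m * (m * (K * Y)) + m * (K * X) + K)"
    by blast
  also have "\<dots> \<le> cc * (X + Y + 1)"
  proof -
    have "0 \<le> (23 * (m ^ 4 * K\<^sup>2)) * (X + Y + 1) + 2 * (m * (m * K)) * (X + 1)
        + 2 * (m * K) * (Y + 1) + 2 * K * (X + Y)"
      using mK m X0 Y0 by (intro add_nonneg_nonneg mult_nonneg_nonneg) auto
    then show ?thesis by (simp add: cc_def li_yau_error_def algebra_simps)
  qed
  finally have bound1: "l * X\<^sup>2 + P \<le> cc * (X + Y + 1)"
    using ell[of p] by (simp add: X2)
  have R: "\<bar>R\<bar> \<le> 23 * (m ^ 4 * K\<^sup>2) * (X\<^sup>2 + X * Y + X + Y + 1)"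
    by (rule remainder_bound[OF m_def m pX X0 hY Y0])
  have "l\<^sup>2 * Y\<^sup>2 \<le> 2 * (\<Sum>k\<in>B. \<Sum>l\<in>B. a k l * (\<Sum>i\<in>B. \<Sum>j\<in>B. a i j * h k i * h l j))"
    using quad_hessian_lower[OF B(1) l sym ell, of h] by (simp add: Y2)
  also have "\<dots> \<le> P * (1 / t) - R" using identity max by simp
  also have "\<dots> \<le> P * (1 / t) + cc * (X\<^sup>2 + X * Y + X + Y + 1)"
  proof -
    have "0 \<le> (2 * (m * (m * K)) + 2 * (m * K) + 2 * K) * (X\<^sup>2 + X * Y + X + Y + 1)"
      using mK m X0 Y0 by (intro mult_nonneg_nonneg add_nonneg_nonneg) auto
    then show ?thesis using R by (simp add: cc_def li_yau_error_def distrib_right abs_le_iff)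
  qed
  finally have bound2: "l\<^sup>2 * Y\<^sup>2 \<le> P * (1 / t) + cc * (X\<^sup>2 + X * Y + X + Y + 1)" .
  show ?thesis
    using A P0 t X0 Y0 bound1 bound2 unfolding growth_const_def m_def[symmetric] cc_def[symmetric] by simp
qed

end

section \<open>Derivative tests at a maximum\<close>

text \<open>If \<open>d\<close> were positive, \<open>\<phi>'\<close> would be positive immediately
  to the right of 0 and \<open>\<phi>\<close> would rise above its maximum.\<close>

lemma second_derivative_at_max:
  fixes \<phi> :: "real \<Rightarrow> real"
  assumes "e > 0" and der: "\<And>s. \<bar>s\<bar> < e \<Longrightarrow> (\<phi> has_real_derivative \<phi>' s) (at s)"
    and d: "(\<phi>' has_real_derivative d) (at 0)"
    and max: "\<And>s. \<bar>s\<bar> < e \<Longrightarrow> \<phi> s \<le> \<phi> 0"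
  shows "\<phi>' 0 = 0" "d \<le> 0"
proof -
  show 0: "\<phi>' 0 = 0"
    by (rule DERIV_local_max[OF der assms(1)]) (use assms in auto)
  show "d \<le> 0"
  proof (rule ccontr)
    assume "\<not> d \<le> 0"
    then obtain r where r: "r > 0" "\<And>h. h > 0 \<Longrightarrow> h < r \<Longrightarrow> \<phi>' 0 < \<phi>' (0 + h)"
      using DERIV_pos_inc_right[OF d] by auto
    define s where "s = min (e / 2) (r / 2)"
    have s: "s > 0" "s < e" "s < r" using \<open>e > 0\<close> r(1) by (auto simp: s_def)
    have "\<exists>z>0. z < s \<and> \<phi> s - \<phi> 0 = (s - 0) * \<phi>' z"
      by (rule MVT2) (use s der in auto)
    then obtain x where x: "x > 0" "x < s" "\<phi> s - \<phi> 0 = s * \<phi>' x" by auto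
    have "\<phi>' x > 0" using r(2)[of x] x s 0 by simp
    then have "s * \<phi>' x > 0" using s by simp
    then show False using x(3) max[of s] s by simp
  qed
qed

context space_time
begin

lemma d_space_cmult:
  fixes f :: "'e \<Rightarrow> real \<Rightarrow> real"
  assumes "C 1 0 f" "b \<in> Basis" "z \<in> D" "t \<in> I"
  shows "d_space b (\<lambda>z t. c * f z t) z t = c * d_space b f z t"
  by (rule d_space_linear[OF bounded_linear_mult_right assms])

lemma d_time_cmult:
  fixes f :: "'e \<Rightarrow> real \<Rightarrow> real"
  assumes "C 0 1 f" "z \<in> D" "t \<in> I"
  shows "d_time I (\<lambda>z t. c * f z t) z t = c * d_time I f z t"
  by (rule d_time_linear[OF bounded_linear_mult_right assms])

lemma C_cmult:
  fixes f :: "'e \<Rightarrow> real \<Rightarrow> real"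
  assumes "C k p f"
  shows "C k p (\<lambda>z t. c * f z t)"
  by (rule C_linear[OF bounded_linear_mult_right assms])

lemma d_space_sum2:
  assumes "\<And>i j. i \<in> B \<Longrightarrow> j \<in> B \<Longrightarrow> C 1 0 (f i j)" "b \<in> Basis" "z \<in> D" "t \<in> I"
  shows "d_space b (\<lambda>z t. \<Sum>i\<in>B. \<Sum>j\<in>B. f i j z t) z t = (\<Sum>i\<in>B. \<Sum>j\<in>B. d_space b (f i j) z t)"
  using assms by (simp add: d_space_sum C_sum cong: sum.cong)

lemma d_time_sum2:
  assumes "\<And>i j. i \<in> B \<Longrightarrow> j \<in> B \<Longrightarrow> C 0 1 (f i j)" "z \<in> D" "t \<in> I"
  shows "d_time I (\<lambda>z t. \<Sum>i\<in>B. \<Sum>j\<in>B. f i j z t) z t = (\<Sum>i\<in>B. \<Sum>j\<in>B. d_time I (f i j) z t)"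
  using assms by (simp add: d_time_sum C_sum cong: sum.cong)

lemma d_space_mult3:
  fixes f g h :: "'e \<Rightarrow> real \<Rightarrow> real"
  assumes "C 1 0 f" "C 1 0 g" "C 1 0 h" "b \<in> Basis" "z \<in> D" "t \<in> I"
  shows "d_space b (\<lambda>z t. f z t * g z t * h z t) z t
    = d_space b f z t * g z t * h z t + f z t * d_space b g z t * h z t + f z t * g z t * d_space b h z t"
  using d_space_mult[OF C_mult[OF assms(1,2)] assms(3-6)] d_space_mult[OF assms(1,2,4-6)]
  by (simp add: algebra_simps)

lemma d_time_mult3:
  fixes f g h :: "'e \<Rightarrow> real \<Rightarrow> real"
  assumes "C 0 1 f" "C 0 1 g" "C 0 1 h" "z \<in> D" "t \<in> I"
  shows "d_time I (\<lambda>z t. f z t * g z t * h z t) z t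
    = d_time I f z t * g z t * h z t + f z t * d_time I g z t * h z t + f z t * g z t * d_time I h z t"
  using d_time_mult[OF C_mult[OF assms(1,2)] assms(3-5)] d_time_mult[OF assms(1,2,4-5)]
  by (simp add: algebra_simps)

lemma C_deriv_along:
  fixes f :: "'e \<Rightarrow> real \<Rightarrow> real"
  assumes "C 1 0 f" "z + s *\<^sub>R v \<in> D" "t \<in> I"
  shows "((\<lambda>s. f (z + s *\<^sub>R v) t) has_real_derivative
    (\<Sum>b\<in>Basis. (v \<bullet> b) * d_space b f (z + s *\<^sub>R v) t)) (at s)"
proof -
  have "((\<lambda>s. z + s *\<^sub>R v) has_derivative (\<lambda>r. r *\<^sub>R v)) (at s)"
    by (auto intro!: derivative_eq_intros)
  from has_derivative_compose[OF this C_frechet[OF assms]]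
  have "((\<lambda>s. f (z + s *\<^sub>R v) t) has_derivative
      (\<lambda>r. \<Sum>b\<in>Basis. (r *\<^sub>R v \<bullet> b) * d_space b f (z + s *\<^sub>R v) t)) (at s)" .
  moreover have "(\<lambda>r. \<Sum>b\<in>Basis. (r *\<^sub>R v \<bullet> b) * d_space b f (z + s *\<^sub>R v) t)
      = (\<lambda>r. (\<Sum>b\<in>Basis. (v \<bullet> b) * d_space b f (z + s *\<^sub>R v) t) * r)"
    by (auto simp: sum_distrib_left sum_distrib_right mult_ac)
  ultimately show ?thesis
    by (simp add: has_field_derivative_def)
qed

text \<open>The one-dimensional test is applied on every line through \<open>z\<close>; the
  direction for the quadratic form is the vector with coordinates \<open>x b\<close>.\<close>

lemma spatial_max:
  fixes P :: "'e \<Rightarrow> real \<Rightarrow> real"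
  assumes P: "C 2 0 P" and zt: "z \<in> D" "t \<in> I" and max: "\<And>y. y \<in> D \<Longrightarrow> P y t \<le> P z t"
  shows "b \<in> Basis \<Longrightarrow> d_space b P z t = 0"
    and "(\<Sum>b\<in>Basis. \<Sum>b'\<in>Basis. d_space b' (d_space b P) z t * x b * x b') \<le> 0"
proof -
  have P1: "C 1 0 P" using C_class_mono[OF P, of 1 0] by simp
  have P2: "C 1 0 (d_space b P)" if "b \<in> Basis" for b
    using C_class_space[of 1] P that by (simp add: numeral_2_eq_2)
  have *: "(\<Sum>b\<in>Basis. (v \<bullet> b) * d_space b P z t) = 0 \<and>
    (\<Sum>b\<in>Basis. (v \<bullet> b) * (\<Sum>b'\<in>Basis. (v \<bullet> b') * d_space b' (d_space b P) z t)) \<le> 0" for v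
  proof -
    have "eventually (\<lambda>s. z + s *\<^sub>R v \<in> D) (nhds 0)" by (rule eventually_line_in[OF zt(1)])
    then obtain e where e: "e > 0" "\<And>s. dist s 0 < e \<Longrightarrow> z + s *\<^sub>R v \<in> D"
      unfolding eventually_nhds_metric by blast
    define \<phi>' where "\<phi>' s = (\<Sum>b\<in>Basis. (v \<bullet> b) * d_space b P (z + s *\<^sub>R v) t)" for s
    have 1: "((\<lambda>s. P (z + s *\<^sub>R v) t) has_real_derivative \<phi>' s) (at s)" if "\<bar>s\<bar> < e" for s
      unfolding \<phi>'_def using e(2)[of s] that by (intro C_deriv_along P1 zt) (simp add: dist_real_def)
    have 2: "(\<phi>' has_real_derivative (\<Sum>b\<in>Basis. (v \<bullet> b) *
        (\<Sum>b'\<in>Basis. (v \<bullet> b') * d_space b' (d_space b P) (z + 0 *\<^sub>R v) t))) (at 0)"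
      unfolding \<phi>'_def using zt by (intro DERIV_sum DERIV_cmult C_deriv_along P2) auto
    have 3: "P (z + s *\<^sub>R v) t \<le> P (z + 0 *\<^sub>R v) t" if "\<bar>s\<bar> < e" for s
      using max[OF e(2)[of s]] that by (simp add: dist_real_def)
    show ?thesis
      using second_derivative_at_max[OF e(1) 1 2 3] unfolding \<phi>'_def by simp
  qed
  show "d_space b P z t = 0" if "b \<in> Basis"
  proof -
    have "(\<Sum>c\<in>Basis. (b \<bullet> c) * d_space c P z t) = (\<Sum>c\<in>Basis. if c = b then d_space b P z t else 0)"
      using that by (intro sum.cong) (auto simp: inner_Basis)
    then show ?thesis using *[of b] that by simp
  qed
  define v where "v = (\<Sum>b\<in>Basis. x b *\<^sub>R b)"
  have v: "v \<bullet> b = x b" if "b \<in> Basis" for b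
    using that by (simp add: v_def)
  have "(\<Sum>b\<in>Basis. \<Sum>b'\<in>Basis. d_space b' (d_space b P) z t * x b * x b')
      = (\<Sum>b\<in>Basis. (v \<bullet> b) * (\<Sum>b'\<in>Basis. (v \<bullet> b') * d_space b' (d_space b P) z t))"
    unfolding sum_distrib_left by (intro sum.cong refl) (simp add: v mult_ac)
  then show "(\<Sum>b\<in>Basis. \<Sum>b'\<in>Basis. d_space b' (d_space b P) z t * x b * x b') \<le> 0"
    using * by simp
qed

text \<open>The maximum is over \<open>s \<le> t\<close> only, since \<open>t\<close> may be the
  last time considered. So just the left difference quotient is available, and the derivative of
  \<open>s * P z s\<close> is shown to be nonnegative instead of 0.\<close>

lemma temporal_max:
  fixes P :: "'e \<Rightarrow> real \<Rightarrow> real"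
  assumes P: "C 0 1 P" and zt: "z \<in> D" "t \<in> interior I" "t > 0"
    and max: "\<And>s. s \<in> I \<Longrightarrow> s \<le> t \<Longrightarrow> s * P z s \<le> t * P z t"
  shows "0 \<le> P z t / t + d_time I P z t"
proof -
  have d: "((\<lambda>s. s * P z s) has_real_derivative P z t + t * d_time I P z t) (at t)"
    using C_deriv_time[OF P zt(1,2)] by (auto intro!: derivative_eq_intros)
  have "0 \<le> P z t + t * d_time I P z t"
  proof (rule ccontr)
    assume "\<not> ?thesis"
    then obtain r where r: "r > 0" "\<And>h. h > 0 \<Longrightarrow> h < r \<Longrightarrow> t * P z t < (t - h) * P z (t - h)"
      using DERIV_neg_dec_left[OF d] by auto
    obtain e where e: "e > 0" "ball t e \<subseteq> I"
      using zt(2) mem_interior by blast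
    define h where "h = min (e / 2) (r / 2)"
    have h: "h > 0" "h < e" "h < r" using e(1) r(1) by (auto simp: h_def)
    then have "t - h \<in> I" using e(2) by (auto simp: dist_real_def)
    then show False using max[of "t - h"] r(2)[of h] h by simp
  qed
  then have "0 \<le> (P z t + t * d_time I P z t) / t" using zt(3) by simp
  then show ?thesis using zt(3) by (simp add: add_divide_distrib)
qed

end

text \<open>An instance of \<open>li_yau_data\<close>. The classes of \<open>a\<close> and
  \<open>f\<close> put \<open>P\<close> into the class of order (2, 1), as the derivative tests
  demand; the work lies in writing the derivatives of \<open>Q\<close>, \<open>P\<close> and the
  equation in coordinates.\<close>

lemma (in space_time) li_yau_at_maximum:
  fixes l K A :: real and f :: "'e \<Rightarrow> real \<Rightarrow> real"
  assumes l: "l > 0" and K: "K \<ge> 1" and A: "growth_const l (li_yau_error (real DIM('e)) K) A"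
    and a: "\<And>i j. i \<in> Basis \<Longrightarrow> j \<in> Basis \<Longrightarrow> C 2 1 (a i j)"
    and b: "\<And>i. i \<in> Basis \<Longrightarrow> C 1 1 (b i)"
    and c: "C 1 1 c" and f: "C 3 2 f"
    and sym: "\<And>i j y s. a i j y s = a j i y s"
    and pde: "\<And>y s. y \<in> D \<Longrightarrow> s \<in> I \<Longrightarrow> d_time I f y s =
        (\<Sum>i\<in>Basis. \<Sum>j\<in>Basis. a i j y s * d_space i (d_space j f) y s)
        + quad Basis (\<lambda>i j. a i j y s) (\<lambda>i. d_space i f y s)
        + (\<Sum>i\<in>Basis. b i y s * d_space i f y s) + c y s"
    and z: "z \<in> D" and t: "t \<in> interior I" "t > 0"
    and ell: "\<And>x. l * (\<Sum>i\<in>Basis. (x i)\<^sup>2) \<le> quad Basis (\<lambda>i j. a i j z t) x"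
    and bounds:
      "\<And>i j. i \<in> Basis \<Longrightarrow> j \<in> Basis \<Longrightarrow> \<bar>a i j z t\<bar> \<le> K"
      "\<And>k i j. k \<in> Basis \<Longrightarrow> i \<in> Basis \<Longrightarrow> j \<in> Basis \<Longrightarrow> \<bar>d_space k (a i j) z t\<bar> \<le> K"
      "\<And>k l i j. k \<in> Basis \<Longrightarrow> l \<in> Basis \<Longrightarrow> i \<in> Basis \<Longrightarrow> j \<in> Basis \<Longrightarrow>
        \<bar>d_space l (d_space k (a i j)) z t\<bar> \<le> K"
      "\<And>i j. i \<in> Basis \<Longrightarrow> j \<in> Basis \<Longrightarrow> \<bar>d_time I (a i j) z t\<bar> \<le> K"
      "\<And>i. i \<in> Basis \<Longrightarrow> \<bar>b i z t\<bar> \<le> K"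
      "\<And>k i. k \<in> Basis \<Longrightarrow> i \<in> Basis \<Longrightarrow> \<bar>d_space k (b i) z t\<bar> \<le> K"
      "\<And>i. i \<in> Basis \<Longrightarrow> \<bar>d_time I (b i) z t\<bar> \<le> K" "\<bar>c z t\<bar> \<le> K"
      "\<And>k. k \<in> Basis \<Longrightarrow> \<bar>d_space k c z t\<bar> \<le> K" "\<bar>d_time I c z t\<bar> \<le> K"
    and P_def: "\<And>y s. P y s = quad Basis (\<lambda>i j. a i j y s) (\<lambda>i. d_space i f y s) - 2 * d_time I f y s"
    and xmax: "\<And>y. y \<in> D \<Longrightarrow> P y t \<le> P z t"
    and tmax: "\<And>s. s \<in> I \<Longrightarrow> s \<le> t \<Longrightarrow> s * P z s \<le> t * P z t"
    and P0: "P z t > 0"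
  shows "P z t \<le> A * (1 / t + 1)"
proof -
  have tI: "t \<in> I" using t interior_subset by blast
  define p where "p i = d_space i f" for i
  define h where "h i j = d_space i (d_space j f)" for i j
  define ft where "ft = d_time I f"
  define Q where "Q = (\<lambda>y s. \<Sum>i\<in>Basis. \<Sum>j\<in>Basis. a i j y s * p i y s * p j y s)"
  note mono = C_class_mono
  have a': "C 1 0 (a i j)" "C 0 1 (a i j)" "C 2 1 (a i j)" if "i \<in> Basis" "j \<in> Basis" for i j
    using mono[OF a[OF that], of 1 0] mono[OF a[OF that], of 0 1] a[OF that] by simp_all
  have a1': "C 1 0 (d_space k (a i j))" if "k \<in> Basis" "i \<in> Basis" "j \<in> Basis" for k i j
    using mono[OF C_class_space[of 1 1 D I "a i j" k], of 1 0] a[of i j] that by (simp add: numeral_2_eq_2)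
  have b': "C 1 0 (b i)" "C 0 1 (b i)" if "i \<in> Basis" for i
    using mono[OF b[OF that], of 1 0] mono[OF b[OF that], of 0 1] by simp_all
  have c': "C 1 0 c" "C 0 1 c"
    using mono[OF c, of 1 0] mono[OF c, of 0 1] by simp_all
  have f2: "C 2 0 f" "C 1 1 f" using mono[OF f, of 2 0] mono[OF f, of 1 1] by simp_all
  have p22: "C 2 2 (p i)" if "i \<in> Basis" for i
    using C_class_space[of 2 2 D I f i] f that by (simp add: p_def eval_nat_numeral)
  have p': "C 1 0 (p i)" "C 0 1 (p i)" "C 2 1 (p i)" "C 2 0 (p i)" "C 1 1 (p i)" if "i \<in> Basis" for i
    using mono[OF p22[OF that], of 1 0] mono[OF p22[OF that], of 0 1] mono[OF p22[OF that], of 2 1]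
      mono[OF p22[OF that], of 2 0] mono[OF p22[OF that], of 1 1] by simp_all
  have h12: "C 1 2 (h i j)" if "i \<in> Basis" "j \<in> Basis" for i j
    using C_class_space[of 1 2 D I "p j" i] p22 that by (simp add: p_def h_def numeral_2_eq_2)
  have h': "C 1 0 (h i j)" "C 0 1 (h i j)" if "i \<in> Basis" "j \<in> Basis" for i j
    using mono[OF h12[OF that], of 1 0] mono[OF h12[OF that], of 0 1] by simp_all
  have ft31: "C 3 1 ft"
    using C_class_time[of 3 1 D I f] f by (simp add: ft_def numeral_2_eq_2)
  have ft': "C 1 0 ft" "C 0 1 ft" "C 2 0 ft" "C 2 1 ft"
    using mono[OF ft31, of 1 0] mono[OF ft31, of 0 1] mono[OF ft31, of 2 0] mono[OF ft31, of 2 1] by simp_all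
  have ft1': "C 1 0 (d_space k ft)" if "k \<in> Basis" for k
    using C_class_space[of 1 0 D I ft k] ft'(3) that by (simp add: numeral_2_eq_2)
  have Q21: "C 2 1 Q"
    unfolding Q_def by (intro C_sum C_mult a' p')
  have Q': "C 1 0 Q" "C 0 1 Q"
    using mono[OF Q21, of 1 0] mono[OF Q21, of 0 1] by simp_all
  have Q_quad: "Q y s = quad Basis (\<lambda>i j. a i j y s) (\<lambda>i. p i y s)" for y s
    by (simp add: Q_def quad_def)
  have P_eq: "P = (\<lambda>y s. Q y s + (- 2) * ft y s)"
    by (auto simp: fun_eq_iff P_def Q_quad p_def ft_def)
  have C_P: "C 2 1 P"
    unfolding P_eq by (intro C_add C_cmult Q21 ft')
  have C_P': "C 2 0 P" "C 0 1 P"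
    using mono[OF C_P, of 2 0] mono[OF C_P, of 0 1] by simp_all

  \<comment> \<open>Keeps the order 1 from becoming \<open>Suc 0\<close>, so that the facts on
    \<open>C 1 0\<close> and \<open>C 0 1\<close> still match.\<close>
  note [simp del] = One_nat_def
  \<comment> \<open>Symmetry of \<open>a\<close> merges two product-rule terms in each first
    derivative of \<open>Q\<close>; hence the factors 2 in \<open>li_yau_data\<close>.\<close>
  have swap: "(\<Sum>i\<in>Basis. \<Sum>j\<in>Basis. a i j y s * u i * v j) = (\<Sum>i\<in>Basis. \<Sum>j\<in>Basis. a i j y s * v i * u j)"
    for y s and u v :: "'e \<Rightarrow> real"
    by (subst sum.swap) (simp add: sym mult_ac)
  have dQ: "d_space k Q y s = (\<Sum>i\<in>Basis. \<Sum>j\<in>Basis. d_space k (a i j) y s * p i y s * p j y s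
      + 2 * (a i j y s * h k i y s * p j y s))" if "k \<in> Basis" "y \<in> D" "s \<in> I" for k y s
  proof -
    have "d_space k Q y s = (\<Sum>i\<in>Basis. \<Sum>j\<in>Basis. d_space k (\<lambda>y s. a i j y s * p i y s * p j y s) y s)"
      unfolding Q_def using that by (intro d_space_sum2 C_mult a' p')
    also have "\<dots> = (\<Sum>i\<in>Basis. \<Sum>j\<in>Basis. d_space k (a i j) y s * p i y s * p j y s
        + a i j y s * h k i y s * p j y s + a i j y s * p i y s * h k j y s)"
      using that by (intro sum.cong refl) (simp add: d_space_mult3 a' p' h_def p_def[symmetric])
    also have "\<dots> = (\<Sum>i\<in>Basis. \<Sum>j\<in>Basis. d_space k (a i j) y s * p i y s * p j y s)
        + (\<Sum>i\<in>Basis. \<Sum>j\<in>Basis. a i j y s * h k i y s * p j y s)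
        + (\<Sum>i\<in>Basis. \<Sum>j\<in>Basis. a i j y s * p i y s * h k j y s)"
      by (simp only: sum.distrib)
    also have "(\<Sum>i\<in>Basis. \<Sum>j\<in>Basis. a i j y s * p i y s * h k j y s)
        = (\<Sum>i\<in>Basis. \<Sum>j\<in>Basis. a i j y s * h k i y s * p j y s)"
      by (rule swap)
    finally show ?thesis
      by (simp add: sum.distrib sum_distrib_left)
  qed
  have ddQ: "d_space l (d_space k Q) z t = (\<Sum>i\<in>Basis. \<Sum>j\<in>Basis.
      d_space l (d_space k (a i j)) z t * p i z t * p j z t
      + d_space k (a i j) z t * (h l i z t * p j z t + p i z t * h l j z t)
      + 2 * (d_space l (a i j) z t * h k i z t * p j z t + a i j z t * d_space l (h k i) z t * p j z t
        + a i j z t * h k i z t * h l j z t))" if kl: "k \<in> Basis" "l \<in> Basis" for k l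
  proof -
    \<comment> \<open>The formula \<open>dQ\<close> holds on all of \<open>D\<close>, so its
      right-hand side may be differentiated in turn.\<close>
    have "d_space l (d_space k Q) z t = d_space l (\<lambda>y s. \<Sum>i\<in>Basis. \<Sum>j\<in>Basis.
        d_space k (a i j) y s * p i y s * p j y s + 2 * (a i j y s * h k i y s * p j y s)) z t"
      by (rule d_space_cong) (use dQ kl tI z in auto)
    also have "\<dots> = (\<Sum>i\<in>Basis. \<Sum>j\<in>Basis. d_space l (\<lambda>y s.
        d_space k (a i j) y s * p i y s * p j y s + 2 * (a i j y s * h k i y s * p j y s)) z t)"
      using kl z tI by (intro d_space_sum2 C_add C_mult C_cmult a' p' a1' h')
    also have "\<dots> = (\<Sum>i\<in>Basis. \<Sum>j\<in>Basis.
      d_space l (d_space k (a i j)) z t * p i z t * p j z t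
      + d_space k (a i j) z t * (h l i z t * p j z t + p i z t * h l j z t)
      + 2 * (d_space l (a i j) z t * h k i z t * p j z t + a i j z t * d_space l (h k i) z t * p j z t
        + a i j z t * h k i z t * h l j z t))"
    proof (intro sum.cong refl)
      fix i j :: 'e assume ij: "i \<in> Basis" "j \<in> Basis"
      have hp: "d_space l (p i) z t = h l i z t" for i by (simp add: h_def p_def)
      have "d_space l (\<lambda>y s. d_space k (a i j) y s * p i y s * p j y s + 2 * (a i j y s * h k i y s * p j y s)) z t
        = d_space l (\<lambda>y s. d_space k (a i j) y s * p i y s * p j y s) z t
          + 2 * d_space l (\<lambda>y s. a i j y s * h k i y s * p j y s) z t"
        using kl ij z tI by (subst d_space_add) (auto intro!: C_mult C_cmult a' p' a1' h' d_space_cmult)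
      also have "d_space l (\<lambda>y s. d_space k (a i j) y s * p i y s * p j y s) z t
        = d_space l (d_space k (a i j)) z t * p i z t * p j z t
          + d_space k (a i j) z t * h l i z t * p j z t + d_space k (a i j) z t * p i z t * h l j z t"
        using kl ij z tI by (simp add: d_space_mult3 a' p' a1' hp)
      also have "d_space l (\<lambda>y s. a i j y s * h k i y s * p j y s) z t
        = d_space l (a i j) z t * h k i z t * p j z t + a i j z t * d_space l (h k i) z t * p j z t
          + a i j z t * h k i z t * h l j z t"
        using kl ij z tI by (simp add: d_space_mult3 a' p' h' hp)
      finally show "d_space l (\<lambda>y s. d_space k (a i j) y s * p i y s * p j y s + 2 * (a i j y s * h k i y s * p j y s)) z t
        = d_space l (d_space k (a i j)) z t * p i z t * p j z t
          + d_space k (a i j) z t * (h l i z t * p j z t + p i z t * h l j z t)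
          + 2 * (d_space l (a i j) z t * h k i z t * p j z t + a i j z t * d_space l (h k i) z t * p j z t
            + a i j z t * h k i z t * h l j z t)"
        by (simp add: distrib_left mult.assoc)
    qed
    finally show ?thesis .
  qed
  have dP: "d_space k P y s = d_space k Q y s + (- 2) * d_space k ft y s"
    if "k \<in> Basis" "y \<in> D" "s \<in> I" for k y s
    unfolding P_eq d_space_add[OF Q'(1) C_cmult[OF ft'(1)] that] d_space_cmult[OF ft'(1) that] ..
  have ddP: "d_space l (d_space k P) z t = d_space l (d_space k Q) z t - 2 * d_space l (d_space k ft) z t"
    if kl: "k \<in> Basis" "l \<in> Basis" for k l
  proof -
    have Q1: "C 1 0 (d_space k Q)"
      using mono[OF C_class_space[of 1 1 D I Q k], of 1 0] Q21 kl by (simp add: numeral_2_eq_2 One_nat_def)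
    have "d_space l (d_space k P) z t = d_space l (\<lambda>y s. d_space k Q y s + (- 2) * d_space k ft y s) z t"
      by (rule d_space_cong) (use dP kl tI z in auto)
    also have "\<dots> = d_space l (d_space k Q) z t + (- 2) * d_space l (d_space k ft) z t"
      unfolding d_space_add[OF Q1 C_cmult[OF ft1'[OF kl(1)]] kl(2) z tI]
        d_space_cmult[OF ft1'[OF kl(1)] kl(2) z tI] ..
    finally show ?thesis by simp
  qed
  have tp: "d_time I (p k) z t = d_space k ft z t" if "k \<in> Basis" for k
    using d_time_space_commute[OF f2(2) that z t(1)] by (simp add: p_def ft_def)
  have dtQ: "d_time I Q z t = (\<Sum>i\<in>Basis. \<Sum>j\<in>Basis. d_time I (a i j) z t * p i z t * p j z t
      + 2 * a i j z t * d_space i ft z t * p j z t)"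
  proof -
    have "d_time I Q z t = (\<Sum>i\<in>Basis. \<Sum>j\<in>Basis. d_time I (\<lambda>y s. a i j y s * p i y s * p j y s) z t)"
      unfolding Q_def using z tI by (intro d_time_sum2 C_mult a' p')
    also have "\<dots> = (\<Sum>i\<in>Basis. \<Sum>j\<in>Basis. d_time I (a i j) z t * p i z t * p j z t
        + a i j z t * d_space i ft z t * p j z t + a i j z t * p i z t * d_space j ft z t)"
      using z tI by (intro sum.cong refl) (simp add: d_time_mult3 a' p' tp)
    also have "\<dots> = (\<Sum>i\<in>Basis. \<Sum>j\<in>Basis. d_time I (a i j) z t * p i z t * p j z t)
        + (\<Sum>i\<in>Basis. \<Sum>j\<in>Basis. a i j z t * d_space i ft z t * p j z t)
        + (\<Sum>i\<in>Basis. \<Sum>j\<in>Basis. a i j z t * p i z t * d_space j ft z t)"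
      by (simp only: sum.distrib)
    also have "(\<Sum>i\<in>Basis. \<Sum>j\<in>Basis. a i j z t * p i z t * d_space j ft z t)
        = (\<Sum>i\<in>Basis. \<Sum>j\<in>Basis. a i j z t * d_space i ft z t * p j z t)"
      by (rule swap)
    finally show ?thesis
      by (simp add: sum.distrib sum_distrib_left mult.assoc)
  qed
  have dtP: "d_time I P z t = d_time I Q z t - 2 * d_time I ft z t"
    unfolding P_eq d_time_add[OF Q'(2) C_cmult[OF ft'(2)] z tI] d_time_cmult[OF ft'(2) z tI] by simp
  \<comment> \<open>\<open>F\<close> is the right-hand side of the equation; differentiating
    \<open>ft = F\<close> gives \<open>ftt\<close> in time and \<open>third\<close> in
    space.\<close>
  define F where "F = (\<lambda>y s. (\<Sum>i\<in>Basis. \<Sum>j\<in>Basis. a i j y s * h i j y s) + Q y s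
        + (\<Sum>i\<in>Basis. b i y s * p i y s) + c y s)"
  have ftF: "ft y s = F y s" if "y \<in> D" "s \<in> I" for y s
    using pde[OF that] by (simp add: ft_def F_def Q_quad h_def p_def)
  \<comment> \<open>Two exchanges carry the time derivative past both space derivatives. The inner
    one is used on all of \<open>D\<close>, because a space derivative is still to be applied to
    it.\<close>
  have th: "d_time I (h k l) z t = d_space k (d_space l ft) z t" if "k \<in> Basis" "l \<in> Basis" for k l
  proof -
    have "d_time I (h k l) z t = d_space k (d_time I (p l)) z t"
      using d_time_space_commute[OF p'(5)[OF that(2)] that(1) z t(1)] by (simp add: h_def p_def)
    also have "\<dots> = d_space k (d_space l ft) z t"
      by (rule d_space_cong[OF _ z])
        (use d_time_space_commute[OF f2(2) that(2) _ t(1)] in \<open>simp add: p_def ft_def\<close>)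
    finally show ?thesis .
  qed
  have C1: "C 1 0 (\<lambda>y s. \<Sum>i\<in>Basis. \<Sum>j\<in>Basis. a i j y s * h i j y s)"
    "C 0 1 (\<lambda>y s. \<Sum>i\<in>Basis. \<Sum>j\<in>Basis. a i j y s * h i j y s)"
    by (intro C_sum C_mult a' h'; assumption)+
  have C2: "C 1 0 (\<lambda>y s. \<Sum>i\<in>Basis. b i y s * p i y s)" "C 0 1 (\<lambda>y s. \<Sum>i\<in>Basis. b i y s * p i y s)"
    by (intro C_sum C_mult b' p'; assumption)+
  have ftt: "d_time I ft z t = (\<Sum>k\<in>Basis. \<Sum>l\<in>Basis. a k l z t * d_space l (d_space k ft) z t)
      + (\<Sum>k\<in>Basis. \<Sum>l\<in>Basis. d_time I (a k l) z t * h k l z t) + d_time I Q z t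
      + (\<Sum>k\<in>Basis. d_time I (b k) z t * p k z t + b k z t * d_space k ft z t) + d_time I c z t"
  proof -
    have "d_time I ft z t = d_time I F z t"
      by (rule d_time_cong) (use ftF z tI in auto)
    also have "\<dots> = d_time I (\<lambda>y s. \<Sum>i\<in>Basis. \<Sum>j\<in>Basis. a i j y s * h i j y s) z t + d_time I Q z t
        + d_time I (\<lambda>y s. \<Sum>i\<in>Basis. b i y s * p i y s) z t + d_time I c z t"
      unfolding F_def using z tI by (simp add: d_time_add C_add C1 C2 Q' c')
    also have "d_time I (\<lambda>y s. \<Sum>i\<in>Basis. \<Sum>j\<in>Basis. a i j y s * h i j y s) z t
        = (\<Sum>k\<in>Basis. \<Sum>l\<in>Basis. d_time I (\<lambda>y s. a k l y s * h k l y s) z t)"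
      using z tI by (intro d_time_sum2 C_mult a' h')
    also have "\<dots> = (\<Sum>k\<in>Basis. \<Sum>l\<in>Basis. d_time I (a k l) z t * h k l z t + a k l z t * d_space l (d_space k ft) z t)"
      using z tI by (intro sum.cong refl) (simp add: d_time_mult a' h' th d_space_commute[OF ft'(3)])
    also have "d_time I (\<lambda>y s. \<Sum>i\<in>Basis. b i y s * p i y s) z t
        = (\<Sum>k\<in>Basis. d_time I (b k) z t * p k z t + b k z t * d_space k ft z t)"
      using z tI by (subst d_time_sum) (auto intro!: C_mult b' p' sum.cong simp: d_time_mult b' p' tp)
    finally show ?thesis by (simp add: sum.distrib)
  qed
  \<comment> \<open>Full symmetry of the third derivatives, arranged to give the index order of
    \<open>h3 l k i\<close>.\<close>
  have dh: "d_space i (h k l) z t = d_space l (h k i) z t"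
    if "i \<in> Basis" "k \<in> Basis" "l \<in> Basis" for i k l
  proof -
    have "d_space i (h k l) z t = d_space k (d_space i (p l)) z t"
      using d_space_commute[OF p'(4)[OF that(3)] that(1,2) z tI] by (simp add: h_def p_def)
    also have "\<dots> = d_space k (d_space l (p i)) z t"
      by (rule d_space_cong[OF _ z])
        (use d_space_commute[OF f2(1) that(1,3) _ tI] in \<open>simp add: p_def\<close>)
    also have "\<dots> = d_space l (h k i) z t"
      using d_space_commute[OF p'(4)[OF that(1)] that(2,3) z tI] by (simp add: h_def p_def)
    finally show ?thesis .
  qed
  have third: "(\<Sum>k\<in>Basis. \<Sum>l\<in>Basis. a k l z t * d_space l (h k i) z t)
      = d_space i ft z t - d_space i Q z t - (\<Sum>k\<in>Basis. d_space i (b k) z t * p k z t + b k z t * h i k z t)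
        - d_space i c z t - (\<Sum>k\<in>Basis. \<Sum>l\<in>Basis. d_space i (a k l) z t * h k l z t)"
    if i: "i \<in> Basis" for i
  proof -
    have "d_space i ft z t = d_space i F z t"
      by (rule d_space_cong) (use ftF z tI in auto)
    also have "\<dots> = d_space i (\<lambda>y s. \<Sum>i\<in>Basis. \<Sum>j\<in>Basis. a i j y s * h i j y s) z t + d_space i Q z t
        + d_space i (\<lambda>y s. \<Sum>i\<in>Basis. b i y s * p i y s) z t + d_space i c z t"
      unfolding F_def using z tI i by (simp add: d_space_add C_add C1 C2 Q' c')
    also have "d_space i (\<lambda>y s. \<Sum>i\<in>Basis. \<Sum>j\<in>Basis. a i j y s * h i j y s) z t
        = (\<Sum>k\<in>Basis. \<Sum>l\<in>Basis. d_space i (\<lambda>y s. a k l y s * h k l y s) z t)"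
      using z tI i by (intro d_space_sum2 C_mult a' h')
    also have "\<dots> = (\<Sum>k\<in>Basis. \<Sum>l\<in>Basis. d_space i (a k l) z t * h k l z t + a k l z t * d_space l (h k i) z t)"
      using z tI i by (intro sum.cong refl) (simp add: d_space_mult a' h' dh)
    also have "d_space i (\<lambda>y s. \<Sum>i\<in>Basis. b i y s * p i y s) z t
        = (\<Sum>k\<in>Basis. d_space i (b k) z t * p k z t + b k z t * h i k z t)"
      using z tI i by (subst d_space_sum)
        (auto intro!: C_mult b' p' sum.cong simp: d_space_mult b' p' h_def p_def[symmetric])
    finally show ?thesis by (simp add: sum.distrib)
  qed
  have crit: "d_space k Q z t = 2 * d_space k ft z t" if "k \<in> Basis" for k
    using spatial_max(1)[OF C_P'(1) z tI xmax that] dP[OF that z tI] by simp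
  have hess: "(\<Sum>k\<in>Basis. \<Sum>l\<in>Basis. a k l z t * d_space l (d_space k P) z t) \<le> 0"
  proof -
    \<comment> \<open>The matrix \<open>a\<close> is positive definite and the Hessian of
      \<open>P\<close> is negative semidefinite, so their trace product has a sign.\<close>
    have "0 \<le> (\<Sum>k\<in>Basis. \<Sum>l\<in>Basis. a k l z t * (- d_space l (d_space k P) z t))"
    proof (rule trace_product_nonneg[OF finite_Basis sym])
      show "0 < quad Basis (\<lambda>i j. a i j z t) x" if "\<exists>i\<in>Basis. x i \<noteq> 0" for x
        by (rule quad_lower_pos[OF finite_Basis ell l that])
      show "0 \<le> quad Basis (\<lambda>k l. - d_space l (d_space k P) z t) x" for x
        using spatial_max(2)[OF C_P'(1) z tI xmax, of x] by (simp add: quad_def sum_negf)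
    qed
    then show ?thesis by (simp add: sum_negf)
  qed
  have "li_yau_data l K Basis (\<lambda>i j. a i j z t) (\<lambda>k i j. d_space k (a i j) z t)
      (\<lambda>k l i j. d_space l (d_space k (a i j)) z t) (\<lambda>i j. d_time I (a i j) z t)
      (\<lambda>i. b i z t) (\<lambda>k i. d_space k (b i) z t) (\<lambda>i. d_time I (b i) z t)
      (c z t) (\<lambda>k. d_space k c z t) (d_time I c z t) (\<lambda>k. d_space k Q z t)
      (\<lambda>i. p i z t) (\<lambda>i j. h i j z t) (\<lambda>l k i. d_space l (h k i) z t)
      (\<lambda>k. d_space k ft z t) (d_time I Q z t) (d_time I ft z t) (\<lambda>k l. d_space l (d_space k ft) z t)
      (\<lambda>k l. d_space l (d_space k P) z t) (d_time I P z t) (ft z t) (P z t) t"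
  proof unfold_locales
    show "0 \<le> P z t / t + d_time I P z t"
      by (rule temporal_max[OF C_P'(2) z t tmax])
    show "ft z t = (\<Sum>k\<in>Basis. \<Sum>l\<in>Basis. a k l z t * h k l z t) + quad Basis (\<lambda>i j. a i j z t) (\<lambda>i. p i z t)
        + (\<Sum>k\<in>Basis. b k z t * p k z t) + c z t"
      using ftF[OF z tI] by (simp add: F_def Q_quad)
    show "P z t = quad Basis (\<lambda>i j. a i j z t) (\<lambda>i. p i z t) - 2 * ft z t"
      by (simp add: P_def p_def ft_def)
    show "d_space k Q z t = (\<Sum>i\<in>Basis. \<Sum>j\<in>Basis. d_space k (a i j) z t * p i z t * p j z t
        + 2 * a i j z t * h k i z t * p j z t)" if "k \<in> Basis" for k
      using dQ[OF that z tI] by (simp add: mult.assoc)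
  qed (use l K sym ell bounds third crit dtQ ftt ddP ddQ dtP P0 t hess in auto)
  then show ?thesis by (rule li_yau_data.estimate[OF _ A])
qed

section \<open>The real form of the equation and changes of charts\<close>

lemma sum_Basis_complex_vec:
  fixes F :: "complex ^ 'n::finite \<Rightarrow> 'b::comm_monoid_add"
  shows "(\<Sum>b\<in>Basis. F b) = (\<Sum>i\<in>UNIV. F (axis i 1) + F (axis i \<i>))"
proof -
  have B: "(Basis :: (complex ^ 'n) set) = (\<Union>i\<in>UNIV. {axis i 1, axis i \<i>})"
    by (auto simp: Basis_vec_def Basis_complex_def)
  have "(\<Sum>b\<in>Basis. F b) = (\<Sum>i\<in>UNIV. \<Sum>b\<in>{axis i 1, axis i \<i>}. F b)"
    unfolding B by (rule sum.UNION_disjoint) (auto simp: axis_eq_axis)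
  then show ?thesis
    by (simp add: axis_eq_axis)
qed

text \<open>With \<open>z\<^sup>i = x\<^sup>i + \<i> y\<^sup>i\<close>, the operator \<open>G\<^sup>i\<^sup>j \<partial>\<^sub>i \<partial>\<close>-bar\<open>\<^sub>j\<close> is \<open>\<Sum>\<^sub>v\<^sub>w G\<^sup>i\<^sup>j cnj v\<^sub>i w\<^sub>j \<partial>\<^sub>v \<partial>\<^sub>w / 4\<close>
  over the real basis vectors \<open>v, w\<close>; this is its real part, made symmetric in \<open>v, w\<close>.\<close>

definition real_coef :: "complex ^ 'n ^ 'n \<Rightarrow> complex ^ 'n \<Rightarrow> complex ^ 'n::finite \<Rightarrow> real" where
  "real_coef G v w = Re (\<Sum>i\<in>UNIV. \<Sum>j\<in>UNIV. G $ i $ j * (cnj (v $ i) * w $ j + cnj (w $ i) * v $ j)) / 8"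

text \<open>The real part of the first-order operator with (1,0) part \<open>X\<close> and (0,1)
  part \<open>Y\<close>, along the real basis vector \<open>v\<close>. The conjugate on the
  \<open>X\<close> side reflects
  \<open>\<partial>_k = (\<partial>_x - \<i> \<partial>_y) / 2\<close>.\<close>

definition real_drift :: "complex ^ 'n \<Rightarrow> complex ^ 'n \<Rightarrow> complex ^ 'n::finite \<Rightarrow> real" where
  "real_drift X Y v = Re (\<Sum>k\<in>UNIV. X $ k * cnj (v $ k) + Y $ k * v $ k) / 2"

text \<open>The covector of derivatives \<open>\<partial>_i\<close> of a function whose real partial
  derivatives are \<open>p\<close>.\<close>

definition complex_gradient :: "(complex ^ 'n \<Rightarrow> real) \<Rightarrow> complex ^ 'n::finite" where
  "complex_gradient p = (\<chi> i. (of_real (p (axis i 1)) - \<i> * of_real (p (axis i \<i>))) / 2)"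

lemma real_coef_sym: "real_coef G v w = real_coef G w v"
  by (simp add: real_coef_def add.commute)

lemma bounded_linear_real_coef: "bounded_linear (\<lambda>G. real_coef G v w)"
proof -
  have "linear (\<lambda>G. real_coef G v w)"
    by (intro linearI) (simp_all add: real_coef_def sum.distrib distrib_right scaleR_conv_of_real[symmetric]
      sum_distrib_left add_divide_distrib scaleR_sum_right[symmetric])
  then show ?thesis by (simp add: linear_conv_bounded_linear)
qed

lemma linear_real_drift:
  "bounded_linear (\<lambda>X. real_drift X 0 v)" "bounded_linear (\<lambda>Y. real_drift 0 Y v)"
  "real_drift X Y v = real_drift X 0 v + real_drift 0 Y v"
proof -
  have "linear (\<lambda>X. real_drift X 0 v)" "linear (\<lambda>Y. real_drift 0 Y v)"
    by (intro linearI; simp add: real_drift_def sum.distrib distrib_right scaleR_conv_of_real[symmetric]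
      sum_distrib_left add_divide_distrib scaleR_sum_right[symmetric])+
  then show "bounded_linear (\<lambda>X. real_drift X 0 v)" "bounded_linear (\<lambda>Y. real_drift 0 Y v)"
    by (simp_all add: linear_conv_bounded_linear)
  show "real_drift X Y v = real_drift X 0 v + real_drift 0 Y v"
    by (simp add: real_drift_def sum.distrib add_divide_distrib)
qed

lemma abs_real_coef_le:
  fixes G :: "complex ^ 'n::finite ^ 'n"
  assumes "v \<in> Basis" "w \<in> Basis"
  shows "\<bar>real_coef G v w\<bar> \<le> (real CARD('n))\<^sup>2 * norm G"
proof -
  have v: "norm (v $ i) \<le> 1" "norm (w $ i) \<le> 1" for i
    using assms by (simp_all add: Finite_Cartesian_Product.norm_nth_le[THEN order_trans])
  have G: "norm (G $ i $ j) \<le> norm G" for i j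
    by (rule order_trans[OF Finite_Cartesian_Product.norm_nth_le Finite_Cartesian_Product.norm_nth_le])
  have "norm (G $ i $ j * (cnj (v $ i) * w $ j + cnj (w $ i) * v $ j)) \<le> norm G * (1 * 1 + 1 * 1)" for i j
    unfolding norm_mult
    by (intro mult_mono G order_trans[OF norm_triangle_ineq] add_mono)
      (auto simp: norm_mult intro!: mult_le_one v)
  then have "norm (\<Sum>i\<in>UNIV. \<Sum>j\<in>UNIV. G $ i $ j * (cnj (v $ i) * w $ j + cnj (w $ i) * v $ j))
      \<le> of_nat CARD('n) * (of_nat CARD('n) * (norm G * (1 * 1 + 1 * 1)))"
    by (intro sum_norm_bound)
  then have "\<bar>Re (\<Sum>i\<in>UNIV. \<Sum>j\<in>UNIV. G $ i $ j * (cnj (v $ i) * w $ j + cnj (w $ i) * v $ j))\<bar>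
      \<le> 2 * ((real CARD('n))\<^sup>2 * norm G)"
    by (intro order_trans[OF abs_Re_le_cmod]) (simp add: power2_eq_square mult_ac)
  moreover have "0 \<le> (real CARD('n))\<^sup>2 * norm G" by simp
  ultimately show ?thesis
    unfolding real_coef_def by simp
qed

lemma abs_real_drift_le:
  fixes X Y :: "complex ^ 'n::finite"
  assumes "v \<in> Basis"
  shows "\<bar>real_drift X Y v\<bar> \<le> (real CARD('n))\<^sup>2 * (norm X + norm Y)"
proof -
  have v: "norm (v $ i) \<le> 1" for i
    using assms by (simp add: Finite_Cartesian_Product.norm_nth_le[THEN order_trans])
  have "norm (X $ k * cnj (v $ k) + Y $ k * v $ k) \<le> norm X * 1 + norm Y * 1" for k
    by (intro order_trans[OF norm_triangle_ineq] add_mono)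
      (auto simp: norm_mult simp del: mult_1_right intro!: mult_mono v Finite_Cartesian_Product.norm_nth_le)
  then have "norm (\<Sum>k\<in>UNIV. X $ k * cnj (v $ k) + Y $ k * v $ k) \<le> of_nat CARD('n) * (norm X * 1 + norm Y * 1)"
    by (intro sum_norm_bound)
  then have "\<bar>Re (\<Sum>k\<in>UNIV. X $ k * cnj (v $ k) + Y $ k * v $ k)\<bar> \<le> real CARD('n) * (norm X + norm Y)"
    by (intro order_trans[OF abs_Re_le_cmod]) simp
  also have "\<dots> \<le> (real CARD('n))\<^sup>2 * (norm X + norm Y)"
  proof (rule mult_right_mono)
    have "1 \<le> real CARD('n)" by (simp add: Suc_leI)
    then show "real CARD('n) \<le> (real CARD('n))\<^sup>2" by (simp add: power2_eq_square)
  qed simp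
  finally show ?thesis
    unfolding real_drift_def by simp
qed

text \<open>Against a symmetric \<open>H\<close> the two halves of the symmetrised coefficient give
  the same sum, the contraction of \<open>G\<close> with the mixed complex derivatives formed from
  \<open>H\<close>. This serves for the Hessian of \<open>u\<close> and, with
  \<open>H v w = p v * p w\<close>, for the gradient form.\<close>

lemma real_coef_sum:
  fixes G :: "complex ^ 'n::finite ^ 'n"
  assumes sym: "\<And>v w. v \<in> Basis \<Longrightarrow> w \<in> Basis \<Longrightarrow> H v w = H w v"
  shows "(\<Sum>v\<in>Basis. \<Sum>w\<in>Basis. real_coef G v w * H v w) = Re (\<Sum>i\<in>UNIV. \<Sum>j\<in>UNIV. G $ i $ j *
    ((of_real (H (axis i 1) (axis j 1)) + \<i> * of_real (H (axis i 1) (axis j \<i>)))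
     - \<i> * (of_real (H (axis i \<i>) (axis j 1)) + \<i> * of_real (H (axis i \<i>) (axis j \<i>)))) / 4)"
proof -
  define E where "E i j = (of_real (H (axis i 1) (axis j 1)) + \<i> * of_real (H (axis i 1) (axis j \<i>)))
     - \<i> * (of_real (H (axis i \<i>) (axis j 1)) + \<i> * of_real (H (axis i \<i>) (axis j \<i>)))" for i j
  have *: "(\<Sum>v\<in>Basis. \<Sum>w\<in>Basis. (\<Sum>i\<in>UNIV. \<Sum>j\<in>UNIV. G $ i $ j * (cnj (v $ i) * w $ j)) * of_real (H v w))
      = (\<Sum>i\<in>UNIV. \<Sum>j\<in>UNIV. G $ i $ j * E i j)"
  proof -
    have "(\<Sum>v\<in>Basis. \<Sum>w\<in>Basis. (\<Sum>i\<in>UNIV. \<Sum>j\<in>UNIV. G $ i $ j * (cnj (v $ i) * w $ j)) * of_real (H v w))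
      = (\<Sum>v\<in>Basis. \<Sum>w\<in>Basis. \<Sum>i\<in>UNIV. \<Sum>j\<in>UNIV. G $ i $ j * (cnj (v $ i) * (w $ j * of_real (H v w))))"
      by (simp add: sum_distrib_right mult.assoc)
    also have "\<dots> = (\<Sum>v\<in>Basis. \<Sum>i\<in>UNIV. \<Sum>w\<in>Basis. \<Sum>j\<in>UNIV. G $ i $ j * (cnj (v $ i) * (w $ j * of_real (H v w))))"
      by (intro sum.cong refl sum.swap)
    also have "\<dots> = (\<Sum>i\<in>UNIV. \<Sum>v\<in>Basis. \<Sum>w\<in>Basis. \<Sum>j\<in>UNIV. G $ i $ j * (cnj (v $ i) * (w $ j * of_real (H v w))))"
      by (rule sum.swap)
    also have "\<dots> = (\<Sum>i\<in>UNIV. \<Sum>v\<in>Basis. \<Sum>j\<in>UNIV. \<Sum>w\<in>Basis. G $ i $ j * (cnj (v $ i) * (w $ j * of_real (H v w))))"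
      by (intro sum.cong refl sum.swap)
    also have "\<dots> = (\<Sum>i\<in>UNIV. \<Sum>j\<in>UNIV. \<Sum>v\<in>Basis. \<Sum>w\<in>Basis. G $ i $ j * (cnj (v $ i) * (w $ j * of_real (H v w))))"
      by (intro sum.cong refl sum.swap)
    also have "\<dots> = (\<Sum>i\<in>UNIV. \<Sum>j\<in>UNIV. G $ i $ j * (\<Sum>v\<in>Basis. cnj (v $ i) * (\<Sum>w\<in>Basis. w $ j * of_real (H v w))))"
      by (simp add: sum_distrib_left)
    also have "\<dots> = (\<Sum>i\<in>UNIV. \<Sum>j\<in>UNIV. G $ i $ j * E i j)"
    proof (intro sum.cong refl arg_cong2[where f = "(*)"])
      fix i j :: 'n
      have ax: "axis k x $ j * y = (if k = j then x * y else 0)" for k j :: 'n and x y :: complex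
        by (simp add: axis_def)
      have cax: "cnj (axis k x $ j) * y = (if k = j then cnj x * y else 0)" for k j :: 'n and x y :: complex
        by (simp add: axis_def)
      show "(\<Sum>v\<in>Basis. cnj (v $ i) * (\<Sum>w\<in>Basis. w $ j * of_real (H v w))) = E i j"
        unfolding sum_Basis_complex_vec ax cax by (simp add: E_def sum.distrib)
    qed
    finally show ?thesis .
  qed
  \<comment> \<open>The second half is the first one with \<open>v\<close> and \<open>w\<close>
    exchanged.\<close>
  have "(\<Sum>v\<in>Basis. \<Sum>w\<in>Basis. (\<Sum>i\<in>UNIV. \<Sum>j\<in>UNIV. G $ i $ j * (cnj (w $ i) * v $ j)) * of_real (H v w))
    = (\<Sum>v\<in>Basis. \<Sum>w\<in>Basis. (\<Sum>i\<in>UNIV. \<Sum>j\<in>UNIV. G $ i $ j * (cnj (w $ i) * v $ j)) * complex_of_real (H w v))"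
    using sym by simp
  also have "\<dots> = (\<Sum>i\<in>UNIV. \<Sum>j\<in>UNIV. G $ i $ j * E i j)"
    by (subst sum.swap) (rule *)
  finally have **: "(\<Sum>v\<in>Basis. \<Sum>w\<in>Basis. (\<Sum>i\<in>UNIV. \<Sum>j\<in>UNIV. G $ i $ j * (cnj (w $ i) * v $ j)) * of_real (H v w))
    = (\<Sum>i\<in>UNIV. \<Sum>j\<in>UNIV. G $ i $ j * E i j)" .
  have "(\<Sum>v\<in>Basis. \<Sum>w\<in>Basis. real_coef G v w * H v w)
    = Re (\<Sum>v\<in>Basis. \<Sum>w\<in>Basis. (\<Sum>i\<in>UNIV. \<Sum>j\<in>UNIV. G $ i $ j * (cnj (v $ i) * w $ j)) * of_real (H v w)
      + (\<Sum>i\<in>UNIV. \<Sum>j\<in>UNIV. G $ i $ j * (cnj (w $ i) * v $ j)) * of_real (H v w)) / 8"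
    unfolding Re_sum sum_divide_distrib
    by (intro sum.cong refl) (simp add: real_coef_def distrib_left sum.distrib distrib_right[symmetric]
        add_divide_distrib left_diff_distrib)
  also have "\<dots> = Re ((\<Sum>i\<in>UNIV. \<Sum>j\<in>UNIV. G $ i $ j * E i j) + (\<Sum>i\<in>UNIV. \<Sum>j\<in>UNIV. G $ i $ j * E i j)) / 8"
    unfolding sum.distrib * ** ..
  also have "\<dots> = Re ((\<Sum>i\<in>UNIV. \<Sum>j\<in>UNIV. G $ i $ j * E i j) / 4)"
    by simp
  also have "\<dots> = Re (\<Sum>i\<in>UNIV. \<Sum>j\<in>UNIV. G $ i $ j * E i j / 4)"
    by (simp only: sum_divide_distrib)
  finally show ?thesis unfolding E_def .
qed

lemma quad_real_coef:
  "quad Basis (real_coef G) p = Re (covector_form G (complex_gradient p))"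
proof -
  have "quad Basis (real_coef G) p = (\<Sum>v\<in>Basis. \<Sum>w\<in>Basis. real_coef G v w * (p v * p w))"
    by (simp add: quad_def mult.assoc)
  also have "\<dots> = Re (covector_form G (complex_gradient p))"
    unfolding covector_form_def
    by (subst real_coef_sum)
      (auto simp: mult.commute complex_gradient_def algebra_simps add_divide_distrib diff_divide_distrib intro!: arg_cong[where f = Re] sum.cong)
  finally show ?thesis .
qed

lemma real_drift_sum:
  "(\<Sum>v\<in>Basis. real_drift X Y v * p v) = Re (\<Sum>k\<in>UNIV.
     X $ k * ((of_real (p (axis k 1)) - \<i> * of_real (p (axis k \<i>))) / 2)
     + Y $ k * ((of_real (p (axis k 1)) + \<i> * of_real (p (axis k \<i>))) / 2))"
proof -
  have ax: "y * axis k x $ j = (if j = k then y * x else 0)" for k j :: 'a and x y :: complex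
    by (simp add: axis_def)
  have cax: "y * cnj (axis k x $ j) = (if j = k then y * cnj x else 0)" for k j :: 'a and x y :: complex
    by (simp add: axis_def)
  show ?thesis
    unfolding real_drift_def sum_Basis_complex_vec ax cax sum.distrib
    by (simp add: sum.distrib[symmetric] field_simps)
qed

section \<open>Passage to the logarithm and to real coefficients\<close>

lemma (in space_time) d_space_ln:
  fixes U :: "'e \<Rightarrow> real \<Rightarrow> real"
  assumes "C 1 0 U" "\<And>y s. y \<in> D \<Longrightarrow> s \<in> I \<Longrightarrow> U y s > 0" "b \<in> Basis" "z \<in> D" "t \<in> I"
  shows "d_space b (\<lambda>y s. ln (U y s)) z t = inverse (U z t) * d_space b U z t"
proof (rule d_space_eqI)
  have "((\<lambda>s. U (z + s *\<^sub>R b) t) has_real_derivative d_space b U z t) (at 0)"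
    using C_deriv_line[OF assms(1,3), of z 0 t] assms by simp
  from DERIV_chain2[OF DERIV_ln this]
  show "((\<lambda>s. ln (U (z + s *\<^sub>R b) t)) has_vector_derivative inverse (U z t) * d_space b U z t) (at 0)"
    using assms by (simp add: has_real_derivative_iff_has_vector_derivative)
qed

lemma (in space_time) d_time_ln:
  fixes U :: "'e \<Rightarrow> real \<Rightarrow> real"
  assumes "C 0 1 U" "\<And>y s. y \<in> D \<Longrightarrow> s \<in> I \<Longrightarrow> U y s > 0" "z \<in> D" "t \<in> I"
  shows "d_time I (\<lambda>y s. ln (U y s)) z t = inverse (U z t) * d_time I U z t"
proof (rule d_time_eqI)
  have "(U z has_real_derivative d_time I U z t) (at t within I)"
    using C_class_has_deriv_time[of 0 0 D I U z t] assms
    by (simp add: has_real_derivative_iff_has_vector_derivative)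
  from DERIV_chain2[OF DERIV_ln this]
  show "((\<lambda>s. ln (U z s)) has_vector_derivative inverse (U z t) * d_time I U z t) (at t within I)"
    using assms by (simp add: has_real_derivative_iff_has_vector_derivative)
qed (use assms in auto)

lemma (in space_time) d_space_space_ln:
  fixes U :: "'e \<Rightarrow> real \<Rightarrow> real"
  assumes U: "C 2 0 U" and pos: "\<And>y s. y \<in> D \<Longrightarrow> s \<in> I \<Longrightarrow> U y s > 0"
    and b: "b \<in> Basis" "b' \<in> Basis" and zt: "z \<in> D" "t \<in> I"
  defines "f \<equiv> \<lambda>y s. ln (U y s)"
  shows "d_space b (d_space b' f) z t
    = inverse (U z t) * d_space b (d_space b' U) z t - d_space b f z t * d_space b' f z t"
proof -
  have U1: "C 1 0 U" using C_class_mono[OF U, of 1 0] by simp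
  have U2: "C 1 0 (d_space b' U)"
    using C_class_space[of 1 0 D I U b'] U b by (simp add: numeral_2_eq_2)
  have inv: "C 1 0 (\<lambda>y s. inverse (U y s))"
    by (rule C_inverse[OF U1]) (use pos in force)
  have dinv: "d_space b (\<lambda>y s. inverse (U y s)) z t = - (inverse (U z t) * d_space b U z t * inverse (U z t))"
  proof (rule d_space_eqI)
    have "((\<lambda>s. U (z + s *\<^sub>R b) t) has_real_derivative d_space b U z t) (at 0)"
      using C_deriv_line[OF U1 b(1), of z 0 t] zt by simp
    from DERIV_inverse'[OF this]
    show "((\<lambda>s. inverse (U (z + s *\<^sub>R b) t)) has_vector_derivative
        - (inverse (U z t) * d_space b U z t * inverse (U z t))) (at 0)"
      using pos[OF zt] by (simp add: has_real_derivative_iff_has_vector_derivative)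
  qed
  have dln: "d_space c (\<lambda>y s. ln (U y s)) z t = inverse (U z t) * d_space c U z t" if "c \<in> Basis" for c
    using d_space_ln[OF U1 _ that zt] pos by blast
  have "d_space b (d_space b' f) z t = d_space b (\<lambda>y s. inverse (U y s) * d_space b' U y s) z t"
    by (rule d_space_cong[OF _ zt(1)]) (use d_space_ln[OF U1 pos b(2) _ zt(2)] f_def in auto)
  also have "\<dots> = inverse (U z t) * d_space b (d_space b' U) z t - d_space b f z t * d_space b' f z t"
    unfolding d_space_mult[OF inv U2 b(1) zt] dinv f_def dln[OF b(1)] dln[OF b(2)] by simp
  finally show ?thesis .
qed

text \<open>The equation is divided by \<open>U\<close>. Since
  \<open>U_ij / U = f_ij + f_i f_j\<close>, the second-order part splits into that of
  \<open>f\<close> and products of first derivatives, which make up the quadratic form.\<close>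

lemma (in space_time) parabolic_eq_ln:
  fixes U :: "'e \<Rightarrow> real \<Rightarrow> real"
  assumes U: "C 2 1 U" and pos: "\<And>y s. y \<in> D \<Longrightarrow> s \<in> I \<Longrightarrow> U y s > 0" and zt: "z \<in> D" "t \<in> I"
    and eq: "d_time I U z t = (\<Sum>i\<in>Basis. \<Sum>j\<in>Basis. a i j * d_space i (d_space j U) z t)
      + (\<Sum>i\<in>Basis. b i * d_space i U z t) + c * U z t"
  defines "f \<equiv> \<lambda>y s. ln (U y s)"
  shows "d_time I f z t = (\<Sum>i\<in>Basis. \<Sum>j\<in>Basis. a i j * d_space i (d_space j f) z t)
      + quad Basis a (\<lambda>i. d_space i f z t) + (\<Sum>i\<in>Basis. b i * d_space i f z t) + c"
proof -
  have U': "C 1 0 U" "C 0 1 U" "C 2 0 U"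
    using C_class_mono[OF U, of 1 0] C_class_mono[OF U, of 0 1] C_class_mono[OF U, of 2 0] by simp_all
  have U0: "U z t \<noteq> 0" using pos[OF zt] by simp
  have "d_time I f z t = inverse (U z t) * d_time I U z t"
    unfolding f_def by (rule d_time_ln[OF U'(2) pos zt])
  also have "\<dots> = (\<Sum>i\<in>Basis. \<Sum>j\<in>Basis. a i j * (inverse (U z t) * d_space i (d_space j U) z t))
      + (\<Sum>i\<in>Basis. b i * (inverse (U z t) * d_space i U z t)) + c"
    unfolding eq distrib_left sum_distrib_left using U0 by (simp add: mult_ac)
  also have "(\<Sum>i\<in>Basis. b i * (inverse (U z t) * d_space i U z t)) = (\<Sum>i\<in>Basis. b i * d_space i f z t)"
    using d_space_ln[OF U'(1) pos _ zt] by (simp add: f_def)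
  also have "(\<Sum>i\<in>Basis. \<Sum>j\<in>Basis. a i j * (inverse (U z t) * d_space i (d_space j U) z t))
      = (\<Sum>i\<in>Basis. \<Sum>j\<in>Basis. a i j * d_space i (d_space j f) z t + a i j * d_space i f z t * d_space j f z t)"
  proof (intro sum.cong refl)
    fix i j :: 'e assume "i \<in> Basis" "j \<in> Basis"
    then have "inverse (U z t) * d_space i (d_space j U) z t
        = d_space i (d_space j f) z t + d_space i f z t * d_space j f z t"
      using d_space_space_ln[OF U'(3) pos _ _ zt, of i j] by (simp add: f_def)
    then show "a i j * (inverse (U z t) * d_space i (d_space j U) z t)
        = a i j * d_space i (d_space j f) z t + a i j * d_space i f z t * d_space j f z t"
      by (simp only: distrib_left mult.assoc)
  qed
  also have "\<dots> = (\<Sum>i\<in>Basis. \<Sum>j\<in>Basis. a i j * d_space i (d_space j f) z t)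
      + quad Basis a (\<lambda>i. d_space i f z t)"
    by (simp only: quad_def sum.distrib)
  finally show ?thesis .
qed

lemma axis_complex_in_Basis [simp]: "axis i 1 \<in> (Basis :: (complex ^ 'n::finite) set)"
  "axis i \<i> \<in> (Basis :: (complex ^ 'n) set)"
  by (auto simp: Basis_vec_def Basis_complex_def)

text \<open>\<open>r\<close> and \<open>U\<close> are real, so taking real parts of the complex
  equation leaves an equation with the real coefficients \<open>real_coef\<close>,
  \<open>real_drift\<close> and \<open>Re c\<close>.\<close>

lemma real_parabolic_eq:
  fixes D :: "(complex ^ 'n::finite) set" and U :: "complex ^ 'n \<Rightarrow> real \<Rightarrow> real"
  assumes st: "space_time D I" and U: "C_class 2 0 D I U" and zt: "z \<in> D" "t \<in> I"
    and eq: "complex_of_real r = (\<Sum>i\<in>UNIV. \<Sum>j\<in>UNIV. G $ i $ j * dz i (dzbar j (\<lambda>z. complex_of_real (U z t))) z)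
           + (\<Sum>k\<in>UNIV. X $ k * dz k (\<lambda>z. complex_of_real (U z t)) z)
           + (\<Sum>k\<in>UNIV. Y $ k * dzbar k (\<lambda>z. complex_of_real (U z t)) z)
           + c * complex_of_real (U z t)"
  shows "r = (\<Sum>v\<in>Basis. \<Sum>w\<in>Basis. real_coef G v w * d_space v (d_space w U) z t)
    + (\<Sum>v\<in>Basis. real_drift X Y v * d_space v U z t) + Re c * U z t"
proof -
  interpret space_time D I by (rule st)
  have U1: "C 1 0 U" using C_class_mono[OF U, of 1 0] by simp
  have U2: "C 1 0 (d_space b U)" if "b \<in> Basis" for b
    using C_class_space[of 1 0 D I U b] U that by (simp add: numeral_2_eq_2)
  have der: "((\<lambda>s. complex_of_real (V (y + s *\<^sub>R b) t)) has_vector_derivative of_real (d_space b V y t)) (at 0)"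
    if "C 1 0 V" "b \<in> Basis" "y \<in> D" for V :: "complex ^ 'n \<Rightarrow> real \<Rightarrow> real" and b y
    using C_deriv_line[OF that(1,2), of y 0 t] that(3) zt(2)
    by (intro has_vector_derivative_of_real) (simp add: has_real_derivative_iff_has_vector_derivative)
  have dir: "dir_deriv b (\<lambda>z. complex_of_real (U z t)) y = of_real (d_space b U y t)"
    if "b \<in> Basis" "y \<in> D" for b y
    using der[OF U1 that] unfolding dir_deriv_def by (rule vector_derivative_at)
  have zb: "dzbar j (\<lambda>z. complex_of_real (U z t)) y
      = (of_real (d_space (axis j 1) U y t) + \<i> * of_real (d_space (axis j \<i>) U y t)) / 2" if "y \<in> D" for j y
    by (simp add: dzbar_def dir that)
  have dir2: "dir_deriv b (dzbar j (\<lambda>z. complex_of_real (U z t))) z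
      = (of_real (d_space b (d_space (axis j 1) U) z t) + \<i> * of_real (d_space b (d_space (axis j \<i>) U) z t)) / 2"
    if b: "b \<in> Basis" for b j
  proof -
    have "((\<lambda>s. (of_real (d_space (axis j 1) U (z + s *\<^sub>R b) t) + \<i> * of_real (d_space (axis j \<i>) U (z + s *\<^sub>R b) t)) / 2)
      has_vector_derivative
      (of_real (d_space b (d_space (axis j 1) U) z t) + \<i> * of_real (d_space b (d_space (axis j \<i>) U) z t)) / 2) (at 0)"
      by (intro has_vector_derivative_divide has_vector_derivative_add
          has_vector_derivative_mult_right der U2 b zt axis_complex_in_Basis)
    then have "((\<lambda>s. dzbar j (\<lambda>z. complex_of_real (U z t)) (z + s *\<^sub>R b)) has_vector_derivative
      (of_real (d_space b (d_space (axis j 1) U) z t) + \<i> * of_real (d_space b (d_space (axis j \<i>) U) z t)) / 2) (at 0)"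
      using has_deriv_line_cong[of "dzbar j (\<lambda>z. complex_of_real (U z t))" _ z b, OF zb zt(1)] by simp
    then show ?thesis unfolding dir_deriv_def by (rule vector_derivative_at)
  qed
  define H where "H v w = d_space v (d_space w U) z t" for v w
  define p where "p v = d_space v U z t" for v
  have Hsym: "H v w = H w v" if "v \<in> Basis" "w \<in> Basis" for v w
    using d_space_commute[OF U that zt] by (simp add: H_def)
  have G: "dz i (dzbar j (\<lambda>z. complex_of_real (U z t))) z =
      ((of_real (H (axis i 1) (axis j 1)) + \<i> * of_real (H (axis i 1) (axis j \<i>)))
     - \<i> * (of_real (H (axis i \<i>) (axis j 1)) + \<i> * of_real (H (axis i \<i>) (axis j \<i>)))) / 4" for i j
    unfolding dz_def dir2[OF axis_complex_in_Basis(1)] dir2[OF axis_complex_in_Basis(2)] H_def[symmetric]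
    by (simp add: field_simps)
  have drift: "(\<Sum>k\<in>UNIV. X $ k * dz k (\<lambda>z. complex_of_real (U z t)) z)
      + (\<Sum>k\<in>UNIV. Y $ k * dzbar k (\<lambda>z. complex_of_real (U z t)) z)
    = (\<Sum>k\<in>UNIV. X $ k * ((of_real (p (axis k 1)) - \<i> * of_real (p (axis k \<i>))) / 2)
     + Y $ k * ((of_real (p (axis k 1)) + \<i> * of_real (p (axis k \<i>))) / 2))"
    by (simp add: sum.distrib dz_def dzbar_def dir zt p_def)
  have "r = Re (complex_of_real r)" by simp
  also have "\<dots> = Re (\<Sum>i\<in>UNIV. \<Sum>j\<in>UNIV. G $ i $ j * dz i (dzbar j (\<lambda>z. complex_of_real (U z t))) z)
      + Re ((\<Sum>k\<in>UNIV. X $ k * dz k (\<lambda>z. complex_of_real (U z t)) z)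
      + (\<Sum>k\<in>UNIV. Y $ k * dzbar k (\<lambda>z. complex_of_real (U z t)) z)) + Re c * U z t"
    unfolding eq by simp
  also have "\<dots> = (\<Sum>v\<in>Basis. \<Sum>w\<in>Basis. real_coef G v w * H v w)
    + (\<Sum>v\<in>Basis. real_drift X Y v * p v) + Re c * U z t"
    unfolding real_drift_sum drift G by (subst real_coef_sum, rule Hsym, assumption+) simp
  finally show ?thesis unfolding H_def p_def .
qed

lemma C_norm_bound:
  assumes "C_norm k p P I f \<le> N" "N < \<infinity>" "bs \<in> lists Basis" "length bs \<le> k" "q \<le> p" "z \<in> P" "t \<in> I"
  shows "norm ((d_time I ^^ q) (foldr d_space bs f) z t) \<le> enn2real N"
proof -
  have "ennreal (norm ((d_time I ^^ q) (foldr d_space bs f) z t)) \<le> C_norm k p P I f"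
    unfolding C_norm_def
    by (rule SUP_upper2[of bs], use assms in simp, rule SUP_upper2[of q], use assms in simp,
      rule SUP_upper2[of z], use assms in simp, rule SUP_upper2[of t], use assms in simp, simp)
  also have "\<dots> \<le> N" by (rule assms(1))
  also have "N = ennreal (enn2real N)" using assms(2) by simp
  finally show ?thesis by simp
qed

text \<open>The chain rule for the transition map. Its derivative is complex linear, so the
  derivative along \<open>axis i \<i>\<close> is \<open>\<i>\<close> times the one along
  \<open>axis i 1\<close>, and no conjugate Jacobian appears.\<close>

lemma complex_gradient_transform:
  fixes A :: "('a::topological_space, 'n::finite) chart set"
  assumes A: "holomorphic_atlas A" and cd: "c \<in> A" "d \<in> A" and x: "x \<in> fst c" "x \<in> fst d"
    and st: "space_time (chart_image d) I"
    and F: "C_class 1 0 (chart_image d) I (local_rep d F)" and t: "t \<in> I"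
  shows "complex_gradient (\<lambda>v. d_space v (local_rep c F) (snd c x) t) $ i
    = (\<Sum>k\<in>UNIV. jacobian c d x $ k $ i * complex_gradient (\<lambda>v. d_space v (local_rep d F) (snd d x) t) $ k)"
proof -
  interpret d: space_time "chart_image d" I by (rule st)
  have hc: "homeomorphism (fst c) (chart_image c) (snd c) (chart_inv c)" "open (chart_image c)"
    and hd: "homeomorphism (fst d) (chart_image d) (snd d) (chart_inv d)" "open (fst d)"
    using A cd unfolding holomorphic_atlas_def is_chart_def by blast+
  have inv_c: "chart_inv c (snd c y) = y" if "y \<in> fst c" for y
    using hc(1) that by (auto simp: homeomorphism_def)
  have inv_d: "chart_inv d (snd d y) = y" if "y \<in> fst d" for y
    using hd(1) that by (auto simp: homeomorphism_def)
  define z where "z = snd c x"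
  define \<phi> where "\<phi> = snd d \<circ> chart_inv c"
  have \<phi>z: "\<phi> z = snd d x" by (simp add: \<phi>_def z_def inv_c x)
  have "z \<in> snd c ` (fst c \<inter> fst d)" using x by (auto simp: z_def)
  moreover have "holomorphic_map_on \<phi> (snd c ` (fst c \<inter> fst d))"
    using A cd unfolding holomorphic_atlas_def \<phi>_def by blast
  ultimately obtain \<phi>' where \<phi>': "(\<phi> has_derivative \<phi>') (at z)" "\<And>a v. \<phi>' (a *s v) = a *s \<phi>' v"
    unfolding holomorphic_map_on_def by blast
  \<comment> \<open>On this neighbourhood of \<open>z\<close> both charts are defined, so the two
    local representatives differ by the transition map.\<close>
  define N where "N = chart_image c \<inter> chart_inv c -` fst d"
  have N: "open N" "z \<in> N"
    using continuous_open_preimage[of "chart_image c" "chart_inv c" "fst d"] hc hd x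
    by (auto simp: N_def homeomorphism_def z_def inv_c chart_image_def)
  have rep: "local_rep c F y t = local_rep d F (\<phi> y) t" if "y \<in> N" for y
    using that by (simp add: local_rep_def \<phi>_def N_def inv_d)
  define g where "g b = d_space b (local_rep d F) (snd d x) t" for b
  have imd: "snd d x \<in> chart_image d" using x by (auto simp: chart_image_def)
  have "((\<lambda>y. local_rep d F y t) has_derivative (\<lambda>v. \<Sum>b\<in>Basis. (v \<bullet> b) * g b)) (at (\<phi> z))"
    unfolding \<phi>z g_def by (rule d.C_frechet[OF F imd t])
  from has_derivative_compose[OF \<phi>'(1) this]
  have "((\<lambda>y. local_rep d F (\<phi> y) t) has_derivative (\<lambda>v. \<Sum>b\<in>Basis. (\<phi>' v \<bullet> b) * g b)) (at z)" .
  then have FD: "((\<lambda>y. local_rep c F y t) has_derivative (\<lambda>v. \<Sum>b\<in>Basis. (\<phi>' v \<bullet> b) * g b)) (at z)"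
    by (rule has_derivative_transform_within_open[OF _ N]) (simp add: rep)
  have line: "((\<lambda>s. z + s *\<^sub>R v) has_derivative (\<lambda>r. r *\<^sub>R v)) (at (0::real))" for v
    by (auto intro!: derivative_eq_intros)
  have ds: "d_space v (local_rep c F) z t = (\<Sum>b\<in>Basis. (\<phi>' v \<bullet> b) * g b)" for v
  proof -
    have "((\<lambda>s. local_rep c F (z + s *\<^sub>R v) t) has_derivative (\<lambda>r. \<Sum>b\<in>Basis. (\<phi>' (r *\<^sub>R v) \<bullet> b) * g b)) (at 0)"
      using has_derivative_compose[OF line, of "\<lambda>y. local_rep c F y t" _ v] FD by simp
    moreover have "\<phi>' (r *\<^sub>R v) = r *\<^sub>R \<phi>' v" for r
      by (rule linear_cmul[OF has_derivative_linear[OF \<phi>'(1)]])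
    ultimately have "((\<lambda>s. local_rep c F (z + s *\<^sub>R v) t) has_vector_derivative (\<Sum>b\<in>Basis. (\<phi>' v \<bullet> b) * g b)) (at 0)"
      by (simp add: has_vector_derivative_def sum_distrib_left mult.assoc)
    then show ?thesis
      unfolding d_space_def dir_deriv_def by (rule vector_derivative_at)
  qed
  define w where "w = \<phi>' (axis i 1)"
  have wi: "\<phi>' (axis i \<i>) = \<i> *s w"
  proof -
    have "axis i \<i> = \<i> *s axis i (1::complex)"
      by (simp add: vec_eq_iff axis_def)
    then show ?thesis using \<phi>'(2) by (simp add: w_def)
  qed
  have jac: "jacobian c d x $ k $ i = w $ k" for k
  proof -
    have "((\<lambda>y. \<phi> y $ k) has_derivative (\<lambda>v. \<phi>' v $ k)) (at z)"
      by (rule bounded_linear.has_derivative[OF bounded_linear_vec_nth \<phi>'(1)])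
    then have "((\<lambda>s. \<phi> (z + s *\<^sub>R v) $ k) has_derivative (\<lambda>r. \<phi>' (r *\<^sub>R v) $ k)) (at 0)" for v
      using has_derivative_compose[OF line, of "\<lambda>y. \<phi> y $ k" _ v] by simp
    then have "((\<lambda>s. \<phi> (z + s *\<^sub>R v) $ k) has_vector_derivative \<phi>' v $ k) (at 0)" for v
      using linear_cmul[OF has_derivative_linear[OF \<phi>'(1)]] by (simp add: has_vector_derivative_def)
    then have "dir_deriv v (\<lambda>y. \<phi> y $ k) z = \<phi>' v $ k" for v
      unfolding dir_deriv_def by (rule vector_derivative_at)
    then show ?thesis
      unfolding jacobian_def dz_def z_def[symmetric] \<phi>_def[symmetric] comp_def
      using wi by (simp add: w_def[symmetric] \<phi>_def comp_def)
  qed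
  have inner_axis_w: "v \<bullet> axis k y = v $ k \<bullet> y" for v :: "complex ^ 'n" and k y
    by (rule inner_axis)
  show ?thesis
    unfolding z_def[symmetric] g_def[symmetric] jac complex_gradient_def vec_lambda_beta ds wi w_def[symmetric]
      sum_Basis_complex_vec inner_axis_w
    by (simp add: sum_distrib_left sum_divide_distrib inner_complex_def
        complex_eq_iff algebra_simps sum.distrib add_divide_distrib diff_divide_distrib sum_subtractf sum_negf)
qed

section \<open>The gradient estimate on the manifold\<close>

lemma norm_complex_vec_squared: "(norm \<xi>)\<^sup>2 = (\<Sum>k\<in>UNIV. (norm (\<xi> $ k))\<^sup>2)"
  for \<xi> :: "complex ^ 'n::finite"
  by (simp add: norm_vec_def L2_set_def sum_nonneg)

text \<open>If \<open>\<eta>\<close> is the vector dual to \<open>\<xi>\<close> under \<open>h\<close>, then \<open>\<bar>\<xi>\<bar>\<^sup>2\<close> in the dual metric is \<open>h(\<eta>, \<eta>)\<close>.\<close>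

lemma covector_norm2_ge:
  fixes h :: "complex ^ 'n::finite ^ 'n"
  assumes herm: "\<And>i j. h $ j $ i = cnj (h $ i $ j)" and mu: "\<mu> > 0"
    and pd: "\<And>v. \<mu> * (norm v)\<^sup>2 \<le> Re (\<Sum>i\<in>UNIV. \<Sum>j\<in>UNIV. h $ i $ j * v $ i * cnj (v $ j))"
    and bnd: "norm h \<le> b"
  shows "\<mu> * (norm \<xi>)\<^sup>2 \<le> ((real CARD('n))\<^sup>2 * b)\<^sup>2 * covector_norm2 h \<xi>"
proof -
  define M where "M = transpose h"
  have Mv: "(M *v v) $ k = (\<Sum>i\<in>UNIV. h $ i $ k * v $ i)" for v k
    by (simp add: M_def matrix_vector_mult_def transpose_def)
  have form: "(\<Sum>i\<in>UNIV. \<Sum>j\<in>UNIV. h $ i $ j * v $ i * cnj (v $ j)) = (\<Sum>k\<in>UNIV. (M *v v) $ k * cnj (v $ k))" for v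
    unfolding Mv sum_distrib_right by (rule sum.swap)
  \<comment> \<open>Definiteness makes \<open>M\<close> injective, so that
    \<open>matrix_inv M\<close> is a genuine inverse.\<close>
  have "v = 0" if "M *v v = 0" for v
  proof -
    have "\<mu> * (norm v)\<^sup>2 \<le> 0" using pd[of v] unfolding form that by simp
    then have "(norm v)\<^sup>2 \<le> 0" using mu by (simp add: mult_le_0_iff)
    then show ?thesis by simp
  qed
  then obtain B where B: "B ** M = mat 1"
    using matrix_left_invertible_ker[of M] by blast
  then have "invertible M"
    unfolding invertible_def using matrix_left_right_inverse by blast
  then have inv: "M ** matrix_inv M = mat 1"
    unfolding matrix_inv_def invertible_def by (rule someI2_ex) blast
  define \<eta> where "\<eta> = matrix_inv M *v (\<chi> k. cnj (\<xi> $ k))"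
  have \<eta>: "(M *v \<eta>) $ k = cnj (\<xi> $ k)" for k
    unfolding \<eta>_def matrix_vector_mul_assoc inv by simp
  have "covector_norm2 h \<xi> = Re (\<Sum>i\<in>UNIV. \<xi> $ i * \<eta> $ i)"
    unfolding covector_norm2_def covector_form_def \<eta>_def M_def[symmetric]
    by (intro arg_cong[where f = Re] sum.cong refl)
      (simp add: matrix_vector_mult_def sum_distrib_left mult_ac)
  also have "\<dots> = Re (\<Sum>i\<in>UNIV. cnj ((M *v \<eta>) $ i) * \<eta> $ i)"
    by (simp add: \<eta>)
  also have "\<dots> = Re (\<Sum>k\<in>UNIV. (M *v \<eta>) $ k * cnj (\<eta> $ k))"
    by (simp add: algebra_simps)
  also have "\<dots> \<ge> \<mu> * (norm \<eta>)\<^sup>2"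
    using pd[of \<eta>] unfolding form .
  finally have 1: "\<mu> * (norm \<eta>)\<^sup>2 \<le> covector_norm2 h \<xi>" .
  have b0: "b \<ge> 0" using bnd norm_ge_zero order_trans by blast
  \<comment> \<open>Conversely, the entries of \<open>\<xi>\<close> are sums of products of entries
    of \<open>h\<close> and \<open>\<eta>\<close>, so the bound on \<open>h\<close> prevents
    \<open>\<eta>\<close> from being small compared with \<open>\<xi>\<close>.\<close>
  have "norm (\<xi> $ k) \<le> real CARD('n) * (b * norm \<eta>)" for k
  proof -
    have "norm (\<xi> $ k) = norm (\<Sum>i\<in>UNIV. h $ i $ k * \<eta> $ i)"
      using \<eta>[of k] unfolding Mv by (metis complex_mod_cnj)
    also have "\<dots> \<le> of_nat CARD('n) * (b * norm \<eta>)"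
    proof (intro sum_norm_bound)
      fix i
      show "norm (h $ i $ k * \<eta> $ i) \<le> b * norm \<eta>"
        unfolding norm_mult using b0 bnd
        by (intro mult_mono Finite_Cartesian_Product.norm_nth_le)
          (auto intro: order_trans[OF Finite_Cartesian_Product.norm_nth_le order_trans[OF Finite_Cartesian_Product.norm_nth_le]])
    qed
    finally show ?thesis by simp
  qed
  then have "(\<Sum>k\<in>UNIV. norm (\<xi> $ k)) \<le> (\<Sum>k\<in>(UNIV::'n set). real CARD('n) * (b * norm \<eta>))"
    by (intro sum_mono)
  moreover have "norm \<xi> \<le> (\<Sum>k\<in>UNIV. norm (\<xi> $ k))"
    unfolding norm_vec_def by (rule L2_set_le_sum) simp
  ultimately have "norm \<xi> \<le> (real CARD('n))\<^sup>2 * b * norm \<eta>"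
    by (simp add: power2_eq_square mult_ac)
  then have "(norm \<xi>)\<^sup>2 \<le> ((real CARD('n))\<^sup>2 * b * norm \<eta>)\<^sup>2"
    by (intro power_mono) auto
  then have "\<mu> * (norm \<xi>)\<^sup>2 \<le> \<mu> * ((real CARD('n))\<^sup>2 * b * norm \<eta>)\<^sup>2"
    using mu by simp
  also have "\<dots> = ((real CARD('n))\<^sup>2 * b)\<^sup>2 * (\<mu> * (norm \<eta>)\<^sup>2)"
    by (simp add: power_mult_distrib mult_ac)
  also have "\<dots> \<le> ((real CARD('n))\<^sup>2 * b)\<^sup>2 * covector_norm2 h \<xi>"
    using 1 by (rule mult_left_mono) simp
  finally show ?thesis .
qed

text \<open>The metric attains a positive minimum on the compact product of \<open>K\<close> with
  the unit sphere. Homogeneity extends it to all vectors, and \<open>covector_norm2_ge\<close>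
  passes to the dual metric.\<close>

lemma covector_norm2_uniform:
  fixes A :: "('a::topological_space, 'n::finite) chart set"
  assumes A: "holomorphic_atlas A" and g: "hermitian_metric A g" and c: "c \<in> A"
    and K: "compact K" "K \<subseteq> fst c"
  obtains \<mu> where "\<mu> > 0" "\<And>x \<xi>. x \<in> K \<Longrightarrow> \<mu> * (norm \<xi>)\<^sup>2 \<le> covector_norm2 (g c x) \<xi>"
proof (cases "K = {}")
  case True
  then show ?thesis using that[of 1] by simp
next
  case False
  note gherm = g[unfolded hermitian_metric_def, THEN conjunct2, THEN conjunct1, rule_format]
    and gpos = g[unfolded hermitian_metric_def, THEN conjunct2, THEN conjunct2, THEN conjunct1, rule_format]
    and gC = g[unfolded hermitian_metric_def, THEN conjunct2, THEN conjunct2, THEN conjunct2, rule_format]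
  have hc: "homeomorphism (fst c) (chart_image c) (snd c) (chart_inv c)"
    using A c unfolding holomorphic_atlas_def is_chart_def by blast
  have inv_c: "chart_inv c (snd c y) = y" if "y \<in> fst c" for y
    using hc that by (auto simp: homeomorphism_def)
  define K' where "K' = snd c ` K"
  have K': "compact K'" "K' \<noteq> {}" "K' \<subseteq> chart_image c"
  proof -
    have "continuous_on K (snd c)"
      by (rule continuous_on_subset[OF homeomorphism_cont1[OF hc] K(2)])
    then show "compact K'" unfolding K'_def using K(1) by (rule compact_continuous_image)
    show "K' \<noteq> {}" using False by (simp add: K'_def)
    show "K' \<subseteq> chart_image c" using K(2) by (auto simp: K'_def chart_image_def)
  qed
  define h where "h z = g c (chart_inv c z)" for z
  have "continuous_on (chart_image c \<times> UNIV) (\<lambda>(z, t). local_rep c (\<lambda>x t. g c x) z (t::real))"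
  proof -
    have "field_C A 0 0 UNIV (\<lambda>c x t. g c x)" by (rule gC)
    then show ?thesis
      using C_class_continuous[of 0 0 "chart_image c" UNIV "local_rep c (\<lambda>x t. g c x)"] c
      unfolding field_C_def by blast
  qed
  \<comment> \<open>The metric is treated as a field constant in time, so its joint continuity is
    evaluated at time 0.\<close>
  then have "continuous_on K' (\<lambda>z. (\<lambda>(z, t). local_rep c (\<lambda>x t. g c x) z (t::real)) (z, 0))"
    by (rule continuous_on_compose2) (use K' in \<open>auto intro: continuous_on_Pair continuous_on_id continuous_on_const\<close>)
  then have ch: "continuous_on K' h"
    by (simp add: h_def local_rep_def)
  define q where "q h v = Re (\<Sum>i\<in>UNIV. \<Sum>j\<in>UNIV. h $ i $ j * v $ i * cnj (v $ j))"
    for h :: "complex ^ 'n ^ 'n" and v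
  have pos: "q (h z) v > 0" if z: "z \<in> K'" and v: "v \<noteq> 0" for z v
  proof -
    obtain x where "x \<in> K" "z = snd c x" using z by (auto simp: K'_def)
    then have "x \<in> fst c" "h z = g c x" using K inv_c by (auto simp: h_def)
    then show ?thesis using gpos[OF c, of x v] v unfolding q_def by simp
  qed
  have "compact (K' \<times> sphere (0 :: complex ^ 'n) 1)"
    using K' by (intro compact_Times compact_sphere)
  moreover have "K' \<times> sphere (0 :: complex ^ 'n) 1 \<noteq> {}"
  proof -
    have "axis undefined 1 \<in> sphere (0 :: complex ^ 'n) 1" by (simp add: norm_axis_1)
    then show ?thesis using K'(2) by blast
  qed
  moreover have "continuous_on (K' \<times> sphere 0 1) (\<lambda>p. q (h (fst p)) (snd p))"
  proof -
    have "continuous_on (K' \<times> sphere (0 :: complex ^ 'n) 1) (\<lambda>p. h (fst p))"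
      by (rule continuous_on_compose2[OF ch continuous_on_fst[OF continuous_on_id]]) auto
    then show ?thesis
      unfolding q_def
      by (intro continuous_on_Re continuous_on_sum continuous_on_mult continuous_on_cnj
          continuous_on_component continuous_on_snd continuous_on_id)
  qed
  ultimately have "\<exists>p\<in>K' \<times> sphere 0 1. \<forall>r\<in>K' \<times> sphere 0 1. q (h (fst p)) (snd p) \<le> q (h (fst r)) (snd r)"
    by (rule continuous_attains_inf)
  then obtain p where p: "p \<in> K' \<times> sphere 0 1"
    "\<And>r. r \<in> K' \<times> sphere 0 1 \<Longrightarrow> q (h (fst p)) (snd p) \<le> q (h (fst r)) (snd r)"
    by meson
  define m where "m = q (h (fst p)) (snd p)"
  have m: "m > 0"
    unfolding m_def by (rule pos) (use p(1) in auto)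
  have qscale: "q h (of_real r *s v) = r\<^sup>2 * q h v" for h r v
  proof -
    have "q h (of_real r *s v) = Re (of_real (r\<^sup>2) * (\<Sum>i\<in>UNIV. \<Sum>j\<in>UNIV. h $ i $ j * v $ i * cnj (v $ j)))"
      unfolding q_def sum_distrib_left
      by (intro arg_cong[where f = Re] sum.cong refl) (simp add: power2_eq_square mult_ac)
    then show ?thesis by (simp add: q_def)
  qed
  have pd: "m * (norm v)\<^sup>2 \<le> q (h z) v" if z: "z \<in> K'" for z v
  proof (cases "v = 0")
    case True
    then show ?thesis by (simp add: q_def)
  next
    case False
    define w where "w = of_real (inverse (norm v)) *s v"
    have "w = inverse (norm v) *\<^sub>R v" unfolding w_def vec_eq_iff vector_smult_component vector_scaleR_component by (simp add: scaleR_conv_of_real)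
    then have "norm w = 1" using False by simp
    then have "m \<le> q (h z) w" using p(2)[of "(z, w)"] z by (simp add: m_def)
    then have "m * (norm v)\<^sup>2 \<le> q (h z) w * (norm v)\<^sup>2" by (rule mult_right_mono) simp
    also have "\<dots> = q (h z) v" using False unfolding w_def qscale by (simp add: field_simps)
    finally show ?thesis .
  qed
  obtain b where b: "\<And>z. z \<in> K' \<Longrightarrow> norm (h z) \<le> b"
    using compact_imp_bounded[OF compact_continuous_image[OF ch K'(1)]] unfolding bounded_iff by auto
  \<comment> \<open>The maximum with 1 keeps \<open>B\<close> positive, as it becomes a
    denominator.\<close>
  define B where "B = ((real CARD('n))\<^sup>2 * (max b 1))\<^sup>2"
  have B: "B > 0" by (simp add: B_def)
  show ?thesis
  proof (rule that[of "m / B"])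
    fix x \<xi> assume x: "x \<in> K"
    then have z: "snd c x \<in> K'" and hx: "h (snd c x) = g c x"
      using K inv_c by (auto simp: K'_def h_def)
    have "m * (norm \<xi>)\<^sup>2 \<le> B * covector_norm2 (g c x) \<xi>"
      unfolding B_def
    proof (rule covector_norm2_ge[OF _ m])
      show "g c x $ j $ i = cnj (g c x $ i $ j)" for i j
        by (rule gherm[OF c]) (use x K in blast)
      show "m * (norm v)\<^sup>2 \<le> Re (\<Sum>i\<in>UNIV. \<Sum>j\<in>UNIV. g c x $ i $ j * v $ i * cnj (v $ j))" for v
        using pd[OF z, of v] unfolding hx q_def .
      show "norm (g c x) \<le> max b 1" using b[OF z] unfolding hx by simp
    qed
    then show "m / B * (norm \<xi>)\<^sup>2 \<le> covector_norm2 (g c x) \<xi>"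
      using B by (simp add: field_simps)
  qed (use m B in simp)
qed

text \<open>One number \<open>N\<close> bounds all four norms, so that the later constants are
  functions of a single real. The atlas, the metric, the cover and \<open>lam\<close> stay fixed
  while the other parameters vary with the solution.\<close>

locale parabolic_solution =
  fixes A :: "('a::t2_space, 'n::finite) chart set"
    and g :: "('a, 'n) chart \<Rightarrow> 'a \<Rightarrow> complex ^ 'n ^ 'n"
    and S :: "(('a, 'n) chart \<times> 'a set) set"
    and lam Lam T N :: real
    and G :: "('a, 'n) chart \<Rightarrow> 'a \<Rightarrow> real \<Rightarrow> complex ^ 'n ^ 'n"
    and chi chibar :: "('a, 'n) chart \<Rightarrow> 'a \<Rightarrow> real \<Rightarrow> complex ^ 'n"
    and chi0 :: "'a \<Rightarrow> real \<Rightarrow> complex"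
    and u :: "'a \<Rightarrow> real \<Rightarrow> real"
  assumes manifold: "compact_hermitian_manifold A g" and cover: "norm_cover A S"
    and lam: "0 < lam" and T: "0 < T" and N: "0 \<le> N"
    and tensor: "contravariant_11 A {0..<T} G"
    and C_G: "field_C A 3 1 {0..<T} G" and norm_G: "field_norm S 3 1 {0..<T} G \<le> ennreal N"
    and ell: "uniformly_elliptic A g {0..<T} lam Lam G"
    and C_chi: "field_C A 1 1 {0..<T} chi" and norm_chi: "field_norm S 1 1 {0..<T} chi \<le> ennreal N"
    and C_chibar: "field_C A 1 1 {0..<T} chibar"
    and norm_chibar: "field_norm S 1 1 {0..<T} chibar \<le> ennreal N"
    and C_chi0: "field_C A 1 1 {0..<T} (\<lambda>c. chi0)"
    and norm_chi0: "field_norm S 1 1 {0..<T} (\<lambda>c. chi0) \<le> ennreal N"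
    and C_u: "field_C A 3 2 {0..<T} (\<lambda>c. u)"
    and pos: "\<And>x t. t \<in> {0..<T} \<Longrightarrow> 0 < u x t"
    and eq: "\<And>c x t. c \<in> A \<Longrightarrow> x \<in> fst c \<Longrightarrow> t \<in> {0..<T} \<Longrightarrow>
         complex_of_real (vector_derivative (u x) (at t within {0..<T})) =
           (\<Sum>i\<in>UNIV. \<Sum>j\<in>UNIV. G c x t $ i $ j *
             dz i (dzbar j (\<lambda>z. complex_of_real (u (chart_inv c z) t))) (snd c x))
           + (\<Sum>k\<in>UNIV. chi c x t $ k * dz k (\<lambda>z. complex_of_real (u (chart_inv c z) t)) (snd c x))
           + (\<Sum>k\<in>UNIV. chibar c x t $ k * dzbar k (\<lambda>z. complex_of_real (u (chart_inv c z) t)) (snd c x))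
           + chi0 x t * complex_of_real (u x t)"
begin

abbreviation "I \<equiv> {0..<T}"

definition log_u :: "('a, 'n) chart \<Rightarrow> complex ^ 'n \<Rightarrow> real \<Rightarrow> real" where
  "log_u c = local_rep c (\<lambda>x t. ln (u x t))"
definition coef :: "('a, 'n) chart \<Rightarrow> complex ^ 'n \<Rightarrow> complex ^ 'n \<Rightarrow> complex ^ 'n \<Rightarrow> real \<Rightarrow> real" where
  "coef c v w = (\<lambda>z t. real_coef (local_rep c (G c) z t) v w)"
definition drift :: "('a, 'n) chart \<Rightarrow> complex ^ 'n \<Rightarrow> complex ^ 'n \<Rightarrow> real \<Rightarrow> real" where
  "drift c v = (\<lambda>z t. real_drift (local_rep c (chi c) z t) (local_rep c (chibar c) z t) v)"
definition zeroth :: "('a, 'n) chart \<Rightarrow> complex ^ 'n \<Rightarrow> real \<Rightarrow> real" where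
  "zeroth c = (\<lambda>z t. Re (local_rep c chi0 z t))"
text \<open>The Li-Yau quantity \<open>P\<close> in the coordinates of \<open>c\<close>; the chart
  is an argument because the differentiation takes place in it.\<close>

definition harnack_quantity :: "('a, 'n) chart \<Rightarrow> complex ^ 'n \<Rightarrow> real \<Rightarrow> real" where
  "harnack_quantity c z t = quad Basis (\<lambda>v w. coef c v w z t) (\<lambda>v. d_space v (log_u c) z t) - 2 * d_time I (log_u c) z t"

lemma atlas: "holomorphic_atlas A" and metric: "hermitian_metric A g"
  and M_compact: "compact (UNIV :: 'a set)" and M_connected: "connected (UNIV :: 'a set)"
  using manifold by (auto simp: compact_hermitian_manifold_def)

lemma chart:
  assumes "c \<in> A"
  shows "homeomorphism (fst c) (chart_image c) (snd c) (chart_inv c)" "open (chart_image c)" "open (fst c)"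
    "x \<in> fst c \<Longrightarrow> chart_inv c (snd c x) = x" "x \<in> fst c \<Longrightarrow> snd c x \<in> chart_image c"
    "z \<in> chart_image c \<Longrightarrow> snd c (chart_inv c z) = z" "z \<in> chart_image c \<Longrightarrow> chart_inv c z \<in> fst c"
proof -
  have "is_chart c" using atlas assms unfolding holomorphic_atlas_def by blast
  then show hom: "homeomorphism (fst c) (chart_image c) (snd c) (chart_inv c)"
    and "open (chart_image c)" "open (fst c)"
    by (simp_all add: is_chart_def)
  show "x \<in> fst c \<Longrightarrow> chart_inv c (snd c x) = x" "z \<in> chart_image c \<Longrightarrow> snd c (chart_inv c z) = z"
    using hom by (simp_all add: homeomorphism_def)
  show "x \<in> fst c \<Longrightarrow> snd c x \<in> chart_image c" "z \<in> chart_image c \<Longrightarrow> chart_inv c z \<in> fst c"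
    using homeomorphism_image1[OF hom] homeomorphism_image2[OF hom] by blast+
qed

lemma space_time_chart: "c \<in> A \<Longrightarrow> space_time (chart_image c) I"
proof
  fix t :: real assume "t \<in> I"
  then have "t islimpt {t<..<T}" by (simp add: islimpt_greaterThanLessThan1)
  then have "t islimpt I" by (rule islimpt_subset) (use \<open>t \<in> I\<close> in auto)
  then show "at t within I \<noteq> bot" by (simp add: trivial_limit_within)
qed (rule chart)

lemma drift_split: "drift c v = (\<lambda>z t. real_drift (local_rep c (chi c) z t) 0 v
    + real_drift 0 (local_rep c (chibar c) z t) v)"
  unfolding drift_def by (intro ext linear_real_drift(3))

lemma regularity:
  assumes "c \<in> A"
  shows "C_class 3 1 (chart_image c) I (coef c v w)" "C_class 1 1 (chart_image c) I (drift c v)"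
    "C_class 1 1 (chart_image c) I (zeroth c)" "C_class 3 2 (chart_image c) I (log_u c)"
proof -
  interpret space_time "chart_image c" I by (rule space_time_chart[OF assms])
  show "C 3 1 (coef c v w)"
    unfolding coef_def using C_G assms
    by (intro C_linear[OF bounded_linear_real_coef]) (auto simp: field_C_def)
  show "C 1 1 (drift c v)"
    unfolding drift_split using C_chi C_chibar assms
    by (intro C_add C_linear[OF linear_real_drift(1)] C_linear[OF linear_real_drift(2)])
      (auto simp: field_C_def)
  show "C 1 1 (zeroth c)"
    unfolding zeroth_def using C_chi0 assms
    by (intro C_linear[OF bounded_linear_Re]) (auto simp: field_C_def)
  have "C 3 2 (\<lambda>z t. ln (local_rep c u z t))"
    using C_u assms pos by (intro C_ln) (auto simp: field_C_def local_rep_def)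
  then show "C 3 2 (log_u c)"
    by (simp add: log_u_def local_rep_def)
qed

lemma log_eq:
  assumes c: "c \<in> A" and zt: "z \<in> chart_image c" "t \<in> I"
  shows "d_time I (log_u c) z t =
        (\<Sum>i\<in>Basis. \<Sum>j\<in>Basis. coef c i j z t * d_space i (d_space j (log_u c)) z t)
        + quad Basis (\<lambda>i j. coef c i j z t) (\<lambda>i. d_space i (log_u c) z t)
        + (\<Sum>i\<in>Basis. drift c i z t * d_space i (log_u c) z t) + zeroth c z t"
proof -
  interpret space_time "chart_image c" I by (rule space_time_chart[OF c])
  define U where "U = local_rep c u"
  have U: "C 3 2 U" using C_u c by (simp add: field_C_def U_def)
  have U': "C 2 0 U" "C 2 1 U" using C_class_mono[OF U, of 2 0] C_class_mono[OF U, of 2 1] by simp_all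
  have posU: "U y s > 0" if "s \<in> I" for y s using pos[OF that] by (simp add: U_def local_rep_def)
  have x: "chart_inv c z \<in> fst c" "snd c (chart_inv c z) = z" using chart[OF c] zt by auto
  have "complex_of_real (d_time I U z t) =
      (\<Sum>i\<in>UNIV. \<Sum>j\<in>UNIV. local_rep c (G c) z t $ i $ j * dz i (dzbar j (\<lambda>z. complex_of_real (U z t))) z)
      + (\<Sum>k\<in>UNIV. local_rep c (chi c) z t $ k * dz k (\<lambda>z. complex_of_real (U z t)) z)
      + (\<Sum>k\<in>UNIV. local_rep c (chibar c) z t $ k * dzbar k (\<lambda>z. complex_of_real (U z t)) z)
      + local_rep c chi0 z t * complex_of_real (U z t)"
    using eq[OF c x(1) zt(2)] x(2) by (simp add: U_def local_rep_def d_time_def)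
  from real_parabolic_eq[OF space_time_chart[OF c] U'(1) zt this]
  have "d_time I U z t = (\<Sum>v\<in>Basis. \<Sum>w\<in>Basis. coef c v w z t * d_space v (d_space w U) z t)
      + (\<Sum>v\<in>Basis. drift c v z t * d_space v U z t) + zeroth c z t * U z t"
    by (simp add: coef_def drift_def zeroth_def)
  from parabolic_eq_ln[OF U'(2) posU zt this] show ?thesis
    by (simp add: log_u_def U_def local_rep_def)
qed

lemma quad_coef: "quad Basis (\<lambda>v w. coef c v w z t) p
    = Re (covector_form (G c (chart_inv c z) t) (complex_gradient p))"
  using quad_real_coef[of "local_rep c (G c) z t" p] by (simp add: coef_def local_rep_def)

text \<open>The factor 1/4 is the ratio of the squared lengths of the complex and the real
  gradient.\<close>

lemma quad_coef_lower:
  assumes c: "c \<in> A" and x: "x \<in> fst c" and t: "t \<in> I"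
    and mu: "\<And>\<xi>. \<mu> * (norm \<xi>)\<^sup>2 \<le> covector_norm2 (g c x) \<xi>"
  shows "lam * \<mu> / 4 * (\<Sum>v\<in>Basis. (p v)\<^sup>2) \<le> quad Basis (\<lambda>v w. coef c v w (snd c x) t) p"
proof -
  define \<xi> where "\<xi> = complex_gradient p"
  have "(norm \<xi>)\<^sup>2 = (\<Sum>k\<in>UNIV. ((p (axis k 1))\<^sup>2 + (p (axis k \<i>))\<^sup>2) / 4)"
    unfolding norm_complex_vec_squared \<xi>_def complex_gradient_def
    by (simp add: norm_divide power_divide cmod_power2)
  also have "\<dots> = (\<Sum>v\<in>Basis. (p v)\<^sup>2) / 4"
    unfolding sum_Basis_complex_vec by (simp add: sum_divide_distrib)
  finally have nrm: "lam * \<mu> / 4 * (\<Sum>v\<in>Basis. (p v)\<^sup>2) = lam * (\<mu> * (norm \<xi>)\<^sup>2)" by simp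
  also have "\<dots> \<le> lam * covector_norm2 (g c x) \<xi>"
    using mu lam by (intro mult_left_mono) auto
  also have "\<dots> \<le> Re (covector_form (G c x t) \<xi>)"
  \<comment> \<open>Ellipticity speaks about nonzero covectors; at 0 both forms vanish.\<close>
  proof (cases "\<xi> = 0")
    case True
    then show ?thesis by (simp add: covector_norm2_def covector_form_def)
  next
    case False
    then show ?thesis using ell c x t unfolding uniformly_elliptic_def by blast
  qed
  also have "\<dots> = quad Basis (\<lambda>v w. coef c v w (snd c x) t) p"
    using chart(4)[OF c x] by (simp add: quad_coef \<xi>_def)
  finally show ?thesis .
qed

text \<open>The Jacobians in the law for \<open>G\<close> are exactly those picked up by the
  gradient, so the quadratic term is a scalar. The time derivative is taken at a fixed point of the
  manifold and does not see the chart.\<close>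

lemma harnack_quantity_invariant:
  assumes c: "c \<in> A" "x \<in> fst c" and d: "d \<in> A" "x \<in> fst d" and t: "t \<in> I"
  shows "harnack_quantity c (snd c x) t = harnack_quantity d (snd d x) t"
proof -
  define \<xi> where "\<xi> c = complex_gradient (\<lambda>v. d_space v (log_u c) (snd c x) t)" for c
  have C1: "C_class 1 0 (chart_image d) I (log_u d)"
    using C_class_mono[OF regularity(4)[OF d(1)], of 1 0] by simp
  have tr: "\<xi> c $ i = (\<Sum>k\<in>UNIV. jacobian c d x $ k $ i * \<xi> d $ k)" for i
    using complex_gradient_transform[OF atlas c(1) d(1) c(2) d(2) space_time_chart[OF d(1)] _ t] C1
    unfolding \<xi>_def log_u_def by blast
  have "covector_form (G d x t) (\<xi> d) = (\<Sum>k\<in>UNIV. \<Sum>l\<in>UNIV. \<Sum>i\<in>UNIV. \<Sum>j\<in>UNIV.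
      jacobian c d x $ k $ i * G c x t $ i $ j * cnj (jacobian c d x $ l $ j) * \<xi> d $ k * cnj (\<xi> d $ l))"
    using tensor c d t unfolding contravariant_11_def covector_form_def
    by (simp add: sum_distrib_right)
  also have "\<dots> = (\<Sum>i\<in>UNIV. \<Sum>j\<in>UNIV. \<Sum>k\<in>UNIV. \<Sum>l\<in>UNIV.
      jacobian c d x $ k $ i * G c x t $ i $ j * cnj (jacobian c d x $ l $ j) * \<xi> d $ k * cnj (\<xi> d $ l))"
    by (rule sum_swap4)
  also have "\<dots> = covector_form (G c x t) (\<xi> c)"
    unfolding covector_form_def tr
    by (intro sum.cong refl) (simp add: sum_distrib_left sum_distrib_right mult_ac)
  finally have form: "covector_form (G d x t) (\<xi> d) = covector_form (G c x t) (\<xi> c)" .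
  have "d_time I (log_u c) (snd c x) t = d_time I (log_u d) (snd d x) t"
    using chart(4)[OF c] chart(4)[OF d] by (simp add: d_time_def log_u_def local_rep_def)
  then show ?thesis
    using form chart(4)[OF c] chart(4)[OF d] unfolding harnack_quantity_def quad_coef \<xi>_def by simp
qed

end

lemma field_norm_bound:
  assumes "(c, K) \<in> S" "x \<in> K" "t \<in> I" "field_norm S k p I F \<le> ennreal N" "0 \<le> N"
    and "bs \<in> lists Basis" "length bs \<le> k" "q \<le> p"
  shows "norm ((d_time I ^^ q) (foldr d_space bs (local_rep c (F c))) (snd c x) t) \<le> N"
proof -
  have "C_norm k p (snd c ` K) I (local_rep c (F c)) \<le> field_norm S k p I F"
    unfolding field_norm_def by (rule SUP_upper2[OF assms(1)]) simp
  also have "\<dots> \<le> ennreal N" by (rule assms(4))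
  finally show ?thesis
    using C_norm_bound[of k p "snd c ` K" I "local_rep c (F c)" "ennreal N" bs q "snd c x" t] assms
    by simp
qed

context parabolic_solution
begin

text \<open>The real coefficients are linear in the components of the tensors, so their derivatives
  are the same linear expressions in the differentiated components. In \<open>b\<close> the factor 2
  accommodates the two fields in the drift, and adding 1 makes \<open>b \<ge> 1\<close>, as the
  pointwise estimate requires.\<close>

lemma coefficient_bounds:
  assumes cK: "(c, K) \<in> S" and x: "x \<in> K" and t: "t \<in> I"
  defines "z \<equiv> snd c x" and "b \<equiv> 2 * (real CARD('n))\<^sup>2 * N + 1"
  shows "v \<in> Basis \<Longrightarrow> w \<in> Basis \<Longrightarrow> \<bar>coef c v w z t\<bar> \<le> b"
    "k \<in> Basis \<Longrightarrow> v \<in> Basis \<Longrightarrow> w \<in> Basis \<Longrightarrow> \<bar>d_space k (coef c v w) z t\<bar> \<le> b"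
    "k \<in> Basis \<Longrightarrow> l \<in> Basis \<Longrightarrow> v \<in> Basis \<Longrightarrow> w \<in> Basis \<Longrightarrow> \<bar>d_space l (d_space k (coef c v w)) z t\<bar> \<le> b"
    "v \<in> Basis \<Longrightarrow> w \<in> Basis \<Longrightarrow> \<bar>d_time I (coef c v w) z t\<bar> \<le> b"
    "v \<in> Basis \<Longrightarrow> \<bar>drift c v z t\<bar> \<le> b"
    "k \<in> Basis \<Longrightarrow> v \<in> Basis \<Longrightarrow> \<bar>d_space k (drift c v) z t\<bar> \<le> b"
    "v \<in> Basis \<Longrightarrow> \<bar>d_time I (drift c v) z t\<bar> \<le> b"
    "\<bar>zeroth c z t\<bar> \<le> b"
    "k \<in> Basis \<Longrightarrow> \<bar>d_space k (zeroth c) z t\<bar> \<le> b"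
    "\<bar>d_time I (zeroth c) z t\<bar> \<le> b"
proof -
  have c: "c \<in> A" "x \<in> fst c" using cover cK x unfolding norm_cover_def by auto
  interpret space_time "chart_image c" I by (rule space_time_chart[OF c(1)])
  have z: "z \<in> chart_image c" unfolding z_def by (rule chart(5)[OF c])
  define GL XL YL ZL where "GL = local_rep c (G c)" and "XL = local_rep c (chi c)"
    and "YL = local_rep c (chibar c)" and "ZL = local_rep c chi0"
  have C: "C 3 1 GL" "C 1 1 XL" "C 1 1 YL" "C 1 1 ZL"
    using C_G C_chi C_chibar C_chi0 c by (auto simp: field_C_def GL_def XL_def YL_def ZL_def)
  have GL: "C 1 0 GL" "C 0 1 GL" "\<And>k. k \<in> Basis \<Longrightarrow> C 1 0 (d_space k GL)"
    using C_class_mono[OF C(1), of 1 0] C_class_mono[OF C(1), of 0 1]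
      C_class_space[of 1 0 "chart_image c" I GL] C_class_mono[OF C(1), of 2 0] by (simp_all add: numeral_2_eq_2)
  have L: "C 1 0 XL" "C 0 1 XL" "C 1 0 YL" "C 0 1 YL" "C 1 0 ZL" "C 0 1 ZL"
    using C_class_mono[OF C(2), of 1 0] C_class_mono[OF C(2), of 0 1] C_class_mono[OF C(3), of 1 0]
      C_class_mono[OF C(3), of 0 1] C_class_mono[OF C(4), of 1 0] C_class_mono[OF C(4), of 0 1] by simp_all
  have nG: "norm ((d_time I ^^ q) (foldr d_space bs GL) z t) \<le> N"
    if "bs \<in> lists Basis" "length bs \<le> 3" "q \<le> 1" for bs q
    unfolding GL_def z_def by (rule field_norm_bound[OF cK x t norm_G N that])
  have nX: "norm ((d_time I ^^ q) (foldr d_space bs XL) z t) \<le> N"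
    if "bs \<in> lists Basis" "length bs \<le> 1" "q \<le> 1" for bs q
    unfolding XL_def z_def by (rule field_norm_bound[OF cK x t norm_chi N that])
  have nY: "norm ((d_time I ^^ q) (foldr d_space bs YL) z t) \<le> N"
    if "bs \<in> lists Basis" "length bs \<le> 1" "q \<le> 1" for bs q
    unfolding YL_def z_def by (rule field_norm_bound[OF cK x t norm_chibar N that])
  have nZ: "norm ((d_time I ^^ q) (foldr d_space bs ZL) z t) \<le> N"
    if "bs \<in> lists Basis" "length bs \<le> 1" "q \<le> 1" for bs q
    unfolding ZL_def z_def by (rule field_norm_bound[OF cK x t norm_chi0[unfolded atomize_eq] N that])
  define n where "n = (real CARD('n))\<^sup>2"
  have n: "n \<ge> 1" by (simp add: n_def Suc_leI)
  have b: "n * N \<le> b" "2 * (n * N) \<le> b" "N \<le> b"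
  proof -
    have "1 * N \<le> n * N" using n N by (intro mult_right_mono)
    then show "n * N \<le> b" "2 * (n * N) \<le> b" "N \<le> b" using N by (auto simp: b_def n_def)
  qed
  have coefb: "\<bar>real_coef H v w\<bar> \<le> b" if "norm H \<le> N" "v \<in> Basis" "w \<in> Basis" for H :: "complex ^ 'n ^ 'n" and v w
  proof -
    have "\<bar>real_coef H v w\<bar> \<le> n * norm H"
      unfolding n_def by (rule abs_real_coef_le[OF that(2,3)])
    also have "\<dots> \<le> n * N" using that(1) n by (intro mult_left_mono) auto
    finally show ?thesis using b by simp
  qed
  have driftb: "\<bar>real_drift X 0 v + real_drift 0 Y v\<bar> \<le> b" if "norm X \<le> N" "norm Y \<le> N" "v \<in> Basis" for X Y :: "complex ^ 'n" and v
  proof -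
    have "\<bar>real_drift X Y v\<bar> \<le> n * (norm X + norm Y)"
      unfolding n_def by (rule abs_real_drift_le[OF that(3)])
    also have "\<dots> \<le> n * (2 * N)" using that n by (intro mult_left_mono) auto
    finally have "\<bar>real_drift X Y v\<bar> \<le> b" using b by simp
    then show ?thesis by (simp add: linear_real_drift(3)[of X Y])
  qed
  have Reb: "\<bar>Re y\<bar> \<le> b" if "norm y \<le> N" for y
    using order_trans[OF abs_Re_le_cmod that] b by simp
  note coef_lin = d_space_linear[OF bounded_linear_real_coef] d_time_linear[OF bounded_linear_real_coef]
  show "\<bar>coef c v w z t\<bar> \<le> b" if "v \<in> Basis" "w \<in> Basis"
    using nG[of "[]" 0] that unfolding coef_def GL_def[symmetric] by (intro coefb) auto
  have dc: "d_space k (coef c v w) y s = real_coef (d_space k GL y s) v w"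
    if "k \<in> Basis" "y \<in> chart_image c" "s \<in> I" for k v w y s
    unfolding coef_def GL_def[symmetric] by (rule coef_lin(1)[OF GL(1) that])
  show "\<bar>d_space k (coef c v w) z t\<bar> \<le> b" if "k \<in> Basis" "v \<in> Basis" "w \<in> Basis"
    using nG[of "[k]" 0] that unfolding dc[OF that(1) z t] by (intro coefb) auto
  show "\<bar>d_space l (d_space k (coef c v w)) z t\<bar> \<le> b"
    if "k \<in> Basis" "l \<in> Basis" "v \<in> Basis" "w \<in> Basis"
  proof -
    have "d_space l (d_space k (coef c v w)) z t = d_space l (\<lambda>y s. real_coef (d_space k GL y s) v w) z t"
      by (rule d_space_cong[OF _ z]) (rule dc[OF that(1) _ t])
    also have "\<dots> = real_coef (d_space l (d_space k GL) z t) v w"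
      by (rule coef_lin(1)[OF GL(3)[OF that(1)] that(2) z t])
    finally show ?thesis using nG[of "[l, k]" 0] that by (simp add: coefb)
  qed
  show "\<bar>d_time I (coef c v w) z t\<bar> \<le> b" if "v \<in> Basis" "w \<in> Basis"
    using nG[of "[]" 1] that unfolding coef_def GL_def[symmetric] coef_lin(2)[OF GL(2) z t]
    by (intro coefb) auto
  show "\<bar>drift c v z t\<bar> \<le> b" if "v \<in> Basis"
    using nX[of "[]" 0] nY[of "[]" 0] that unfolding drift_split XL_def[symmetric] YL_def[symmetric]
    by (intro driftb) auto
  have CX: "C 1 0 (\<lambda>z t. real_drift (XL z t) 0 v)" "C 0 1 (\<lambda>z t. real_drift (XL z t) 0 v)"
    and CY: "C 1 0 (\<lambda>z t. real_drift 0 (YL z t) v)" "C 0 1 (\<lambda>z t. real_drift 0 (YL z t) v)" for v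
    by (intro C_linear[OF linear_real_drift(1)] C_linear[OF linear_real_drift(2)] L)+
  show "\<bar>d_space k (drift c v) z t\<bar> \<le> b" if "k \<in> Basis" "v \<in> Basis"
    using nX[of "[k]" 0] nY[of "[k]" 0] that
    unfolding drift_split XL_def[symmetric] YL_def[symmetric] d_space_add[OF CX(1) CY(1) that(1) z t]
      d_space_linear[OF linear_real_drift(1) L(1) that(1) z t]
      d_space_linear[OF linear_real_drift(2) L(3) that(1) z t]
    by (intro driftb) auto
  show "\<bar>d_time I (drift c v) z t\<bar> \<le> b" if "v \<in> Basis"
    using nX[of "[]" 1] nY[of "[]" 1] that
    unfolding drift_split XL_def[symmetric] YL_def[symmetric] d_time_add[OF CX(2) CY(2) z t]
      d_time_linear[OF linear_real_drift(1) L(2) z t]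
      d_time_linear[OF linear_real_drift(2) L(4) z t]
    by (intro driftb) auto
  show "\<bar>zeroth c z t\<bar> \<le> b"
    using nZ[of "[]" 0] unfolding zeroth_def ZL_def[symmetric] by (intro Reb) auto
  show "\<bar>d_space k (zeroth c) z t\<bar> \<le> b" if "k \<in> Basis"
    using nZ[of "[k]" 0] that
    unfolding zeroth_def ZL_def[symmetric] d_space_linear[OF bounded_linear_Re L(5) that(1) z t]
    by (intro Reb) auto
  show "\<bar>d_time I (zeroth c) z t\<bar> \<le> b"
    using nZ[of "[]" 1]
    unfolding zeroth_def ZL_def[symmetric] d_time_linear[OF bounded_linear_Re L(6) z t]
    by (intro Reb) auto
qed

lemma harnack_quantity_continuous:
  assumes "c \<in> A"
  shows "continuous_on (chart_image c \<times> I) (\<lambda>(z, t). harnack_quantity c z t)"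
proof -
  interpret space_time "chart_image c" I by (rule space_time_chart[OF assms])
  have f: "C 1 0 (log_u c)" "C 0 1 (log_u c)"
    using C_class_mono[OF regularity(4)[OF assms], of 1 0] C_class_mono[OF regularity(4)[OF assms], of 0 1]
    by simp_all
  have a: "C 0 0 (coef c v w)" for v w
    using C_class_mono[OF regularity(1)[OF assms], of 0 0] by simp
  have 1: "C 0 0 (d_space v (log_u c))" if "v \<in> Basis" for v
    using C_class_space[of 0 0] f that by simp
  have 2: "C 0 0 (d_time I (log_u c))"
    using C_class_time[of 0 0] f by simp
  have "C 0 0 (\<lambda>z t. (\<Sum>v\<in>Basis. \<Sum>w\<in>Basis. coef c v w z t * d_space v (log_u c) z t * d_space w (log_u c) z t)
      + (- 2) * d_time I (log_u c) z t)"
    by (intro C_add C_cmult C_sum C_mult a 1 2)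
  from C_class_continuous[OF this] show ?thesis
    by (simp add: harnack_quantity_def quad_def)
qed

text \<open>The maximum is taken over the compact pieces on which the norms control the coefficients;
  by invariance it is a maximum over all of \<open>M\<close>.\<close>

lemma harnack_quantity_maximum:
  assumes T': "0 \<le> T'" "T' < T"
  obtains c K x t where "(c, K) \<in> S" "x \<in> K" "t \<in> {0..T'}"
    "\<And>d y s. d \<in> A \<Longrightarrow> y \<in> fst d \<Longrightarrow> s \<in> {0..T'} \<Longrightarrow>
      s * harnack_quantity d (snd d y) s \<le> t * harnack_quantity c (snd c x) t"
proof -
  define E where "E c x t = t * harnack_quantity c (snd c x) t" for c x t
  \<comment> \<open>Empty pieces carry no maximum and are discarded.\<close>
  define S' where "S' = {p \<in> S. snd p \<noteq> {}}"
  have S: "finite S" "\<And>c K. (c, K) \<in> S \<Longrightarrow> c \<in> A \<and> compact K \<and> K \<subseteq> fst c"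
    "\<And>y. \<exists>c K. (c, K) \<in> S \<and> y \<in> K"
  proof -
    show "finite S" "\<And>c K. (c, K) \<in> S \<Longrightarrow> c \<in> A \<and> compact K \<and> K \<subseteq> fst c"
      using cover unfolding norm_cover_def by auto
    show "\<exists>c K. (c, K) \<in> S \<and> y \<in> K" for y
      using cover UNIV_I[of y] unfolding norm_cover_def by blast
  qed
  have S': "finite S'" "S' \<noteq> {}"
    using S(1) S(3)[of undefined] by (auto simp: S'_def)
  have "\<exists>q. fst q \<in> snd p \<and> snd q \<in> {0..T'} \<and>
      (\<forall>y\<in>snd p. \<forall>s\<in>{0..T'}. E (fst p) y s \<le> E (fst p) (fst q) (snd q))" if p: "p \<in> S'" for p
  proof -
    obtain c K where cK: "p = (c, K)" "(c, K) \<in> S" "K \<noteq> {}" using p by (cases p) (auto simp: S'_def)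
    have c: "c \<in> A" "compact K" "K \<subseteq> fst c" using S(2)[OF cK(2)] by auto
    have cs: "continuous_on K (snd c)"
      by (rule continuous_on_subset[OF homeomorphism_cont1[OF chart(1)[OF c(1)]] c(3)])
    have "continuous_on (K \<times> {0..T'}) (\<lambda>q. (\<lambda>(z, t). harnack_quantity c z t) (snd c (fst q), snd q))"
    proof (rule continuous_on_compose2[OF harnack_quantity_continuous[OF c(1)]])
      show "continuous_on (K \<times> {0..T'}) (\<lambda>q. (snd c (fst q), snd q))"
        by (intro continuous_on_Pair continuous_on_compose2[OF cs] continuous_on_fst continuous_on_snd
            continuous_on_id) auto
      show "(\<lambda>q. (snd c (fst q), snd q)) ` (K \<times> {0..T'}) \<subseteq> chart_image c \<times> I"
        using c T' by (auto simp: chart_image_def)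
    qed
    then have "continuous_on (K \<times> {0..T'}) (\<lambda>q. E c (fst q) (snd q))"
      unfolding E_def
      by (intro continuous_on_mult continuous_on_snd continuous_on_id) simp
    moreover have "compact (K \<times> {0..T'})" "K \<times> {0..T'} \<noteq> {}"
      using c cK T' by (auto intro: compact_Times)
    ultimately have "\<exists>q\<in>K \<times> {0..T'}. \<forall>r\<in>K \<times> {0..T'}. E c (fst r) (snd r) \<le> E c (fst q) (snd q)"
      by (intro continuous_attains_sup)
    then show ?thesis unfolding cK by fastforce
  qed
  then obtain q where q: "\<And>p. p \<in> S' \<Longrightarrow> fst (q p) \<in> snd p \<and> snd (q p) \<in> {0..T'} \<and>
      (\<forall>y\<in>snd p. \<forall>s\<in>{0..T'}. E (fst p) y s \<le> E (fst p) (fst (q p)) (snd (q p)))"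
    by metis
  \<comment> \<open>The maximum on each piece; the largest of these finitely many is selected
    next.\<close>
  define m where "m p = E (fst p) (fst (q p)) (snd (q p))" for p
  obtain p where p: "p \<in> S'" "\<And>r. r \<in> S' \<Longrightarrow> m r \<le> m p"
    using Max_in[of "m ` S'"] Max_ge[of "m ` S'"] S' by (metis (no_types, lifting) finite_imageI image_iff image_is_empty)
  show ?thesis
  proof (rule that)
    show "(fst p, snd p) \<in> S" "fst (q p) \<in> snd p" "snd (q p) \<in> {0..T'}"
      using p(1) q[OF p(1)] by (auto simp: S'_def)
    fix d y s assume d: "d \<in> A" "y \<in> fst d" and s: "s \<in> {0..T'}"
    obtain c K where cK: "(c, K) \<in> S" "y \<in> K" using S(3) by blast
    have c: "c \<in> A" "y \<in> fst c" using S(2)[OF cK(1)] cK(2) by auto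
    have cS': "(c, K) \<in> S'" using cK by (auto simp: S'_def)
    have "s * harnack_quantity d (snd d y) s = E c y s"
      unfolding E_def using harnack_quantity_invariant[OF d c, of s] s T' by simp
    also have "\<dots> \<le> m (c, K)" using q[OF cS'] cK(2) s unfolding m_def by simp
    also have "\<dots> \<le> m p" by (rule p(2)[OF cS'])
    finally show "s * harnack_quantity d (snd d y) s
        \<le> snd (q p) * harnack_quantity (fst p) (snd (fst p) (fst (q p))) (snd (q p))"
      unfolding m_def E_def .
  qed
qed

text \<open>The maximum is taken over \<open>[0, t]\<close> for the very time \<open>t\<close> in
  question, so that \<open>s \<le> t\<close> lets \<open>B * (1 + s)\<close> be replaced by
  \<open>B * (1 + t)\<close>. As \<open>t < T\<close>, a positive \<open>s\<close> is interior to
  the time interval even when it is the last time considered.\<close>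

lemma gradient_estimate:
  assumes mu: "\<mu> > 0" "\<And>c K x \<xi>. (c, K) \<in> S \<Longrightarrow> x \<in> K \<Longrightarrow> \<mu> * (norm \<xi>)\<^sup>2 \<le> covector_norm2 (g c x) \<xi>"
    and B: "growth_const (lam * \<mu> / 4) (li_yau_error (real DIM(complex ^ 'n)) (2 * (real CARD('n))\<^sup>2 * N + 1)) B"
    and c: "c \<in> A" "x \<in> fst c" and t: "0 < t" "t < T"
  shows "harnack_quantity c (snd c x) t \<le> B * (1 / t + 1)"
proof -
  define b where "b = 2 * (real CARD('n))\<^sup>2 * N + 1"
  have b: "b \<ge> 1" using N by (simp add: b_def)
  have l: "lam * \<mu> / 4 > 0" using lam mu by simp
  have B0: "B \<ge> 0" using B by (simp add: growth_const_def)
  obtain d K y s where dK: "(d, K) \<in> S" "y \<in> K" "s \<in> {0..t}" and max: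
    "\<And>e w r. e \<in> A \<Longrightarrow> w \<in> fst e \<Longrightarrow> r \<in> {0..t} \<Longrightarrow>
      r * harnack_quantity e (snd e w) r \<le> s * harnack_quantity d (snd d y) s"
    using harnack_quantity_maximum[of t] t by (metis less_imp_le)
  define z where "z = snd d y"
  have d: "d \<in> A" "y \<in> fst d" using cover dK unfolding norm_cover_def by auto
  have z: "z \<in> chart_image d" unfolding z_def by (rule chart(5)[OF d])
  have bound: "s * harnack_quantity d z s \<le> B * (1 + t)"
  \<comment> \<open>A nonpositive maximum is harmless as \<open>B \<ge> 0\<close>; this also
    disposes of \<open>s = 0\<close>, where the pointwise estimate says nothing.\<close>
  proof (cases "0 < s \<and> 0 < harnack_quantity d z s")
    case False
    then have "s * harnack_quantity d z s \<le> 0"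
      using dK(3) by (auto simp: mult_le_0_iff)
    also have "0 \<le> B * (1 + t)" using B0 t by simp
    finally show ?thesis .
  next
    case True
    have s: "s \<in> I" using dK(3) t by auto
    have "harnack_quantity d z s \<le> B * (1 / s + 1)"
    proof (rule space_time.li_yau_at_maximum[OF space_time_chart[OF d(1)] l b B[folded b_def],
          of "coef d" "drift d" "zeroth d" "log_u d"])
      show "C_class 2 1 (chart_image d) I (coef d i j)" for i j
        using C_class_mono[OF regularity(1)[OF d(1)], of 2 1] by simp
      show "C_class 1 1 (chart_image d) I (drift d i)" "C_class 1 1 (chart_image d) I (zeroth d)"
        "C_class 3 2 (chart_image d) I (log_u d)" for i
        by (rule regularity[OF d(1)])+
      show "coef d i j y s = coef d j i y s" for i j y s
        unfolding coef_def by (rule real_coef_sym)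
      show "s \<in> interior I" "0 < s" using True dK(3) t by auto
      show "lam * \<mu> / 4 * (\<Sum>i\<in>Basis. (p i)\<^sup>2) \<le> quad Basis (\<lambda>i j. coef d i j z s) p" for p
        unfolding z_def by (rule quad_coef_lower[OF d s mu(2)[OF dK(1,2)]])
      show "harnack_quantity d w r = quad Basis (\<lambda>i j. coef d i j w r) (\<lambda>i. d_space i (log_u d) w r)
          - 2 * d_time I (log_u d) w r" for w r
        by (rule harnack_quantity_def)
      show "harnack_quantity d w s \<le> harnack_quantity d z s" if "w \<in> chart_image d" for w
      proof -
        have "s * harnack_quantity d w s \<le> s * harnack_quantity d z s"
          using max[OF d(1) chart(7)[OF d(1) that] dK(3)] chart(6)[OF d(1) that] by (simp add: z_def)
        then show ?thesis using True by simp
      qed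
      show "r * harnack_quantity d z r \<le> s * harnack_quantity d z s" if "r \<in> I" "r \<le> s" for r
        using max[OF d, of r] that dK(3) by (simp add: z_def)
    qed (use True z log_eq[OF d(1)] coefficient_bounds[OF dK(1,2) s] in \<open>simp_all add: z_def b_def\<close>)
    then have "s * harnack_quantity d z s \<le> s * (B * (1 / s + 1))"
      using True by simp
    also have "\<dots> = B * (1 + s)" using True by (simp add: field_simps)
    also have "\<dots> \<le> B * (1 + t)" using B0 dK(3) by (intro mult_left_mono) auto
    finally show ?thesis .
  qed
  have "t * harnack_quantity c (snd c x) t \<le> B * (1 + t)"
    using max[OF c, of t] t bound by (simp add: z_def)
  also have "\<dots> = t * (B * (1 / t + 1))" using t by (simp add: field_simps)
  finally show "harnack_quantity c (snd c x) t \<le> B * (1 / t + 1)"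
    using t by simp
qed

end

section \<open>Harnack chains\<close>

text \<open>Both arguments move, so joint differentiability in space and time is needed. It comes
  from \<open>has_derivative_from_partials\<close> on the product space, whose basis consists of the
  vectors \<open>(b, 0)\<close> and of \<open>(0, 1)\<close>.\<close>

lemma (in space_time) C_deriv_path:
  fixes f :: "'e \<Rightarrow> real \<Rightarrow> real"
  assumes f: "C 1 0 f" "C 0 1 f" and z: "z + (\<tau> - s) *\<^sub>R w \<in> D" and \<tau>: "\<tau> \<in> interior I"
  shows "((\<lambda>\<tau>. f (z + (\<tau> - s) *\<^sub>R w) \<tau>) has_real_derivative
    (\<Sum>b\<in>Basis. (w \<bullet> b) * d_space b f (z + (\<tau> - s) *\<^sub>R w) \<tau>) + d_time I f (z + (\<tau> - s) *\<^sub>R w) \<tau>) (at \<tau>)"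
proof -
  define W where "W = D \<times> interior I"
  define h where "h = (\<lambda>p. f (fst p) (snd p))"
  define k where "k b p = (if snd b = 0 then d_space (fst b) f (fst p) (snd p) else d_time I f (fst p) (snd p))"
    for b :: "'e \<times> real" and p
  have B: "(Basis :: ('e \<times> real) set) = (\<lambda>b. (b, 0)) ` Basis \<union> {(0, 1)}"
    by (auto simp: Basis_prod_def)
  have IW: "interior I \<subseteq> I" by (rule interior_subset)
  have der: "((\<lambda>s. h (p + s *\<^sub>R b)) has_real_derivative k b p) (at 0)" if p: "p \<in> W" and b: "b \<in> Basis" for p b
  proof -
    have pD: "fst p \<in> D" "snd p \<in> interior I" "snd p \<in> I" using p IW by (auto simp: W_def)
    consider e where "e \<in> Basis" "b = (e, 0)" | "b = (0, 1)" using b B by auto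
    then show ?thesis
    proof cases
      case 1
      then show ?thesis
        using C_deriv_line[OF f(1) 1(1), of "fst p" 0 "snd p"] pD by (simp add: h_def k_def)
    next
      case 2
      have "(f (fst p) has_real_derivative d_time I f (fst p) (snd p)) (at (snd p))"
        by (rule C_deriv_time[OF f(2) pD(1,2)])
      then have "((\<lambda>s. f (fst p) (s + snd p)) has_real_derivative d_time I f (fst p) (snd p)) (at 0)"
        using DERIV_shift[of "f (fst p)" "d_time I f (fst p) (snd p)" 0 "snd p"] by simp
      then show ?thesis
        using 2 by (simp add: h_def k_def add.commute)
    qed
  qed
  have cont: "continuous_on W (k b)" if b: "b \<in> Basis" for b
  proof -
    have *: "continuous_on W (\<lambda>p. q (fst p) (snd p))" if "C 0 0 q" for q :: "'e \<Rightarrow> real \<Rightarrow> real"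
      using continuous_on_subset[OF C_class_continuous[OF that], of W] IW
      by (auto simp: W_def case_prod_unfold)
    consider e where "e \<in> Basis" "b = (e, 0)" | "b = (0, 1)" using b B by auto
    then show ?thesis
    proof cases
      case 1
      then show ?thesis
        using *[OF C_class_space[of 0 0 D I f e]] f by (simp add: k_def)
    next
      case 2
      then show ?thesis
        using *[OF C_class_time[of 0 0 D I f]] f by (simp add: k_def)
    qed
  qed
  define p where "p = (z + (\<tau> - s) *\<^sub>R w, \<tau>)"
  have "open W" "p \<in> W"
    using open_D z \<tau> by (auto simp: W_def p_def intro: open_Times)
  from has_derivative_from_partials[OF this der cont]
  have "(h has_derivative (\<lambda>v. \<Sum>b\<in>Basis. (v \<bullet> b) * k b p)) (at (z + (\<tau> - s) *\<^sub>R w, \<tau>))"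
    unfolding p_def by blast
  moreover have "((\<lambda>\<tau>. (z + (\<tau> - s) *\<^sub>R w, \<tau>)) has_derivative (\<lambda>r. (r *\<^sub>R w, r))) (at \<tau>)"
    by (auto intro!: derivative_eq_intros)
  ultimately have "((\<lambda>\<tau>. h (z + (\<tau> - s) *\<^sub>R w, \<tau>)) has_derivative
      (\<lambda>r. \<Sum>b\<in>Basis. ((r *\<^sub>R w, r) \<bullet> b) * k b p)) (at \<tau>)"
    by (rule has_derivative_compose[rotated])
  moreover have "(\<Sum>b\<in>Basis. ((r *\<^sub>R w, r) \<bullet> b) * k b p) =
      ((\<Sum>b\<in>Basis. (w \<bullet> b) * d_space b f (z + (\<tau> - s) *\<^sub>R w) \<tau>) + d_time I f (z + (\<tau> - s) *\<^sub>R w) \<tau>) * r" for r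
  proof -
    have "(\<Sum>b\<in>Basis. ((r *\<^sub>R w, r) \<bullet> b) * k b p)
        = (\<Sum>b\<in>(\<lambda>b. (b, 0 :: real)) ` (Basis :: 'e set). ((r *\<^sub>R w, r) \<bullet> b) * k b p) + r * d_time I f (fst p) (snd p)"
      unfolding B by (subst sum.union_disjoint) (auto simp: k_def)
    also have "(\<Sum>b\<in>(\<lambda>b. (b, 0 :: real)) ` (Basis :: 'e set). ((r *\<^sub>R w, r) \<bullet> b) * k b p)
        = (\<Sum>b\<in>Basis. (r *\<^sub>R w \<bullet> b) * d_space b f (fst p) (snd p))"
      by (subst sum.reindex) (auto simp: inj_on_def k_def)
    finally show ?thesis
      by (simp add: p_def algebra_simps sum_distrib_left)
  qed
  ultimately show ?thesis
    by (simp add: has_field_derivative_def h_def)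
qed

text \<open>Quantified over all pairs of times, so that a chain of points is free to choose its
  intermediate times.\<close>

definition harnack_bound :: "('a \<Rightarrow> real \<Rightarrow> real) \<Rightarrow> real \<Rightarrow> real \<Rightarrow> real \<Rightarrow> real \<Rightarrow> 'a \<Rightarrow> 'a \<Rightarrow> bool" where
  "harnack_bound u T C1 C2 C3 x y \<longleftrightarrow> (\<forall>s s'. 0 < s \<longrightarrow> s < s' \<longrightarrow> s' < T \<longrightarrow>
     u x s \<le> ((s' / s) powr C2 * exp (C3 / (s' - s) + C1 * (s' - s))) * u y s')"

lemma harnack_boundD:
  assumes "harnack_bound u T C1 C2 C3 x y" "0 < s" "s < s'" "s' < T"
  shows "u x s \<le> ((s' / s) powr C2 * exp (C3 / (s' - s) + C1 * (s' - s))) * u y s'"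
  using assms unfolding harnack_bound_def by blast

lemma harnack_bound_mono:
  assumes "harnack_bound u T C1 C2 C3 x y" "C3 \<le> C3'" "\<And>t. t \<in> {0..<T} \<Longrightarrow> 0 < u y t"
  shows "harnack_bound u T C1 C2 C3' x y"
  unfolding harnack_bound_def
proof (intro allI impI)
  fix s s' :: real assume s: "0 < s" "s < s'" "s' < T"
  note harnack_boundD[OF assms(1) s]
  also have "((s' / s) powr C2 * exp (C3 / (s' - s) + C1 * (s' - s))) * u y s'
      \<le> ((s' / s) powr C2 * exp (C3' / (s' - s) + C1 * (s' - s))) * u y s'"
    using s assms(2) assms(3)[of s'] by (intro mult_right_mono mult_left_mono) (auto intro!: divide_right_mono)
  finally show "u x s \<le> \<dots>" .
qed

text \<open>With \<open>k + 1\<close> equal time steps the term \<open>C\<^sub>3 / (s' - s)\<close> picks up the factor \<open>(k + 1)\<^sup>2\<close>.\<close>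

lemma harnack_bound_chain:
  assumes R: "\<And>x y. (x, y) \<in> R \<Longrightarrow> harnack_bound u T C1 C2 C3 x y"
    and "(x, y) \<in> R ^^ Suc k"
  shows "harnack_bound u T C1 C2 ((real (Suc k))\<^sup>2 * C3) x y"
  using assms(2)
proof (induction k arbitrary: y)
  case 0
  then show ?case using R by simp
next
  case (Suc k)
  then obtain w where w: "(x, w) \<in> R ^^ Suc k" "(w, y) \<in> R" by auto
  show ?case
    unfolding harnack_bound_def
  proof (intro allI impI)
    fix s s' :: real assume s: "0 < s" "s < s'" "s' < T"
    define n where "n = real (Suc k)"
    \<comment> \<open>The first \<open>n\<close> links together get \<open>n\<close> of the
      \<open>n + 1\<close> equal time steps, the last link gets one.\<close>
    define d where "d = (s' - s) / (n + 1)"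
    define r where "r = s + n * d"
    have n: "n > 0" by (simp add: n_def)
    have d: "d > 0" using s n by (simp add: d_def)
    have "(n + 1) * d = s' - s" using n by (simp add: d_def)
    then have s'r: "s' = r + d" by (simp add: r_def algebra_simps)
    have rs: "r - s = n * d" "s' - r = d" "s' - s = (n + 1) * d"
      using s'r by (simp_all add: r_def algebra_simps)
    have r: "s < r" "r < s'" "0 < r" using s n d rs by (auto simp: r_def intro: add_pos_pos)
    have "u x s \<le> ((r / s) powr C2 * exp (n\<^sup>2 * C3 / (r - s) + C1 * (r - s))) * u w r"
      using harnack_boundD[OF Suc.IH[OF w(1)], of s r] s r by (simp add: n_def)
    also have "\<dots> \<le> ((r / s) powr C2 * exp (n\<^sup>2 * C3 / (r - s) + C1 * (r - s))) *
        (((s' / r) powr C2 * exp (C3 / (s' - r) + C1 * (s' - r))) * u y s')"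
      using harnack_boundD[OF R[OF w(2)], of r s'] s r by (intro mult_left_mono) auto
    also have "\<dots> = (((r / s) powr C2 * (s' / r) powr C2) * (exp (n\<^sup>2 * C3 / (r - s) + C1 * (r - s)) *
        exp (C3 / (s' - r) + C1 * (s' - r)))) * u y s'"
      by (simp add: mult_ac)
    \<comment> \<open>The time ratios telescope, so \<open>C2\<close> does not grow with the length
      of the chain.\<close>
    also have "(r / s) powr C2 * (s' / r) powr C2 = (s' / s) powr C2"
      using s r by (subst powr_mult[symmetric]) auto
    also have "exp (n\<^sup>2 * C3 / (r - s) + C1 * (r - s)) * exp (C3 / (s' - r) + C1 * (s' - r))
        = exp ((n + 1)\<^sup>2 * C3 / (s' - s) + C1 * (s' - s))"
    proof -
      have "n\<^sup>2 * C3 / (n * d) = n * C3 / d" "(n + 1)\<^sup>2 * C3 / ((n + 1) * d) = (n + 1) * C3 / d"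
        using n by (simp_all add: power2_eq_square)
      then show ?thesis
        unfolding exp_add[symmetric] rs by (simp add: algebra_simps add_divide_distrib)
    qed
    also have "n + 1 = real (Suc (Suc k))" by (simp add: n_def)
    finally show "u x s \<le> ((s' / s) powr C2 *
        exp ((real (Suc (Suc k)))\<^sup>2 * C3 / (s' - s) + C1 * (s' - s))) * u y s'" .
  qed
qed

text \<open>The points reachable from \<open>x0\<close> form an open set with open complement, hence
  everything. As \<open>R\<close> is reflexive, the sets \<open>W k\<close> increase with
  \<open>k\<close>, and compactness gives one length for all points. Since \<open>R\<close> is
  symmetric, any two points are joined through \<open>x0\<close>.\<close>

lemma uniform_chain:
  fixes \<V> :: "'a::topological_space set set"
  assumes compact: "compact (UNIV :: 'a set)" and conn: "connected (UNIV :: 'a set)"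
    and V: "\<And>V. V \<in> \<V> \<Longrightarrow> open V" "\<Union>\<V> = UNIV"
  defines "R \<equiv> {(x, y). \<exists>V\<in>\<V>. x \<in> V \<and> y \<in> V}"
  shows "\<exists>k. \<forall>x y. (x, y) \<in> R ^^ Suc k"
proof -
  define x0 :: 'a where "x0 = undefined"
  define W where "W k = {y. (x0, y) \<in> R ^^ Suc k}" for k
  have inV: "\<exists>V\<in>\<V>. y \<in> V" for y using V(2) by blast
  have refl: "(y, y) \<in> R" for y using inV by (auto simp: R_def)
  have Wstep: "y \<in> W (Suc k)" if "w \<in> W k" "(w, y) \<in> R" for w y k
    using that by (auto simp: W_def)
  have Wopen: "open (W k)" for k
  proof (subst open_subopen, intro ballI)
    fix y assume "y \<in> W k"
    then obtain w V where w: "(x0, w) \<in> R ^^ k" "V \<in> \<V>" "w \<in> V" "y \<in> V" by (auto simp: W_def R_def)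
    then have "V \<subseteq> W k" by (auto simp: W_def R_def)
    then show "\<exists>V. open V \<and> y \<in> V \<and> V \<subseteq> W k" using w V(1) by blast
  qed
  have "open (- (\<Union>k. W k))"
  proof (subst open_subopen, intro ballI)
    fix y assume y: "y \<in> - (\<Union>k. W k)"
    obtain V where v: "V \<in> \<V>" "y \<in> V" using inV by blast
    have "V \<subseteq> - (\<Union>k. W k)"
    proof
      fix w assume "w \<in> V"
      then have "(w, y) \<in> R" using v by (auto simp: R_def)
      then show "w \<in> - (\<Union>k. W k)" using Wstep y by blast
    qed
    then show "\<exists>V. open V \<and> y \<in> V \<and> V \<subseteq> - (\<Union>k. W k)" using v V(1) by blast
  qed
  moreover have "open (\<Union>k. W k)" using Wopen by blast
  moreover have "x0 \<in> (\<Union>k. W k)" using refl[of x0] by (auto simp: W_def intro!: exI[of _ 0])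
  ultimately have "(\<Union>k. W k) = UNIV"
    using connectedD[OF conn, of "\<Union>k. W k" "- (\<Union>k. W k)"] by auto
  then have cover: "UNIV \<subseteq> (\<Union>k\<in>UNIV. W k)" by simp
  obtain F where F: "finite F" "UNIV \<subseteq> (\<Union>k\<in>F. W k)"
    by (rule compactE_image[OF compact Wopen cover])
  have Wmono: "W i \<subseteq> W j" if "i \<le> j" for i j
    using that by (induction rule: dec_induct) (use Wstep refl in blast)+
  define n where "n = Max F"
  have all: "y \<in> W n" for y
  proof -
    obtain k where "k \<in> F" "y \<in> W k" using F(2) by blast
    then show ?thesis using Wmono[of k n] F(1) by (auto simp: n_def)
  qed
  have sym: "(y, x) \<in> R ^^ m" if "(x, y) \<in> R ^^ m" for x y m
    using that
  proof (induction m arbitrary: y)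
    case (Suc m)
    then obtain w where "(x, w) \<in> R ^^ m" "(w, y) \<in> R" by auto
    then have "(w, x) \<in> R ^^ m" "(y, w) \<in> R" using Suc.IH by (auto simp: R_def)
    then show ?case by (rule relpow_Suc_I2[rotated])
  qed simp
  \<comment> \<open>In to \<open>x0\<close> and out again; the total length is a successor, as
    \<open>harnack_bound_chain\<close> wants it.\<close>
  have "(x, y) \<in> R ^^ (Suc n + Suc n)" for x y
    using sym[of x0 x "Suc n"] all[of x] all[of y] unfolding W_def relpow_add by blast
  then show ?thesis
    by (intro exI[of _ "n + Suc n"]) simp
qed

context parabolic_solution
begin

text \<open>The hypothesis on \<open>P\<close> says that twice the time derivative of
  \<open>f\<close> is at least \<open>Q - B * (1 / t + 1)\<close>. Half of \<open>Q\<close> pays for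
  the motion in space. What remains integrates explicitly: \<open>B / 2 * (1 / t)\<close> to the
  power of \<open>s' / s\<close>, the constant \<open>B / 2\<close> to the linear term in the
  exponent, and the squared speed to the term with \<open>C3\<close>.\<close>

lemma local_harnack:
  assumes c: "c \<in> A" and K: "convex K" "K \<subseteq> chart_image c" "z1 \<in> K" "z2 \<in> K" "dist z1 z2 \<le> r"
    and mu: "\<mu> > 0" "\<And>z \<xi>. z \<in> K \<Longrightarrow> \<mu> * (norm \<xi>)\<^sup>2 \<le> covector_norm2 (g c (chart_inv c z)) \<xi>"
    and B: "\<And>z t. z \<in> K \<Longrightarrow> 0 < t \<Longrightarrow> t < T \<Longrightarrow> harnack_quantity c z t \<le> B * (1 / t + 1)"
  shows "harnack_bound u T (B / 2) (B / 2) (2 * r\<^sup>2 / (lam * \<mu>)) (chart_inv c z1) (chart_inv c z2)"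
  unfolding harnack_bound_def
proof (intro allI impI)
  fix s s' :: real assume s: "0 < s" "s < s'" "s' < T"
  interpret space_time "chart_image c" I by (rule space_time_chart[OF c])
  define l where "l = lam * \<mu> / 4"
  have l: "l > 0" using lam mu by (simp add: l_def)
  define w where "w = (1 / (s' - s)) *\<^sub>R (z2 - z1)"
  define z where "z \<tau> = z1 + (\<tau> - s) *\<^sub>R w" for \<tau>
  define f where "f = log_u c"
  have z_ends: "z s = z1" "z s' = z2" using s by (simp_all add: z_def w_def)
  have zK: "z \<tau> \<in> K" if "s \<le> \<tau>" "\<tau> \<le> s'" for \<tau>
  proof -
    define \<theta> where "\<theta> = (\<tau> - s) / (s' - s)"
    have \<theta>: "0 \<le> 1 - \<theta>" "0 \<le> \<theta>" using that s by (simp_all add: \<theta>_def)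
    have "z \<tau> = z1 + \<theta> *\<^sub>R (z2 - z1)"
      by (simp add: z_def w_def \<theta>_def)
    also have "\<dots> = (1 - \<theta>) *\<^sub>R z1 + \<theta> *\<^sub>R z2" by (simp add: algebra_simps)
    also have "\<dots> \<in> K" by (rule convexD[OF K(1,3,4) \<theta>]) simp
    finally show ?thesis .
  qed
  have f01: "C 1 0 f" "C 0 1 f"
    using C_class_mono[OF regularity(4)[OF c], of 1 0] C_class_mono[OF regularity(4)[OF c], of 0 1]
    by (simp_all add: f_def)
  \<comment> \<open>The loss per unit of time in Young's inequality at constant velocity
    \<open>w\<close>, when \<open>l / 2\<close> times the squared gradient is available.\<close>
  define a where "a = (norm w)\<^sup>2 / (2 * l)"
  \<comment> \<open>\<open>f\<close> along the path plus an antiderivative of all that may be lost;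
    monotonicity of \<open>H\<close> is the integrated inequality.\<close>
  define H where "H \<tau> = f (z \<tau>) \<tau> + a * \<tau> + B / 2 * (ln \<tau> + \<tau>)" for \<tau>
  have "H s \<le> H s'"
  proof (rule DERIV_nonneg_imp_nondecreasing[of s s' H])
    fix \<tau> assume \<tau>: "s \<le> \<tau>" "\<tau> \<le> s'"
    have \<tau>': "\<tau> \<in> interior I" "\<tau> \<in> I" "0 < \<tau>" "\<tau> < T" using \<tau> s by auto
    have zD: "z \<tau> \<in> chart_image c" using zK[OF \<tau>] K by blast
    define S where "S = (\<Sum>b\<in>Basis. (w \<bullet> b) * d_space b f (z \<tau>) \<tau>)"
    define q where "q = d_time I f (z \<tau>) \<tau>"
    have "((\<lambda>\<tau>. f (z \<tau>) \<tau>) has_real_derivative S + q) (at \<tau>)"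
      unfolding S_def q_def z_def by (rule C_deriv_path[OF f01 zD[unfolded z_def] \<tau>'(1)])
    moreover have "((\<lambda>\<tau>. a * \<tau>) has_real_derivative a) (at \<tau>)"
      by (rule DERIV_cmult_Id)
    moreover have "((\<lambda>\<tau>. B / 2 * (ln \<tau> + \<tau>)) has_real_derivative B / 2 * (1 / \<tau> + 1)) (at \<tau>)"
      by (intro DERIV_cmult DERIV_add DERIV_ln_divide DERIV_ident \<tau>'(3))
    ultimately have dH: "(H has_real_derivative S + q + a + B / 2 * (1 / \<tau> + 1)) (at \<tau>)"
      unfolding H_def by (intro DERIV_add)
    have "l * (\<Sum>b\<in>Basis. (d_space b f (z \<tau>) \<tau>)\<^sup>2) \<le> quad Basis (\<lambda>v w. coef c v w (z \<tau>) \<tau>) (\<lambda>v. d_space v f (z \<tau>) \<tau>)"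
      using quad_coef_lower[OF c chart(7)[OF c zD] \<tau>'(2) mu(2)[OF zK[OF \<tau>]]] chart(6)[OF c zD]
      by (simp add: l_def)
    also have "\<dots> = harnack_quantity c (z \<tau>) \<tau> + 2 * q"
      by (simp add: harnack_quantity_def f_def q_def)
    also have "\<dots> \<le> B * (1 / \<tau> + 1) + 2 * q"
      using B[OF zK[OF \<tau>] \<tau>'(3,4)] by simp
    finally have q: "l / 2 * (\<Sum>b\<in>Basis. (d_space b f (z \<tau>) \<tau>)\<^sup>2) \<le> B / 2 * (1 / \<tau> + 1) + q"
      by simp
    have "0 \<le> (w \<bullet> b) * y + (w \<bullet> b)\<^sup>2 / (2 * l) + l / 2 * y\<^sup>2" for b y
    proof -
      have "0 \<le> ((w \<bullet> b) + l * y)\<^sup>2 / (2 * l)" using l by simp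
      also have "\<dots> = (w \<bullet> b) * y + (w \<bullet> b)\<^sup>2 / (2 * l) + l / 2 * y\<^sup>2"
        using l by (simp add: field_simps power2_eq_square)
      finally show ?thesis .
    qed
    then have "0 \<le> (\<Sum>b\<in>Basis. (w \<bullet> b) * d_space b f (z \<tau>) \<tau> + (w \<bullet> b)\<^sup>2 / (2 * l) + l / 2 * (d_space b f (z \<tau>) \<tau>)\<^sup>2)"
      by (intro sum_nonneg)
    also have "\<dots> = S + (\<Sum>b\<in>Basis. (w \<bullet> b)\<^sup>2) / (2 * l) + l / 2 * (\<Sum>b\<in>Basis. (d_space b f (z \<tau>) \<tau>)\<^sup>2)"
      by (simp add: S_def sum.distrib sum_divide_distrib sum_distrib_left)
    also have "(\<Sum>b\<in>Basis. (w \<bullet> b)\<^sup>2) = (norm w)\<^sup>2"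
      unfolding power2_norm_eq_inner euclidean_inner[of w w] by (simp add: power2_eq_square)
    finally have "0 \<le> S + q + a + B / 2 * (1 / \<tau> + 1)"
      using q unfolding a_def by linarith
    then show "\<exists>y. (H has_real_derivative y) (at \<tau>) \<and> 0 \<le> y" using dH by blast
  qed (use s in simp)
  then have "f z1 s \<le> f z2 s' + a * (s' - s) + B / 2 * (ln s' - ln s) + B / 2 * (s' - s)"
    unfolding H_def z_ends by (simp add: algebra_simps add_divide_distrib diff_divide_distrib)
  \<comment> \<open>At constant speed the total loss is a multiple of squared distance over elapsed
    time, which is the origin of \<open>C3\<close>.\<close>
  moreover have "a * (s' - s) \<le> 2 * r\<^sup>2 / (lam * \<mu>) / (s' - s)"
  proof -
    have "a * (s' - s) = (dist z1 z2)\<^sup>2 / (2 * l) / (s' - s)"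
      using s by (simp add: a_def w_def dist_norm norm_minus_commute power_divide power2_eq_square)
    also have "\<dots> \<le> r\<^sup>2 / (2 * l) / (s' - s)"
      using K(5) s l by (intro divide_right_mono power_mono) auto
    also have "\<dots> = 2 * r\<^sup>2 / (lam * \<mu>) / (s' - s)" by (simp add: l_def mult.commute)
    finally show ?thesis .
  qed
  moreover have "ln s' - ln s = ln (s' / s)" using s by (simp add: ln_div)
  ultimately have "f z1 s \<le> (B / 2 * ln (s' / s)
      + (2 * r\<^sup>2 / (lam * \<mu>) / (s' - s) + B / 2 * (s' - s))) + f z2 s'"
    by simp
  then have "exp (f z1 s) \<le> exp ((B / 2 * ln (s' / s)
      + (2 * r\<^sup>2 / (lam * \<mu>) / (s' - s) + B / 2 * (s' - s))) + f z2 s')"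
    by simp
  then show "u (chart_inv c z1) s \<le> ((s' / s) powr (B / 2) *
      exp (2 * r\<^sup>2 / (lam * \<mu>) / (s' - s) + B / 2 * (s' - s))) * u (chart_inv c z2) s'"
    using s pos[of s "chart_inv c z1"] pos[of s' "chart_inv c z2"]
    by (simp add: exp_add powr_def f_def log_u_def local_rep_def)
qed

end

section \<open>Constants independent of the solution\<close>

text \<open>\<open>V\<close> and \<open>C3\<close> come from a coordinate ball, the metric and
  \<open>lam\<close> alone. They are fixed before any solution is mentioned, so one finite cover by
  such sets serves all solutions.\<close>

lemma local_harnack_neighbourhood:
  fixes A :: "('a::t2_space, 'n::finite) chart set"
  assumes M: "compact_hermitian_manifold A g" and lam: "lam > 0"
  obtains V C3 where "open V" "x \<in> V"
    "\<And>S Lam T N G chi chibar chi0 u B y y'. parabolic_solution A g S lam Lam T N G chi chibar chi0 u \<Longrightarrow>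
      (\<And>c x t. c \<in> A \<Longrightarrow> x \<in> fst c \<Longrightarrow> 0 < t \<Longrightarrow> t < T \<Longrightarrow>
        parabolic_solution.harnack_quantity T G u c (snd c x) t \<le> B * (1 / t + 1)) \<Longrightarrow>
      y \<in> V \<Longrightarrow> y' \<in> V \<Longrightarrow> harnack_bound u T (B / 2) (B / 2) C3 y y'"
proof -
  have atlas: "holomorphic_atlas A" and metric: "hermitian_metric A g"
    using M by (auto simp: compact_hermitian_manifold_def)
  obtain c where c: "c \<in> A" "x \<in> fst c"
    using atlas unfolding holomorphic_atlas_def by blast
  have op: "open (fst c)" "open (chart_image c)"
    and hom: "homeomorphism (fst c) (chart_image c) (snd c) (chart_inv c)"
    using atlas c unfolding holomorphic_atlas_def is_chart_def by blast+
  have inv: "chart_inv c (snd c y) = y" if "y \<in> fst c" for y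
    using hom that by (simp add: homeomorphism_def)
  have inv': "snd c (chart_inv c z) = z" if "z \<in> chart_image c" for z
    using hom that by (simp add: homeomorphism_def)
  have "snd c x \<in> chart_image c" using c by (auto simp: chart_image_def)
  then obtain e where e: "e > 0" "cball (snd c x) e \<subseteq> chart_image c"
    using op(2) open_contains_cball by blast
  define K where "K = cball (snd c x) e"
  define V where "V = fst c \<inter> snd c -` ball (snd c x) e"
  have K: "compact (chart_inv c ` K)" "chart_inv c ` K \<subseteq> fst c"
  proof -
    show "compact (chart_inv c ` K)"
      unfolding K_def
      by (rule compact_continuous_image[OF continuous_on_subset[OF homeomorphism_cont2[OF hom] e(2)] compact_cball])
    show "chart_inv c ` K \<subseteq> fst c"
      using e(2) homeomorphism_image2[OF hom] unfolding K_def by blast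
  qed
  obtain \<mu> where mu: "\<mu> > 0"
    "\<And>y \<xi>. y \<in> chart_inv c ` K \<Longrightarrow> \<mu> * (norm \<xi>)\<^sup>2 \<le> covector_norm2 (g c y) \<xi>"
    using covector_norm2_uniform[OF atlas metric c(1) K] by blast
  show ?thesis
  proof (rule that[of V "2 * (2 * e)\<^sup>2 / (lam * \<mu>)"])
    show "open V"
      unfolding V_def by (rule continuous_open_preimage[OF homeomorphism_cont1[OF hom] op(1) open_ball])
    show "x \<in> V" using c e by (simp add: V_def)
    fix S Lam T N G chi chibar chi0 u B y y'
    assume sol: "parabolic_solution A g S lam Lam T N G chi chibar chi0 u"
      and est: "\<And>c x t. c \<in> A \<Longrightarrow> x \<in> fst c \<Longrightarrow> 0 < t \<Longrightarrow> t < T \<Longrightarrow>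
        parabolic_solution.harnack_quantity T G u c (snd c x) t \<le> B * (1 / t + 1)"
      and y: "y \<in> V" "y' \<in> V"
    interpret parabolic_solution A g S lam Lam T N G chi chibar chi0 u by (rule sol)
    have "harnack_bound u T (B / 2) (B / 2) (2 * (2 * e)\<^sup>2 / (lam * \<mu>))
        (chart_inv c (snd c y)) (chart_inv c (snd c y'))"
    proof (rule local_harnack[OF c(1), of K])
      show "convex K" "K \<subseteq> chart_image c" using e by (auto simp: K_def)
      show "snd c y \<in> K" "snd c y' \<in> K" using y by (auto simp: V_def K_def)
      show "dist (snd c y) (snd c y') \<le> 2 * e"
        using y dist_triangle2[of "snd c y" "snd c y'" "snd c x"] by (auto simp: V_def dist_commute)
      show "\<mu> * (norm \<xi>)\<^sup>2 \<le> covector_norm2 (g c (chart_inv c z)) \<xi>" if "z \<in> K" for z \<xi>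
        using mu(2) that by blast
      show "harnack_quantity c z t \<le> B * (1 / t + 1)" if "z \<in> K" "0 < t" "t < T" for z t
      proof -
        have "chart_inv c z \<in> fst c" "snd c (chart_inv c z) = z"
          using that K(2) inv' e(2) by (auto simp: K_def)
        then show ?thesis using est[OF c(1), of "chart_inv c z" t] that by simp
      qed
    qed (rule mu(1))
    then show "harnack_bound u T (B / 2) (B / 2) (2 * (2 * e)\<^sup>2 / (lam * \<mu>)) y y'"
      using y by (simp add: V_def inv)
  qed
qed

lemma uniform_ellipticity_on_cover:
  fixes A :: "('a::t2_space, 'n::finite) chart set"
  assumes "compact_hermitian_manifold A g" "norm_cover A S"
  obtains \<mu> where "\<mu> > 0"
    "\<And>c K x \<xi>. (c, K) \<in> S \<Longrightarrow> x \<in> K \<Longrightarrow> \<mu> * (norm \<xi>)\<^sup>2 \<le> covector_norm2 (g c x) \<xi>"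
proof -
  have atlas: "holomorphic_atlas A" and metric: "hermitian_metric A g"
    using assms(1) by (auto simp: compact_hermitian_manifold_def)
  have S: "finite S" "\<And>c K. (c, K) \<in> S \<Longrightarrow> c \<in> A \<and> compact K \<and> K \<subseteq> fst c"
    using assms(2) unfolding norm_cover_def by auto
  have "\<exists>\<mu>>0. \<forall>x\<in>snd p. \<forall>\<xi>. \<mu> * (norm \<xi>)\<^sup>2 \<le> covector_norm2 (g (fst p) x) \<xi>" if "p \<in> S" for p
    using covector_norm2_uniform[OF atlas metric, of "fst p" "snd p"] S(2)[of "fst p" "snd p"] that
    by (metis prod.collapse)
  then obtain m where m: "\<And>p. p \<in> S \<Longrightarrow> m p > 0"
    "\<And>p x \<xi>. p \<in> S \<Longrightarrow> x \<in> snd p \<Longrightarrow> m p * (norm \<xi>)\<^sup>2 \<le> covector_norm2 (g (fst p) x) \<xi>"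
    by metis
  \<comment> \<open>The inserted 1 spares a proof that \<open>S\<close> is nonempty.\<close>
  define \<mu> where "\<mu> = Min (insert 1 (m ` S))"
  show ?thesis
  proof (rule that)
    show "\<mu> > 0" using S(1) m(1) by (auto simp: \<mu>_def)
    fix c K x and \<xi> :: "complex ^ 'n" assume cK: "(c, K) \<in> S" "x \<in> K"
    have "\<mu> \<le> m (c, K)" using S(1) cK(1) by (auto simp: \<mu>_def)
    then have "\<mu> * (norm \<xi>)\<^sup>2 \<le> m (c, K) * (norm \<xi>)\<^sup>2" by (intro mult_right_mono) auto
    then show "\<mu> * (norm \<xi>)\<^sup>2 \<le> covector_norm2 (g c x) \<xi>" using m(2)[OF cK(1), of x \<xi>] cK(2) by simp
  qed
qed

text \<open>The order of the choices carries the dependence of the constants: \<open>\<mu>\<close>,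
  the neighbourhoods, the chain length and \<open>C3\<close> come from the background,
  \<open>B\<close> is a function of \<open>N\<close>, and only after that is a solution
  given.\<close>

lemma global_harnack:
  fixes A :: "('a::t2_space, 'n::finite) chart set"
  assumes M: "compact_hermitian_manifold A g" and S: "norm_cover A S" and lam: "0 < lam"
  obtains B :: "real \<Rightarrow> real" and C3 :: real where
    "\<And>Lam T N G chi chibar chi0 u x y. parabolic_solution A g S lam Lam T N G chi chibar chi0 u \<Longrightarrow>
      harnack_bound u T (B N) (B N) C3 x y"
proof -
  obtain \<mu> where mu: "\<mu> > 0"
    "\<And>c K x \<xi>. (c, K) \<in> S \<Longrightarrow> x \<in> K \<Longrightarrow> \<mu> * (norm \<xi>)\<^sup>2 \<le> covector_norm2 (g c x) \<xi>"
    using uniform_ellipticity_on_cover[OF M S] by blast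
  \<comment> \<open>The premise inside the existential lets \<open>B\<close> be chosen as a total
    function, arbitrary at negative \<open>N\<close>.\<close>
  have "\<exists>B. 0 \<le> N \<longrightarrow> growth_const (lam * \<mu> / 4) (li_yau_error (real DIM(complex ^ 'n)) (2 * (real CARD('n))\<^sup>2 * N + 1)) B" for N
  proof (cases "0 \<le> N")
    case True
    define b where "b = 2 * (real CARD('n))\<^sup>2 * N + 1"
    have "b > 0" using True by (simp add: b_def add_nonneg_pos)
    then have "li_yau_error (real DIM(complex ^ 'n)) b > 0"
      unfolding li_yau_error_def by (intro add_nonneg_pos add_nonneg_nonneg) auto
    then show ?thesis using growth_const_exists[of "lam * \<mu> / 4"] lam mu by (simp add: b_def)
  qed simp
  then obtain B where B: "\<And>N. 0 \<le> N \<Longrightarrow> growth_const (lam * \<mu> / 4)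
      (li_yau_error (real DIM(complex ^ 'n)) (2 * (real CARD('n))\<^sup>2 * N + 1)) (B N)"
    by metis
  have "\<exists>V C3. open V \<and> x \<in> V \<and> (\<forall>S Lam T N G chi chibar chi0 u B y y'.
      parabolic_solution A g S lam Lam T N G chi chibar chi0 u \<longrightarrow>
      (\<forall>c x t. c \<in> A \<longrightarrow> x \<in> fst c \<longrightarrow> 0 < t \<longrightarrow> t < T \<longrightarrow>
        parabolic_solution.harnack_quantity T G u c (snd c x) t \<le> B * (1 / t + 1)) \<longrightarrow>
      y \<in> V \<longrightarrow> y' \<in> V \<longrightarrow> harnack_bound u T (B / 2) (B / 2) C3 y y')" for x
    by (rule local_harnack_neighbourhood[OF M lam, of x]) blast
  then obtain V C3 where V: "\<And>x. open (V x)" "\<And>x. x \<in> V x"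
    and loc: "\<And>x S Lam T N G chi chibar chi0 u B y y'.
      parabolic_solution A g S lam Lam T N G chi chibar chi0 u \<Longrightarrow>
      (\<And>c x t. c \<in> A \<Longrightarrow> x \<in> fst c \<Longrightarrow> 0 < t \<Longrightarrow> t < T \<Longrightarrow>
        parabolic_solution.harnack_quantity T G u c (snd c x) t \<le> B * (1 / t + 1)) \<Longrightarrow>
      y \<in> V x \<Longrightarrow> y' \<in> V x \<Longrightarrow> harnack_bound u T (B / 2) (B / 2) (C3 x) y y'"
    by metis
  have cpt: "compact (UNIV :: 'a set)" and conn: "connected (UNIV :: 'a set)"
    using M by (auto simp: compact_hermitian_manifold_def)
  have cover: "UNIV \<subseteq> (\<Union>x\<in>UNIV. V x)" using V(2) by blast
  obtain X where X: "finite X" "UNIV \<subseteq> (\<Union>x\<in>X. V x)"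
    by (rule compactE_image[OF cpt V(1) cover]) simp_all
  define R where "R = {(x, y). \<exists>W\<in>V ` X. x \<in> W \<and> y \<in> W}"
  have "\<exists>k. \<forall>x y. (x, y) \<in> R ^^ Suc k"
    unfolding R_def by (rule uniform_chain[OF cpt conn]) (use V X in auto)
  then obtain k where k: "\<And>x y. (x, y) \<in> R ^^ Suc k" by blast
  define C where "C = Max (insert 0 (C3 ` X))"
  have C: "C3 x \<le> C" if "x \<in> X" for x using X(1) that by (simp add: C_def)
  show ?thesis
  proof (rule that)
    fix Lam T N G chi chibar chi0 u x y
    assume sol: "parabolic_solution A g S lam Lam T N G chi chibar chi0 u"
    interpret parabolic_solution A g S lam Lam T N G chi chibar chi0 u by (rule sol)
    have "harnack_bound u T (B N / 2) (B N / 2) C y y'" if yy: "(y, y') \<in> R" for y y'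
    proof -
      obtain x where x: "x \<in> X" "y \<in> V x" "y' \<in> V x" using yy by (auto simp: R_def)
      have "harnack_bound u T (B N / 2) (B N / 2) (C3 x) y y'"
        by (rule loc[OF sol gradient_estimate[OF mu B[OF N]] x(2,3)])
      then show ?thesis using C[OF x(1)] pos by (rule harnack_bound_mono)
    qed
    from harnack_bound_chain[OF this k]
    show "harnack_bound u T (B N / 2) (B N / 2) ((real (Suc k))\<^sup>2 * C) x y" .
  qed
qed

text \<open>The inequality holds for all pairs of points, so any single value at the later time
  bounds the supremum; divided by \<open>Q > 0\<close>, the supremum is in turn a lower bound of all
  these values.\<close>

lemma SUP_le_INF_of_harnack_bound:
  assumes H: "\<And>x y. harnack_bound u T C1 C2 C3 x y" and t: "0 < s" "s < t" "t < T"
  shows "(SUP x. u x s) \<le> ((t / s) powr C2 * exp (C3 / (t - s) + C1 * (t - s))) * (INF x. u x t)"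
proof -
  define Q where "Q = (t / s) powr C2 * exp (C3 / (t - s) + C1 * (t - s))"
  have Q: "Q > 0" using t by (simp add: Q_def)
  have le: "u x s \<le> Q * u y t" for x y
    using harnack_boundD[OF H t] by (simp add: Q_def)
  have "(SUP x. u x s) / Q \<le> u y t" for y
  proof -
    have "(SUP x. u x s) \<le> Q * u y t" by (rule cSUP_least) (use le in auto)
    then show ?thesis using Q by (simp add: field_simps)
  qed
  then have "(SUP x. u x s) / Q \<le> (INF x. u x t)" by (intro cINF_greatest) auto
  then show ?thesis using Q unfolding Q_def[symmetric] by (simp add: field_simps)
qed

theorem theorem7p2:
  fixes A :: "('a::t2_space, 'n::finite) chart set"
    and g :: "('a, 'n) chart \<Rightarrow> 'a \<Rightarrow> complex ^ 'n ^ 'n"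
    and S :: "(('a, 'n) chart \<times> 'a set) set"
    and lam Lam :: real
  assumes "compact_hermitian_manifold A g"
    and "norm_cover A S"
    and "0 < lam" and "0 < Lam"
  shows "\<exists>C\<^sub>1 C\<^sub>2 C\<^sub>3 :: ennreal \<Rightarrow> ennreal \<Rightarrow> ennreal \<Rightarrow> ennreal \<Rightarrow> real.
    \<forall>(T :: real)
      (G :: ('a, 'n) chart \<Rightarrow> 'a \<Rightarrow> real \<Rightarrow> complex ^ 'n ^ 'n)
      (chi :: ('a, 'n) chart \<Rightarrow> 'a \<Rightarrow> real \<Rightarrow> complex ^ 'n)
      (chibar :: ('a, 'n) chart \<Rightarrow> 'a \<Rightarrow> real \<Rightarrow> complex ^ 'n)
      (chi0 :: 'a \<Rightarrow> real \<Rightarrow> complex)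
      (u :: 'a \<Rightarrow> real \<Rightarrow> real).
    let I = {0..<T};
        N_G = field_norm S 3 1 I G;
        N_chi0 = field_norm S 1 1 I (\<lambda>c. chi0);
        N_chi = field_norm S 1 1 I chi;
        N_chibar = field_norm S 1 1 I chibar;
        c\<^sub>1 = C\<^sub>1 N_G N_chi0 N_chi N_chibar;
        c\<^sub>2 = C\<^sub>2 N_G N_chi0 N_chi N_chibar;
        c\<^sub>3 = C\<^sub>3 N_G N_chi0 N_chi N_chibar
    in
      0 < T \<longrightarrow>
      contravariant_11 A I G \<longrightarrow> field_C A 3 1 I G \<longrightarrow> N_G < \<infinity> \<longrightarrow>
      uniformly_elliptic A g I lam Lam G \<longrightarrow>
      vector_field_10 A I chi \<longrightarrow> field_C A 1 1 I chi \<longrightarrow> N_chi < \<infinity> \<longrightarrow>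
      vector_field_01 A I chibar \<longrightarrow> field_C A 1 1 I chibar \<longrightarrow> N_chibar < \<infinity> \<longrightarrow>
      field_C A 1 1 I (\<lambda>c. chi0) \<longrightarrow> N_chi0 < \<infinity> \<longrightarrow>
      field_C A 3 2 I (\<lambda>c. u) \<longrightarrow>
      (\<forall>x. \<forall>t\<in>I. 0 < u x t) \<longrightarrow>
      (\<forall>c\<in>A. \<forall>x\<in>fst c. \<forall>t\<in>I.
         let v = (\<lambda>z. complex_of_real (u (chart_inv c z) t)); z = snd c x in
         complex_of_real (vector_derivative (u x) (at t within I)) =
           (\<Sum>i\<in>UNIV. \<Sum>j\<in>UNIV. G c x t $ i $ j * dz i (dzbar j v) z)
           + (\<Sum>k\<in>UNIV. chi c x t $ k * dz k v z)
           + (\<Sum>k\<in>UNIV. chibar c x t $ k * dzbar k v z)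
           + chi0 x t * complex_of_real (u x t)) \<longrightarrow>
      (\<forall>t\<^sub>1 t\<^sub>2. 0 < t\<^sub>1 \<longrightarrow> t\<^sub>1 < t\<^sub>2 \<longrightarrow> t\<^sub>2 < T \<longrightarrow>
         (SUP x. u x t\<^sub>1) \<le>
           ((t\<^sub>2 / t\<^sub>1) powr c\<^sub>2 * exp (c\<^sub>3 / (t\<^sub>2 - t\<^sub>1) + c\<^sub>1 * (t\<^sub>2 - t\<^sub>1))) * (INF x. u x t\<^sub>2))"
proof -
  obtain B :: "real \<Rightarrow> real" and C3 :: real where H:
    "\<And>Lam T N G chi chibar chi0 u x y. parabolic_solution A g S lam Lam T N G chi chibar chi0 u \<Longrightarrow>
      harnack_bound u T (B N) (B N) C3 x y"
    using global_harnack[OF assms(1-3)] by blast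
  \<comment> \<open>The sum of the norms dominates each of them and serves as \<open>N\<close>;
    \<open>enn2real\<close> loses nothing because the norms are assumed finite.\<close>
  define C where "C a b c d = B (enn2real a + enn2real b + enn2real c + enn2real d)" for a b c d
  show ?thesis
    unfolding Let_def
  \<comment> \<open>The first two constants coincide, as both come from the bound
    \<open>B * (1 / t + 1)\<close>; the third ignores the norms.\<close>
  proof (rule exI[of _ C], rule exI[of _ C], rule exI[of _ "\<lambda>_ _ _ _. C3"], intro allI impI, goal_cases)
    case (1 T G chi chibar chi0 u t\<^sub>1 t\<^sub>2)
    define N where "N = enn2real (field_norm S 3 1 {0..<T} G) + enn2real (field_norm S 1 1 {0..<T} (\<lambda>c. chi0))
      + enn2real (field_norm S 1 1 {0..<T} chi) + enn2real (field_norm S 1 1 {0..<T} chibar)"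
    have le: "a \<le> ennreal r" if "a < \<infinity>" "enn2real a \<le> r" for a r
      using that ennreal_leI[of "enn2real a" r] by simp
    have "parabolic_solution A g S lam Lam T N G chi chibar chi0 u"
    proof
      show "field_norm S 3 1 {0..<T} G \<le> ennreal N" "field_norm S 1 1 {0..<T} chi \<le> ennreal N"
        "field_norm S 1 1 {0..<T} chibar \<le> ennreal N" "field_norm S 1 1 {0..<T} (\<lambda>c. chi0) \<le> ennreal N"
        by (rule le; use 1 in \<open>simp add: N_def\<close>)+
    qed (use assms 1 in \<open>simp_all add: N_def\<close>)
    from SUP_le_INF_of_harnack_bound[OF H[OF this]] show ?case
      using 1 unfolding C_def N_def[symmetric] by simp
  qed
qed

end
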